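(* Let $\mathfrak{C}$ be a class of finite groups closed under subgroups, quotients, finite direct products and extensions. Let $(X,\bar R,\omega)$ be a presentation of a pro-$\mathfrak{C}$-group $G$, with $F=F_{\mathfrak{C}}(X)$, and let $F^{(1)}$ be the first step of the step-by-step ("pas-à-pas") construction of the simplicial pro-$\mathfrak{C}$-resolution of $G$ from this presentation. Then the crossed $F_0^{(1)}$-module $$\frac{NF_1^{(1)}}{d_2^2\,NF_2^{(1)}}\xrightarrow{\ d_1^1\ }F_0^{(1)}$$ coincides with (is isomorphic to) the pro-$\mathfrak{C}$-crossed $F$-module $(H/P,F,\partial)$ of the presentation.
   Context: $F_{\mathfrak{C}}(Y)$ is the free pro-$\mathfrak{C}$-group on a profinite space $Y$. A presentation $(X,\bar R,\omega)$ of $G$ consists of profinite spaces $X,\bar R$ and a continuous map $\omega:\bar R\to F=F_{\mathfrak{C}}(X)$ such that $1\to N(R)\to F\to G\to1$ is exact, where $N(R)$ is the closed normal subgroup generated by $R=\omega(\bar R)$. A pro-$\mathfrak{C}$-crossed module $(G_2,G_1,\partial)$ consists of pro-$\mathfrak{C}$-groups $G_1,G_2$, a continuous left action of $G_1$ on $G_2$, $(g_1,g_2)\mapsto{}^{g_1}g_2$, and a continuous homomorphism $\partial:G_2\to G_1$ with (CM1) $\partial({}^{g_1}g_2)=g_1\partial(g_2)g_1^{-1}$ and (CM2) ${}^{\partial(g_2)}g_2'=g_2g_2'g_2^{-1}$; if only CM1 holds it is a precrossed module. Isomorphisms of crossed $G_1$-modules are $G_1$-equivariant isomorphisms commuting with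 $\partial$. Crossed module of the presentation: $H$ is the closed normal closure of $\bar R$ in $F_{\mathfrak{C}}(X\cup\bar R)$ (disjoint union), on which $F$ acts by conjugation; $\Theta:H\to F$ is the restriction of the homomorphism $F_{\mathfrak{C}}(X\cup\bar R)\to F$ with $x\mapsto x$ ($x\in X$), $\rho\mapsto\omega(\rho)$ ($\rho\in\bar R$). $P$ is the Peiffer subgroup: the closed subgroup of $H$ generated by the Peiffer commutators $\langle a,b\rangle=aba^{-1}({}^{\Theta(a)}b)^{-1}$, $a,b\in H$. $\partial:H/P\to F$ is induced by $\Theta$. The simplicial pro-$\mathfrak{C}$-group $F^{(1)}$: $F^{(1)}_0=F=F_{\mathfrak{C}}(X)$, $F^{(1)}_1=F_{\mathfrak{C}}(X\cup\bar R)$, and in general $F^{(1)}_n$ is the free pro-$\mathfrak{C}$-group on $X\cup\bigcup_{t:[n]\twoheadrightarrow[1]}\bar R_t$, where $\bar R_t=\{\rho_t:\rho\in\bar R\}$ is a copy of $\bar R$ for each monotone surjection $t$. All faces and degeneracies fix $X$; $s_i(\rho_t)=\rho_{t\alpha_i}$ where $\alpha_i:[n+1]\to[n]$ is the monotone surjection hitting $i$ twice; with $\delta_i:[n-1]\to[n]$ the monotone injection missing $i$, $d_i(\rho_t)=\rho_{t\delta_i}$ if $t\delta_i$ is surjective, $d_i(\rho_t)=\omega(\rho)$ if $t\delta_i$ is constant $0$, and $d_i(\rho_t)=1$ if $t\delta_i$ is constant $1$. In particular $d_0^1(\rho)=1$, $d_1^1(\rho)=\omega(\rho)$ for $\rho\in\bar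 R$. $NF^{(1)}_n=\bigcap_{i=0}^{n-1}\ker(d_i^n)$ is the Moore complex; $F^{(1)}_0$ acts on $NF^{(1)}_1$ (and on its quotient) by ${}^gx=s_0(g)\,x\,s_0(g)^{-1}$. *)

theory Defs
  imports "HOL-Analysis.Analysis" "HOL-Algebra.Product_Groups"
begin

section \<open>Topological groups\<close>

record 'a tgroup = "'a monoid" +
  gtop :: "'a topology"

definition topological_group :: "'a tgroup \<Rightarrow> bool" where
  "topological_group G \<longleftrightarrow>
     group G \<and> topspace (gtop G) = carrier G \<and>
     continuous_map (prod_topology (gtop G) (gtop G)) (gtop G) (\<lambda>(x, y). x \<otimes>\<^bsub>G\<^esub> y) \<and>
     continuous_map (gtop G) (gtop G) (\<lambda>x. inv\<^bsub>G\<^esub> x)"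

definition cont_hom :: "'a tgroup \<Rightarrow> 'b tgroup \<Rightarrow> ('a \<Rightarrow> 'b) set" where
  "cont_hom G K = {h \<in> hom G K. continuous_map (gtop G) (gtop K) h}"

definition sub_tgroup :: "'a tgroup \<Rightarrow> 'a set \<Rightarrow> 'a tgroup" where
  "sub_tgroup G H = G\<lparr>carrier := H, gtop := subtopology (gtop G) H\<rparr>"

definition quot_topology :: "'a tgroup \<Rightarrow> 'a set \<Rightarrow> 'a set topology" where
  "quot_topology G N = topology (\<lambda>\<U>. \<U> \<subseteq> carrier (G Mod N) \<and>
     openin (gtop G) {x \<in> carrier G. N #>\<^bsub>G\<^esub> x \<in> \<U>})"

lemma openin_quot_topology:
  "openin (quot_topology G N) \<U> \<longleftrightarrow>
     \<U> \<subseteq> carrier (G Mod N) \<and> openin (gtop G) {x \<in> carrier G. N #>\<^bsub>G\<^esub> x \<in> \<U>}"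
proof -
  have 1: "{x \<in> carrier G. N #>\<^bsub>G\<^esub> x \<in> S \<inter> T} =
      {x \<in> carrier G. N #>\<^bsub>G\<^esub> x \<in> S} \<inter> {x \<in> carrier G. N #>\<^bsub>G\<^esub> x \<in> T}" for S T
    by auto
  have 2: "{x \<in> carrier G. N #>\<^bsub>G\<^esub> x \<in> \<Union>\<K>} =
      (\<Union>K\<in>\<K>. {x \<in> carrier G. N #>\<^bsub>G\<^esub> x \<in> K})" for \<K>
    by auto
  have "istopology (\<lambda>\<U>. \<U> \<subseteq> carrier (G Mod N) \<and>
     openin (gtop G) {x \<in> carrier G. N #>\<^bsub>G\<^esub> x \<in> \<U>})"
    unfolding istopology_def 1 2 by blast
  then show ?thesis
    by (simp add: quot_topology_def)
qed

definition quot_tgroup :: "'a tgroup \<Rightarrow> 'a set \<Rightarrow> 'a set tgroup" where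
  "quot_tgroup G N = \<lparr>carrier = carrier (G Mod N), monoid.mult = mult (G Mod N),
     one = one (G Mod N), gtop = quot_topology G N\<rparr>"

definition closed_gen :: "'a tgroup \<Rightarrow> 'a set \<Rightarrow> 'a set" where
  "closed_gen G S = \<Inter>{K. subgroup K G \<and> closedin (gtop G) K \<and> S \<subseteq> K}"

definition closed_normal_gen :: "'a tgroup \<Rightarrow> 'a set \<Rightarrow> 'a set" where
  "closed_normal_gen G S = \<Inter>{K. K \<lhd> G \<and> closedin (gtop G) K \<and> S \<subseteq> K}"


section \<open>Pro-C groups\<close>

text \<open>Every finite group is isomorphic to one carried by a set of natural numbers, so a class of
  finite groups is given by a set of representatives of that type. Membership of a group on any
  type is membership up to isomorphism.\<close>

definition in_class :: "nat monoid set \<Rightarrow> ('a, 'm) monoid_scheme \<Rightarrow> bool" where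
  "in_class C G \<longleftrightarrow> group G \<and> (\<exists>K\<in>C. G \<cong> K)"

text \<open>The empty product is included, so the trivial group belongs to the class.\<close>

definition group_class :: "nat monoid set \<Rightarrow> bool" where
  "group_class C \<longleftrightarrow>
     (\<forall>K\<in>C. group K \<and> finite (carrier K)) \<and>
     (\<forall>K\<in>C. \<forall>H. subgroup H K \<longrightarrow> in_class C (K\<lparr>carrier := H\<rparr>)) \<and>
     (\<forall>K\<in>C. \<forall>N. N \<lhd> K \<longrightarrow> in_class C (K Mod N)) \<and>
     (\<forall>(I :: nat set) A. finite I \<and> (\<forall>i\<in>I. A i \<in> C) \<longrightarrow> in_class C (product_group I A)) \<and>
     (\<forall>(K :: nat monoid) N. N \<lhd> K \<and> in_class C (K\<lparr>carrier := N\<rparr>) \<and> in_class C (K Mod N)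
        \<longrightarrow> in_class C K)"

text \<open>Inverse limits of groups in the class: equivalently, compact Hausdorff groups in which the
  open normal subgroups with quotient in the class form a base of neighbourhoods of the identity.\<close>

definition proC_group :: "nat monoid set \<Rightarrow> 'a tgroup \<Rightarrow> bool" where
  "proC_group C G \<longleftrightarrow>
     topological_group G \<and> compact_space (gtop G) \<and> Hausdorff_space (gtop G) \<and>
     (\<forall>U. openin (gtop G) U \<and> \<one>\<^bsub>G\<^esub> \<in> U \<longrightarrow>
        (\<exists>N. N \<lhd> G \<and> openin (gtop G) N \<and> in_class C (G Mod N) \<and> N \<subseteq> U))"

definition profinite_space :: "'y topology \<Rightarrow> bool" where
  "profinite_space Y \<longleftrightarrow> compact_space Y \<and> Hausdorff_space Y \<and>
     (\<forall>S. connectedin Y S \<longrightarrow> (\<exists>y. S \<subseteq> {y}))"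

text \<open>\<open>F\<close> with \<open>\<iota>\<close> is the free pro-C group on \<open>Y\<close>. A definition cannot quantify over types, so the
  test groups \<open>K\<close> are taken on the type \<open>'f + nat\<close>, which has room for all finite groups. As a
  pro-C group is the inverse limit of its quotients in the class, the universal property then
  holds for pro-C groups on every type: this is \<open>free_proC_universal\<close> below.\<close>

definition free_proC ::
  "nat monoid set \<Rightarrow> 'y topology \<Rightarrow> 'f tgroup \<Rightarrow> ('y \<Rightarrow> 'f) \<Rightarrow> bool" where
  "free_proC C Y F \<iota> \<longleftrightarrow>
     profinite_space Y \<and> proC_group C F \<and> continuous_map Y (gtop F) \<iota> \<and>
     (\<forall>(K :: ('f + nat) tgroup) f. proC_group C K \<and> continuous_map Y (gtop K) f \<longrightarrow>
        (\<exists>!h. h \<in> cont_hom F K \<inter> extensional (carrier F) \<and>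
              (\<forall>y\<in>topspace Y. h (\<iota> y) = f y)))"

lemma discrete_copy:
  fixes Q :: "('q, 'm) monoid_scheme" and i :: "'q \<Rightarrow> 'k"
  assumes C: "in_class C Q" and fin: "finite (carrier Q)" and i: "inj_on i (carrier Q)"
  obtains T :: "'k tgroup"
  where "proC_group C T" "gtop T = discrete_topology (i ` carrier Q)" "i \<in> iso Q T"
proof -
  interpret Q: group Q
    using C by (simp add: in_class_def)
  define j where "j = inv_into (carrier Q) i"
  have ji [simp]: "j (i x) = x" if "x \<in> carrier Q" for x
    using that i by (simp add: j_def)
  define T :: "'k tgroup" where "T = \<lparr>carrier = i ` carrier Q,
    monoid.mult = (\<lambda>x y. i (j x \<otimes>\<^bsub>Q\<^esub> j y)), one = i \<one>\<^bsub>Q\<^esub>,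
    gtop = discrete_topology (i ` carrier Q)\<rparr>"
  have T [simp]: "carrier T = i ` carrier Q" "mult T = (\<lambda>x y. i (j x \<otimes>\<^bsub>Q\<^esub> j y))"
    "one T = i \<one>\<^bsub>Q\<^esub>" "gtop T = discrete_topology (i ` carrier Q)"
    by (simp_all add: T_def)
  have isoi: "i \<in> iso Q T"
    using i by (auto simp: iso_def hom_def bij_betw_def)
  have grp: "group T"
  proof (rule groupI)
    fix x assume "x \<in> carrier T"
    then obtain a where a: "a \<in> carrier Q" "x = i a"
      by auto
    then show "\<exists>y\<in>carrier T. y \<otimes>\<^bsub>T\<^esub> x = \<one>\<^bsub>T\<^esub>"
      by (intro bexI[of _ "i (inv\<^bsub>Q\<^esub> a)"]) auto
  qed (auto simp: Q.m_assoc)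
  then interpret T: group T .
  have top: "topological_group T"
    using grp T.inv_closed T.m_closed
    by (auto simp: topological_group_def simp flip: prod_topology_discrete_topology)
  have "T Mod {\<one>\<^bsub>T\<^esub>} \<cong> T"
    using T.trivial_factor_iso is_iso_def by blast
  moreover have "T \<cong> Q"
    using Q.iso_sym is_isoI[OF isoi] by blast
  moreover obtain K where "K \<in> C" "Q \<cong> K"
    using C by (auto simp: in_class_def)
  ultimately have "K \<in> C" "T Mod {\<one>\<^bsub>T\<^esub>} \<cong> K"
    by (auto intro: iso_trans)
  moreover have nrm: "{\<one>\<^bsub>T\<^esub>} \<lhd> T"
    by (rule T.one_is_normal)
  ultimately have "in_class C (T Mod {\<one>\<^bsub>T\<^esub>})"
    using normal.factorgroup_is_group by (auto simp: in_class_def)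
  then have "proC_group C T"
    using top fin nrm T.one_closed unfolding proC_group_def
    by (auto simp: compact_space_discrete_topology Hausdorff_space_discrete_topology
        simp del: T(2,3) intro!: exI[of _ "{\<one>\<^bsub>T\<^esub>}"])
  with isoi that show thesis
    by (simp only: T)
qed

lemma free_proC_finite:
  fixes Q :: "('q, 'm) monoid_scheme"
  assumes C: "group_class C" and F: "free_proC C Y F \<iota>" and Q: "in_class C Q"
    and f: "continuous_map Y (discrete_topology (carrier Q)) f"
  shows "\<exists>h. h \<in> hom F Q \<and> continuous_map (gtop F) (discrete_topology (carrier Q)) h \<and>
      (\<forall>y\<in>topspace Y. h (\<iota> y) = f y) \<and>
      (\<forall>h'. h' \<in> hom F Q \<and> continuous_map (gtop F) (discrete_topology (carrier Q)) h' \<and>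
         (\<forall>y\<in>topspace Y. h' (\<iota> y) = f y) \<longrightarrow> (\<forall>x\<in>carrier F. h' x = h x))"
proof -
  interpret Q: group Q
    using Q by (simp add: in_class_def)
  obtain A e where A: "A \<in> C" and e: "e \<in> iso Q A"
    using Q by (auto simp: in_class_def is_iso_def)
  have fin: "finite (carrier Q)"
    using A e C by (auto simp: group_class_def iso_def dest: bij_betw_finite)
  define i :: "_ \<Rightarrow> 'b + nat" where "i = (\<lambda>x. Inr (e x))"
  have inj: "inj_on i (carrier Q)"
    using e by (auto simp: i_def iso_def bij_betw_def inj_on_def)
  obtain T where T: "proC_group C T" "gtop T = discrete_topology (i ` carrier Q)" "i \<in> iso Q T"
    by (rule discrete_copy[OF Q fin inj])
  define j where "j = inv_into (carrier Q) i"
  have j: "j \<in> iso T Q"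
    unfolding j_def using T(3) by (rule Q.iso_set_sym)
  have ji: "j (i x) = x" if "x \<in> carrier Q" for x
    using that inj by (simp add: j_def)
  have ci: "continuous_map (discrete_topology (carrier Q)) (gtop T) i"
    by (simp add: T(2))
  have cj: "continuous_map (gtop T) (discrete_topology (carrier Q)) j"
    by (auto simp: T(2) ji)
  have "continuous_map Y (gtop T) (i \<circ> f)"
    using f ci by (rule continuous_map_compose)
  then have ex1: "\<exists>!h. h \<in> cont_hom F T \<inter> extensional (carrier F) \<and>
        (\<forall>y\<in>topspace Y. h (\<iota> y) = (i \<circ> f) y)"
    using F T(1) unfolding free_proC_def by blast
  then obtain h where h: "h \<in> hom F T" "continuous_map (gtop F) (gtop T) h"
      "\<forall>y\<in>topspace Y. h (\<iota> y) = i (f y)" "h \<in> extensional (carrier F)"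
    by (auto simp: cont_hom_def)
  have fY: "f y \<in> carrier Q" if "y \<in> topspace Y" for y
    using continuous_map_image_subset_topspace[OF f] that by auto
  have topF: "topspace (gtop F) = carrier F" and grpF: "group F"
    using F by (auto simp: free_proC_def proC_group_def topological_group_def)
  have \<iota>: "\<iota> y \<in> carrier F" if "y \<in> topspace Y" for y
    using F that continuous_map_image_subset_topspace[of Y "gtop F" \<iota>] topF
    by (auto simp: free_proC_def)
  show ?thesis
  proof (intro exI[of _ "j \<circ> h"] conjI allI impI ballI)
    show "j \<circ> h \<in> hom F Q"
      using h(1) j by (auto simp: iso_def intro: hom_compose)
    show "continuous_map (gtop F) (discrete_topology (carrier Q)) (j \<circ> h)"
      using h(2) cj by (rule continuous_map_compose)
    show "(j \<circ> h) (\<iota> y) = f y" if "y \<in> topspace Y" for y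
      using h(3) that by (simp add: ji fY)
    fix h' x
    assume h': "h' \<in> hom F Q \<and> continuous_map (gtop F) (discrete_topology (carrier Q)) h' \<and>
        (\<forall>y\<in>topspace Y. h' (\<iota> y) = f y)" and x: "x \<in> carrier F"
    define h2 where "h2 = restrict (i \<circ> h') (carrier F)"
    have "i \<circ> h' \<in> hom F T"
      using h' T(3) by (auto simp: iso_def intro: hom_compose)
    then have "h2 \<in> hom F T"
      using group.is_monoid[OF grpF] monoid.m_closed
      by (fastforce simp: h2_def hom_def)
    moreover have "continuous_map (gtop F) (gtop T) (i \<circ> h')"
      using h' ci continuous_map_compose by blast
    then have "continuous_map (gtop F) (gtop T) h2"
      by (rule continuous_map_eq) (simp add: h2_def topF)
    moreover have "\<forall>y\<in>topspace Y. h2 (\<iota> y) = i (f y)"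
      using h' \<iota> by (simp add: h2_def)
    ultimately have "h2 = h"
      using ex1 h by (auto simp: cont_hom_def h2_def)
    then have "h x = i (h' x)"
      using x by (auto simp: h2_def)
    moreover have "h' x \<in> carrier Q"
      using h' x by (auto simp: hom_def)
    ultimately show "h' x = (j \<circ> h) x"
      by (simp add: ji)
  qed
qed

lemma free_proC_universal:
  fixes K :: "'k tgroup"
  assumes C: "group_class C" and F: "free_proC C Y F \<iota>" and K: "proC_group C K"
    and f: "continuous_map Y (gtop K) f"
  shows "\<exists>!h. h \<in> cont_hom F K \<inter> extensional (carrier F) \<and> (\<forall>y\<in>topspace Y. h (\<iota> y) = f y)"
proof -
  have tK: "topspace (gtop K) = carrier K" "Hausdorff_space (gtop K)" and grpK: "group K"
    and mK: "continuous_map (prod_topology (gtop K) (gtop K)) (gtop K) (\<lambda>(x, y). x \<otimes>\<^bsub>K\<^esub> y)"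
    using K by (auto simp: proC_group_def topological_group_def)
  interpret K: group K by (rule grpK)
  have topF: "topspace (gtop F) = carrier F" and grpF: "group F"
    using F by (auto simp: free_proC_def proC_group_def topological_group_def)
  interpret F: group F by (rule grpF)
  have \<iota>: "\<iota> y \<in> carrier F" if "y \<in> topspace Y" for y
    using F that continuous_map_image_subset_topspace[of Y "gtop F" \<iota>] topF
    by (auto simp: free_proC_def)
  have fK: "f y \<in> carrier K" if "y \<in> topspace Y" for y
    using that continuous_map_image_subset_topspace[OF f] tK by auto
  have trl: "openin (gtop K) {z \<in> carrier K. k \<otimes>\<^bsub>K\<^esub> z \<in> V}"
    and trr: "openin (gtop K) {z \<in> carrier K. z \<otimes>\<^bsub>K\<^esub> k \<in> V}"
    if "k \<in> carrier K" "openin (gtop K) V" for k V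
  proof -
    have "continuous_map (gtop K) (gtop K) ((\<lambda>(x, y). x \<otimes>\<^bsub>K\<^esub> y) \<circ> (\<lambda>z. (k, z)))"
      by (rule continuous_map_compose[OF _ mK]) (simp add: continuous_map_pairwise o_def that tK)
    then show "openin (gtop K) {z \<in> carrier K. k \<otimes>\<^bsub>K\<^esub> z \<in> V}"
      using that by (auto simp: continuous_map_def tK)
    have "continuous_map (gtop K) (gtop K) ((\<lambda>(x, y). x \<otimes>\<^bsub>K\<^esub> y) \<circ> (\<lambda>z. (z, k)))"
      by (rule continuous_map_compose[OF _ mK]) (simp add: continuous_map_pairwise o_def that tK)
    then show "openin (gtop K) {z \<in> carrier K. z \<otimes>\<^bsub>K\<^esub> k \<in> V}"
      using that by (auto simp: continuous_map_def tK)
  qed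
  define \<N> where "\<N> = {N. N \<lhd> K \<and> openin (gtop K) N \<and> in_class C (K Mod N)}"
  have base: "\<exists>N\<in>\<N>. N \<subseteq> U" if "openin (gtop K) U" "\<one>\<^bsub>K\<^esub> \<in> U" for U
    using K that unfolding proC_group_def \<N>_def by blast
  have nrm: "N \<lhd> K" and sub: "subgroup N K" if "N \<in> \<N>" for N
    using that by (auto simp: \<N>_def normal_imp_subgroup)
  have qhom: "(\<lambda>k. N #>\<^bsub>K\<^esub> k) \<in> hom K (K Mod N)" if "N \<in> \<N>" for N
    using normal.r_coset_hom_Mod[OF nrm[OF that]] .
  have coset_eq: "N #>\<^bsub>K\<^esub> a = N #>\<^bsub>K\<^esub> b \<longleftrightarrow> a \<otimes>\<^bsub>K\<^esub> inv\<^bsub>K\<^esub> b \<in> N"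
    if "N \<in> \<N>" "a \<in> carrier K" "b \<in> carrier K" for N a b
  proof
    assume "N #>\<^bsub>K\<^esub> a = N #>\<^bsub>K\<^esub> b"
    then have "a \<in> N #>\<^bsub>K\<^esub> b"
      using K.rcos_self[OF that(2) sub[OF that(1)]] by simp
    then show "a \<otimes>\<^bsub>K\<^esub> inv\<^bsub>K\<^esub> b \<in> N"
      using subgroup.rcos_module_imp[OF sub[OF that(1)] grpK that(3)] by simp
  next
    assume "a \<otimes>\<^bsub>K\<^esub> inv\<^bsub>K\<^esub> b \<in> N"
    then have "a \<in> N #>\<^bsub>K\<^esub> b"
      using subgroup.rcos_module_rev[OF sub[OF that(1)] grpK that(3,2)] by simp
    then show "N #>\<^bsub>K\<^esub> a = N #>\<^bsub>K\<^esub> b"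
      using K.repr_independence[OF _ that(3) sub[OF that(1)]] by simp
  qed
  have qcont: "continuous_map (gtop K) (discrete_topology (carrier (K Mod N))) (\<lambda>k. N #>\<^bsub>K\<^esub> k)"
    if N: "N \<in> \<N>" for N
    unfolding continuous_map_def
  proof (intro conjI allI impI)
    show "(\<lambda>k. N #>\<^bsub>K\<^esub> k) \<in> topspace (gtop K) \<rightarrow> topspace (discrete_topology (carrier (K Mod N)))"
      using qhom[OF N] by (simp add: tK hom_def)
    fix U
    show "openin (gtop K) {k \<in> topspace (gtop K). N #>\<^bsub>K\<^esub> k \<in> U}"
    proof (subst openin_subopen, intro ballI)
      fix k assume "k \<in> {k \<in> topspace (gtop K). N #>\<^bsub>K\<^esub> k \<in> U}"
      then have k: "k \<in> carrier K" "N #>\<^bsub>K\<^esub> k \<in> U"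
        by (auto simp: tK)
      have "openin (gtop K) {z \<in> carrier K. z \<otimes>\<^bsub>K\<^esub> inv\<^bsub>K\<^esub> k \<in> N}"
        using trr[of "inv\<^bsub>K\<^esub> k" N] k N by (auto simp: \<N>_def)
      moreover have "k \<in> {z \<in> carrier K. z \<otimes>\<^bsub>K\<^esub> inv\<^bsub>K\<^esub> k \<in> N}"
        using k subgroup.one_closed[OF sub[OF N]] by simp
      moreover have "{z \<in> carrier K. z \<otimes>\<^bsub>K\<^esub> inv\<^bsub>K\<^esub> k \<in> N} \<subseteq> {k \<in> topspace (gtop K). N #>\<^bsub>K\<^esub> k \<in> U}"
        using coset_eq[OF N _ k(1)] k by (force simp: tK)
      ultimately show "\<exists>T. openin (gtop K) T \<and> k \<in> T \<and> T \<subseteq> {k \<in> topspace (gtop K). N #>\<^bsub>K\<^esub> k \<in> U}"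
        by blast
    qed
  qed
  define P where "P N h \<longleftrightarrow> h \<in> hom F (K Mod N) \<and>
      continuous_map (gtop F) (discrete_topology (carrier (K Mod N))) h \<and>
      (\<forall>y\<in>topspace Y. h (\<iota> y) = N #>\<^bsub>K\<^esub> f y)" for N h
  have "\<exists>h. P N h \<and> (\<forall>h'. P N h' \<longrightarrow> (\<forall>x\<in>carrier F. h' x = h x))" if N: "N \<in> \<N>" for N
  proof -
    have "continuous_map Y (discrete_topology (carrier (K Mod N))) (\<lambda>y. N #>\<^bsub>K\<^esub> f y)"
      using continuous_map_compose[OF f qcont[OF N]] by (simp add: o_def)
    moreover have "in_class C (K Mod N)"
      using N by (simp add: \<N>_def)
    ultimately show ?thesis
      using free_proC_finite[OF C F] unfolding P_def by (simp only: conj_assoc)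
  qed
  then obtain h where hP: "\<And>N. N \<in> \<N> \<Longrightarrow> P N (h N)"
    and huniq: "\<And>N h' x. \<lbrakk>N \<in> \<N>; P N h'; x \<in> carrier F\<rbrakk> \<Longrightarrow> h' x = h N x"
    by metis
  have sep: "a = b" if a: "a \<in> carrier K" and b: "b \<in> carrier K"
    and ab: "\<And>N. N \<in> \<N> \<Longrightarrow> N #>\<^bsub>K\<^esub> a = N #>\<^bsub>K\<^esub> b" for a b
  proof (rule ccontr)
    assume "a \<noteq> b"
    then have "a \<otimes>\<^bsub>K\<^esub> inv\<^bsub>K\<^esub> b \<noteq> \<one>\<^bsub>K\<^esub>"
      using a b K.inv_unique' K.inv_inv by (metis K.inv_closed K.inv_equality)
    then obtain U where "openin (gtop K) U" "\<one>\<^bsub>K\<^esub> \<in> U" "a \<otimes>\<^bsub>K\<^esub> inv\<^bsub>K\<^esub> b \<notin> U"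
      using tK a b unfolding Hausdorff_space_def disjnt_iff
      by (metis K.inv_closed K.m_closed K.one_closed)
    then show False
      using base ab coset_eq a b by (meson subsetD)
  qed
  have compat: "h M x = M #>\<^bsub>K\<^esub> k"
    if M: "M \<in> \<N>" and N: "N \<in> \<N>" and NM: "N \<subseteq> M" and x: "x \<in> carrier F"
      and k: "k \<in> carrier K" "h N x = N #>\<^bsub>K\<^esub> k" for M N x k
  proof -
    obtain r where r: "r \<in> hom (K Mod N) (K Mod M)"
      and rq: "\<And>z. z \<in> carrier K \<Longrightarrow> r (N #>\<^bsub>K\<^esub> z) = M #>\<^bsub>K\<^esub> z"
    proof (rule FactGroup_universal[OF qhom[OF M] nrm[OF N]])
      show "M #>\<^bsub>K\<^esub> a = M #>\<^bsub>K\<^esub> b"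
        if "a \<in> carrier K" "b \<in> carrier K" "N #>\<^bsub>K\<^esub> a = N #>\<^bsub>K\<^esub> b" for a b
        using that coset_eq[OF M] coset_eq[OF N] NM by blast
    qed blast
    have "P M (r \<circ> h N)"
      unfolding P_def
    proof (intro conjI ballI)
      show "r \<circ> h N \<in> hom F (K Mod M)"
        using hP[OF N] r by (auto simp: P_def intro: hom_compose)
      have "continuous_map (discrete_topology (carrier (K Mod N)))
          (discrete_topology (carrier (K Mod M))) r"
        using r by (auto simp: hom_def)
      then show "continuous_map (gtop F) (discrete_topology (carrier (K Mod M))) (r \<circ> h N)"
        using hP[OF N] continuous_map_compose unfolding P_def by blast
      show "(r \<circ> h N) (\<iota> y) = M #>\<^bsub>K\<^esub> f y" if "y \<in> topspace Y" for y
        using hP[OF N] that rq fK by (simp add: P_def)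
    qed
    then have "r (h N x) = h M x"
      using huniq[OF M _ x] by fastforce
    then show ?thesis
      using rq k by simp
  qed
  have lift: "\<exists>k. k \<in> carrier K \<and> (\<forall>N\<in>\<N>. h N x = N #>\<^bsub>K\<^esub> k)" if x: "x \<in> carrier F" for x
  proof -
    define Z where "Z N = {k \<in> carrier K. h N x = N #>\<^bsub>K\<^esub> k}" for N
    have Zcl: "closedin (gtop K) (Z N)" if N: "N \<in> \<N>" for N
    proof -
      have "h N x \<in> carrier (K Mod N)"
        using hP[OF N] x by (auto simp: P_def hom_def)
      then have "closedin (gtop K) {k \<in> topspace (gtop K). N #>\<^bsub>K\<^esub> k \<in> {h N x}}"
        by (intro closedin_continuous_map_preimage[OF qcont[OF N]]) simp
      then show ?thesis
        by (simp add: Z_def tK eq_commute)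
    qed
    have Zne: "Z N \<noteq> {}" if N: "N \<in> \<N>" for N
    proof -
      have "h N x \<in> carrier (K Mod N)"
        using hP[OF N] x by (auto simp: P_def hom_def)
      then show ?thesis
        by (auto simp: Z_def FactGroup_def RCOSETS_def)
    qed
    have "\<Inter>(Z ` \<M>) \<noteq> {}" if \<M>: "finite \<M>" "\<M> \<subseteq> \<N>" "\<M> \<noteq> {}" for \<M>
    proof -
      have "openin (gtop K) (\<Inter>\<M>)" "\<one>\<^bsub>K\<^esub> \<in> \<Inter>\<M>"
        using \<M> subgroup.one_closed[OF sub] by (auto simp: \<N>_def intro!: openin_Inter)
      then obtain N where N: "N \<in> \<N>" "N \<subseteq> \<Inter>\<M>"
        using base by blast
      obtain k where "k \<in> Z N"
        using Zne[OF N(1)] by blast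
      then have "k \<in> Z M" if "M \<in> \<M>" for M
        using compat[of M N x k] that N \<M> x by (auto simp: Z_def)
      then show ?thesis
        by blast
    qed
    then have fip: "\<Inter>\<F> \<noteq> {}" if "finite \<F>" "\<F> \<subseteq> Z ` \<N>" for \<F>
      using that finite_subset_image[OF that] by (cases "\<F> = {}") force+
    have "compact_space (gtop K)"
      using K by (simp add: proC_group_def)
    then have "\<Inter>(Z ` \<N>) \<noteq> {}"
      unfolding compact_space_fip using Zcl fip by blast
    then obtain k where k: "\<And>N. N \<in> \<N> \<Longrightarrow> k \<in> Z N"
      by blast
    obtain N where "N \<in> \<N>"
      using base[of "carrier K"] openin_topspace[of "gtop K"] tK by auto
    then show ?thesis
      using k by (auto simp: Z_def)
  qed
  then obtain g where gK: "\<And>x. x \<in> carrier F \<Longrightarrow> g x \<in> carrier K"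
    and gN: "\<And>x N. \<lbrakk>x \<in> carrier F; N \<in> \<N>\<rbrakk> \<Longrightarrow> h N x = N #>\<^bsub>K\<^esub> g x"
    by metis
  have ghom: "g \<in> hom F K"
  proof (rule homI)
    fix x y assume x: "x \<in> carrier F" and y: "y \<in> carrier F"
    show "g (x \<otimes>\<^bsub>F\<^esub> y) = g x \<otimes>\<^bsub>K\<^esub> g y"
    proof (rule sep)
      fix N assume N: "N \<in> \<N>"
      have "N #>\<^bsub>K\<^esub> g (x \<otimes>\<^bsub>F\<^esub> y) = h N (x \<otimes>\<^bsub>F\<^esub> y)"
        using gN N x y by simp
      also have "\<dots> = h N x \<otimes>\<^bsub>K Mod N\<^esub> h N y"
        using hP[OF N] x y by (simp add: P_def hom_def del: mult_FactGroup)
      also have "\<dots> = N #>\<^bsub>K\<^esub> (g x \<otimes>\<^bsub>K\<^esub> g y)"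
        using gN N x y gK qhom[OF N] by (simp add: hom_def del: mult_FactGroup)
      finally show "N #>\<^bsub>K\<^esub> g (x \<otimes>\<^bsub>F\<^esub> y) = N #>\<^bsub>K\<^esub> (g x \<otimes>\<^bsub>K\<^esub> g y)" .
    qed (use x y gK in auto)
  qed (rule gK)
  have gcont: "continuous_map (gtop F) (gtop K) g"
    unfolding continuous_map_def
  proof (intro conjI allI impI)
    show "g \<in> topspace (gtop F) \<rightarrow> topspace (gtop K)"
      using gK by (simp add: topF tK)
    fix V assume V: "openin (gtop K) V"
    show "openin (gtop F) {x \<in> topspace (gtop F). g x \<in> V}"
    proof (subst openin_subopen, intro ballI)
      fix x assume "x \<in> {x \<in> topspace (gtop F). g x \<in> V}"
      then have x: "x \<in> carrier F" "g x \<in> V"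
        by (auto simp: topF)
      have "openin (gtop K) {z \<in> carrier K. z \<otimes>\<^bsub>K\<^esub> g x \<in> V}"
        using trr[OF gK[OF x(1)] V] .
      then obtain N where N: "N \<in> \<N>" "N \<subseteq> {z \<in> carrier K. z \<otimes>\<^bsub>K\<^esub> g x \<in> V}"
        using base[of "{z \<in> carrier K. z \<otimes>\<^bsub>K\<^esub> g x \<in> V}"] x gK by auto
      have hx: "h N x \<in> carrier (K Mod N)"
        using hP[OF N(1)] x by (auto simp: P_def hom_def)
      then have "openin (gtop F) {z \<in> topspace (gtop F). h N z \<in> {h N x}}"
        using hP[OF N(1)] by (intro openin_continuous_map_preimage) (auto simp: P_def)
      moreover have "g z \<in> V" if z: "z \<in> carrier F" "h N z = h N x" for z
      proof -
        have "g z \<otimes>\<^bsub>K\<^esub> inv\<^bsub>K\<^esub> g x \<in> N"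
          using coset_eq[OF N(1) gK[OF z(1)] gK[OF x(1)]] gN[OF z(1) N(1)] gN[OF x(1) N(1)] z(2)
          by simp
        then have "g z \<otimes>\<^bsub>K\<^esub> inv\<^bsub>K\<^esub> g x \<otimes>\<^bsub>K\<^esub> g x \<in> V"
          using N(2) by blast
        then show ?thesis
          using gK[OF z(1)] gK[OF x(1)] by (simp add: K.m_assoc)
      qed
      ultimately show "\<exists>T. openin (gtop F) T \<and> x \<in> T \<and> T \<subseteq> {x \<in> topspace (gtop F). g x \<in> V}"
        using x by (intro exI[of _ "{z \<in> topspace (gtop F). h N z \<in> {h N x}}"]) (auto simp: topF)
    qed
  qed
  have g\<iota>: "g (\<iota> y) = f y" if y: "y \<in> topspace Y" for y
  proof (rule sep)
    show "N #>\<^bsub>K\<^esub> g (\<iota> y) = N #>\<^bsub>K\<^esub> f y" if "N \<in> \<N>" for N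
      using hP[OF that] gN[OF \<iota>[OF y] that] y by (simp add: P_def)
  qed (use y \<iota> gK fK in auto)
  have uniq: "g' x = g x" if g': "g' \<in> cont_hom F K" "\<forall>y\<in>topspace Y. g' (\<iota> y) = f y"
    and x: "x \<in> carrier F" for g' x
  proof (rule sep)
    fix N assume N: "N \<in> \<N>"
    have "P N ((\<lambda>k. N #>\<^bsub>K\<^esub> k) \<circ> g')"
      unfolding P_def
    proof (intro conjI ballI)
      show "(\<lambda>k. N #>\<^bsub>K\<^esub> k) \<circ> g' \<in> hom F (K Mod N)"
        by (rule hom_compose[OF _ qhom[OF N]]) (use g' in \<open>simp add: cont_hom_def\<close>)
      show "continuous_map (gtop F) (discrete_topology (carrier (K Mod N))) ((\<lambda>k. N #>\<^bsub>K\<^esub> k) \<circ> g')"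
        by (rule continuous_map_compose[OF _ qcont[OF N]]) (use g' in \<open>simp add: cont_hom_def\<close>)
    qed (use g' in simp)
    from huniq[OF N this x] show "N #>\<^bsub>K\<^esub> g' x = N #>\<^bsub>K\<^esub> g x"
      using gN[OF x N] by simp
  qed (use g' x gK in \<open>auto simp: cont_hom_def hom_def\<close>)
  define g0 where "g0 = restrict g (carrier F)"
  have "g0 \<in> hom F K"
    using ghom by (auto simp: g0_def hom_def)
  moreover have "continuous_map (gtop F) (gtop K) g0"
    using gcont by (rule continuous_map_eq) (simp add: g0_def topF)
  ultimately have "g0 \<in> cont_hom F K \<inter> extensional (carrier F) \<and> (\<forall>y\<in>topspace Y. g0 (\<iota> y) = f y)"
    using g\<iota> \<iota> by (auto simp: cont_hom_def g0_def)
  moreover have "g' = g0" if "g' \<in> cont_hom F K \<inter> extensional (carrier F)"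
      "\<forall>y\<in>topspace Y. g' (\<iota> y) = f y" for g'
    using that uniq[of g'] by (intro extensionalityI[of _ "carrier F"]) (auto simp: g0_def)
  ultimately show ?thesis
    by (intro ex1I[of _ g0]) auto
qed

definition free_ext ::
  "'y topology \<Rightarrow> 'f tgroup \<Rightarrow> ('y \<Rightarrow> 'f) \<Rightarrow> 'k tgroup \<Rightarrow> ('y \<Rightarrow> 'k) \<Rightarrow> 'f \<Rightarrow> 'k" where
  "free_ext Y F \<iota> K f = (THE h. h \<in> cont_hom F K \<inter> extensional (carrier F) \<and>
     (\<forall>y\<in>topspace Y. h (\<iota> y) = f y))"


section \<open>Presentations\<close>

definition proC_presentation ::
  "nat monoid set \<Rightarrow> 'x topology \<Rightarrow> 'r topology \<Rightarrow> ('r \<Rightarrow> 'f) \<Rightarrow> 'f tgroup \<Rightarrow> ('x \<Rightarrow> 'f) \<Rightarrow>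
   'g tgroup \<Rightarrow> ('f \<Rightarrow> 'g) \<Rightarrow> bool" where
  "proC_presentation C X R \<omega> F \<iota> G p \<longleftrightarrow>
     profinite_space X \<and> profinite_space R \<and> free_proC C X F \<iota> \<and> proC_group C G \<and>
     continuous_map R (gtop F) \<omega> \<and>
     p \<in> cont_hom F G \<and> p ` carrier F = carrier G \<and>
     kernel F G p = closed_normal_gen F (\<omega> ` topspace R)"

definition disjoint_sum :: "'a topology \<Rightarrow> 'b topology \<Rightarrow> ('a + 'b) topology" where
  "disjoint_sum X Y = topology (\<lambda>U. U \<subseteq> Inl ` topspace X \<union> Inr ` topspace Y \<and>
     openin X {x. Inl x \<in> U} \<and> openin Y {y. Inr y \<in> U})"

lemma openin_disjoint_sum:
  "openin (disjoint_sum X Y) U \<longleftrightarrow> U \<subseteq> Inl ` topspace X \<union> Inr ` topspace Y \<and>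
     openin X {x. Inl x \<in> U} \<and> openin Y {y. Inr y \<in> U}"
proof -
  have 1: "{x. Inl x \<in> S \<inter> T} = {x. Inl x \<in> S} \<inter> {x. Inl x \<in> T}"
    "{y. Inr y \<in> S \<inter> T} = {y. Inr y \<in> S} \<inter> {y. Inr y \<in> T}" for S T :: "('a + 'b) set"
    by auto
  have 2: "{x. Inl x \<in> \<Union>\<K>} = (\<Union>K\<in>\<K>. {x. Inl x \<in> K})"
    "{y. Inr y \<in> \<Union>\<K>} = (\<Union>K\<in>\<K>. {y. Inr y \<in> K})" for \<K> :: "('a + 'b) set set"
    by auto
  have "istopology (\<lambda>U. U \<subseteq> Inl ` topspace X \<union> Inr ` topspace Y \<and>
     openin X {x. Inl x \<in> U} \<and> openin Y {y. Inr y \<in> U})"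
    unfolding istopology_def 1 2 by blast
  then show ?thesis
    by (simp add: disjoint_sum_def)
qed


section \<open>Crossed modules\<close>

text \<open>The crossed module \<open>cm_bd : cm_top \<rightarrow> cm_base\<close>.\<close>

record ('m, 'g) crossed =
  cm_top :: "'m tgroup"
  cm_base :: "'g tgroup"
  cm_act :: "'g \<Rightarrow> 'm \<Rightarrow> 'm"
  cm_bd :: "'m \<Rightarrow> 'g"

definition proC_crossed_module :: "nat monoid set \<Rightarrow> ('m, 'g) crossed \<Rightarrow> bool" where
  "proC_crossed_module C A \<longleftrightarrow>
     (let M = cm_top A; G = cm_base A; act = cm_act A; bd = cm_bd A in
      proC_group C M \<and> proC_group C G \<and> bd \<in> cont_hom M G \<and>
      (\<forall>g\<in>carrier G. act g \<in> hom M M) \<and>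
      (\<forall>m\<in>carrier M. act \<one>\<^bsub>G\<^esub> m = m) \<and>
      (\<forall>g\<in>carrier G. \<forall>g'\<in>carrier G. \<forall>m\<in>carrier M. act (g \<otimes>\<^bsub>G\<^esub> g') m = act g (act g' m)) \<and>
      continuous_map (prod_topology (gtop G) (gtop M)) (gtop M) (\<lambda>(g, m). act g m) \<and>
      (\<forall>g\<in>carrier G. \<forall>m\<in>carrier M. bd (act g m) = g \<otimes>\<^bsub>G\<^esub> bd m \<otimes>\<^bsub>G\<^esub> inv\<^bsub>G\<^esub> g) \<and>
      (\<forall>m\<in>carrier M. \<forall>m'\<in>carrier M. act (bd m) m' = m \<otimes>\<^bsub>M\<^esub> m' \<otimes>\<^bsub>M\<^esub> inv\<^bsub>M\<^esub> m))"

definition crossed_iso_over_base :: "('m, 'g) crossed \<Rightarrow> ('n, 'g) crossed \<Rightarrow> bool" where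
  "crossed_iso_over_base A B \<longleftrightarrow> cm_base A = cm_base B \<and>
     (\<exists>f. f \<in> iso (cm_top A) (cm_top B) \<and>
          homeomorphic_map (gtop (cm_top A)) (gtop (cm_top B)) f \<and>
          (\<forall>g\<in>carrier (cm_base A). \<forall>m\<in>carrier (cm_top A).
             f (cm_act A g m) = cm_act B g (f m)) \<and>
          (\<forall>m\<in>carrier (cm_top A). cm_bd B (f m) = cm_bd A m))"

definition conj_by :: "'a tgroup \<Rightarrow> 'a \<Rightarrow> 'a \<Rightarrow> 'a" where
  "conj_by G a x = a \<otimes>\<^bsub>G\<^esub> x \<otimes>\<^bsub>G\<^esub> inv\<^bsub>G\<^esub> a"


section \<open>The crossed module of a presentation\<close>

text \<open>Here \<open>F\<close> with \<open>\<iota>\<close> is free on \<open>X\<close>, and \<open>E\<close> with \<open>\<epsilon>\<close> is free on the disjoint union of \<open>X\<close>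
  and \<open>R\<close>. The group \<open>F\<close> acts on \<open>H\<close> by conjugation through the homomorphism \<open>pres_incl\<close>
  from \<open>F\<close> to \<open>E\<close> that fixes \<open>X\<close>.\<close>

definition pres_H :: "'r topology \<Rightarrow> 'e tgroup \<Rightarrow> ('x + 'r \<Rightarrow> 'e) \<Rightarrow> 'e set" where
  "pres_H R E \<epsilon> = closed_normal_gen E ((\<lambda>\<rho>. \<epsilon> (Inr \<rho>)) ` topspace R)"

definition pres_incl ::
  "'x topology \<Rightarrow> 'f tgroup \<Rightarrow> ('x \<Rightarrow> 'f) \<Rightarrow> 'e tgroup \<Rightarrow> ('x + 'r \<Rightarrow> 'e) \<Rightarrow> 'f \<Rightarrow> 'e" where
  "pres_incl X F \<iota> E \<epsilon> = free_ext X F \<iota> E (\<lambda>x. \<epsilon> (Inl x))"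

definition pres_\<Theta> ::
  "'x topology \<Rightarrow> 'r topology \<Rightarrow> ('r \<Rightarrow> 'f) \<Rightarrow> 'f tgroup \<Rightarrow> ('x \<Rightarrow> 'f) \<Rightarrow>
   'e tgroup \<Rightarrow> ('x + 'r \<Rightarrow> 'e) \<Rightarrow> 'e \<Rightarrow> 'f" where
  "pres_\<Theta> X R \<omega> F \<iota> E \<epsilon> = free_ext (disjoint_sum X R) E \<epsilon> F (case_sum \<iota> \<omega>)"

definition pres_P ::
  "'x topology \<Rightarrow> 'r topology \<Rightarrow> ('r \<Rightarrow> 'f) \<Rightarrow> 'f tgroup \<Rightarrow> ('x \<Rightarrow> 'f) \<Rightarrow>
   'e tgroup \<Rightarrow> ('x + 'r \<Rightarrow> 'e) \<Rightarrow> 'e set" where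
  "pres_P X R \<omega> F \<iota> E \<epsilon> = closed_gen (sub_tgroup E (pres_H R E \<epsilon>))
     {a \<otimes>\<^bsub>E\<^esub> b \<otimes>\<^bsub>E\<^esub> inv\<^bsub>E\<^esub> a \<otimes>\<^bsub>E\<^esub>
        inv\<^bsub>E\<^esub> (conj_by E (pres_incl X F \<iota> E \<epsilon> (pres_\<Theta> X R \<omega> F \<iota> E \<epsilon> a)) b) |
      a b. a \<in> pres_H R E \<epsilon> \<and> b \<in> pres_H R E \<epsilon>}"

definition pres_crossed ::
  "'x topology \<Rightarrow> 'r topology \<Rightarrow> ('r \<Rightarrow> 'f) \<Rightarrow> 'f tgroup \<Rightarrow> ('x \<Rightarrow> 'f) \<Rightarrow>
   'e tgroup \<Rightarrow> ('x + 'r \<Rightarrow> 'e) \<Rightarrow> ('e set, 'f) crossed" where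
  "pres_crossed X R \<omega> F \<iota> E \<epsilon> = \<lparr>
     cm_top = quot_tgroup (sub_tgroup E (pres_H R E \<epsilon>)) (pres_P X R \<omega> F \<iota> E \<epsilon>),
     cm_base = F,
     cm_act = (\<lambda>g c. conj_by E (pres_incl X F \<iota> E \<epsilon> g) ` c),
     cm_bd = (\<lambda>c. the_elem (pres_\<Theta> X R \<omega> F \<iota> E \<epsilon> ` c))\<rparr>"


section \<open>Simplicial groups\<close>

text \<open>\<open>sface S n i\<close> is the face \<open>d_i\<close> with source in degree \<open>n\<close> (used for \<open>n \<ge> 1\<close>), and
  \<open>sdegen S n i\<close> is the degeneracy \<open>s_i\<close> with source in degree \<open>n\<close>.\<close>

record 'a simplicial_tgroup =
  sobj :: "nat \<Rightarrow> 'a tgroup"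
  sface :: "nat \<Rightarrow> nat \<Rightarrow> 'a \<Rightarrow> 'a"
  sdegen :: "nat \<Rightarrow> nat \<Rightarrow> 'a \<Rightarrow> 'a"

definition moore :: "'a simplicial_tgroup \<Rightarrow> nat \<Rightarrow> 'a set" where
  "moore S n = {x \<in> carrier (sobj S n). \<forall>i<n. sface S n i x = \<one>\<^bsub>sobj S (n - 1)\<^esub>}"

definition moore_crossed :: "'a simplicial_tgroup \<Rightarrow> ('a set, 'a) crossed" where
  "moore_crossed S = \<lparr>
     cm_top = quot_tgroup (sub_tgroup (sobj S 1) (moore S 1)) (sface S 2 2 ` moore S 2),
     cm_base = sobj S 0,
     cm_act = (\<lambda>g c. conj_by (sobj S 1) (sdegen S 0 0 g) ` c),
     cm_bd = (\<lambda>c. the_elem (sface S 1 1 ` c))\<rparr>"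


section \<open>The first step of the pas-a-pas construction\<close>

text \<open>The ordinal \<open>[n]\<close> is \<open>{..n}\<close>.\<close>

definition mono_surj :: "nat \<Rightarrow> nat \<Rightarrow> (nat \<Rightarrow> nat) set" where
  "mono_surj n m = {t \<in> {..n} \<rightarrow>\<^sub>E {..m}. mono_on {..n} t \<and> t ` {..n} = {..m}}"

definition coface :: "nat \<Rightarrow> nat \<Rightarrow> nat" where
  "coface i j = (if j < i then j else Suc j)"

definition codegen :: "nat \<Rightarrow> nat \<Rightarrow> nat" where
  "codegen i j = (if j \<le> i then j else j - 1)"

text \<open>\<open>Inr (t, \<rho>)\<close> is the generator \<open>\<rho>\<^sub>t\<close>.\<close>

definition gen_space ::
  "'x topology \<Rightarrow> 'r topology \<Rightarrow> nat \<Rightarrow> ('x + (nat \<Rightarrow> nat) \<times> 'r) topology" where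
  "gen_space X R n = disjoint_sum X (sum_topology (\<lambda>t. R) (mono_surj n 1))"

text \<open>The word \<open>\<omega>(\<rho>)\<close> of \<open>F\<close> is read in degree \<open>n - 1\<close> through the homomorphism that fixes
  \<open>X\<close>.\<close>

definition face_gen ::
  "'x topology \<Rightarrow> ('r \<Rightarrow> 'f) \<Rightarrow> (nat \<Rightarrow> 'f tgroup) \<Rightarrow> (nat \<Rightarrow> 'x + (nat \<Rightarrow> nat) \<times> 'r \<Rightarrow> 'f) \<Rightarrow>
   nat \<Rightarrow> nat \<Rightarrow> 'x + (nat \<Rightarrow> nat) \<times> 'r \<Rightarrow> 'f" where
  "face_gen X \<omega> L \<eta> n i y = (case y of
     Inl x \<Rightarrow> \<eta> (n - 1) (Inl x)
   | Inr (t, \<rho>) \<Rightarrow>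
       (let u = compose {..n - 1} t (coface i) in
        if u \<in> mono_surj (n - 1) 1 then \<eta> (n - 1) (Inr (u, \<rho>))
        else if u ` {..n - 1} = {0} then
          free_ext X (L 0) (\<lambda>x. \<eta> 0 (Inl x)) (L (n - 1)) (\<lambda>x. \<eta> (n - 1) (Inl x)) (\<omega> \<rho>)
        else \<one>\<^bsub>L (n - 1)\<^esub>))"

definition degen_gen ::
  "(nat \<Rightarrow> 'x + (nat \<Rightarrow> nat) \<times> 'r \<Rightarrow> 'f) \<Rightarrow>
   nat \<Rightarrow> nat \<Rightarrow> 'x + (nat \<Rightarrow> nat) \<times> 'r \<Rightarrow> 'f" where
  "degen_gen \<eta> n i y = (case y of
     Inl x \<Rightarrow> \<eta> (Suc n) (Inl x)
   | Inr (t, \<rho>) \<Rightarrow> \<eta> (Suc n) (Inr (compose {..Suc n} t (codegen i), \<rho>)))"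

text \<open>Here \<open>L n\<close> with \<open>\<eta> n\<close> is free on \<open>gen_space X R n\<close>.\<close>

definition pas_a_pas1 ::
  "'x topology \<Rightarrow> 'r topology \<Rightarrow> ('r \<Rightarrow> 'f) \<Rightarrow> (nat \<Rightarrow> 'f tgroup) \<Rightarrow>
   (nat \<Rightarrow> 'x + (nat \<Rightarrow> nat) \<times> 'r \<Rightarrow> 'f) \<Rightarrow> 'f simplicial_tgroup" where
  "pas_a_pas1 X R \<omega> L \<eta> = \<lparr>
     sobj = L,
     sface = (\<lambda>n i. free_ext (gen_space X R n) (L n) (\<eta> n) (L (n - 1)) (face_gen X \<omega> L \<eta> n i)),
     sdegen = (\<lambda>n i. free_ext (gen_space X R n) (L n) (\<eta> n) (L (Suc n)) (degen_gen \<eta> n i))\<rparr>"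

end

theory Submission
  imports Defs
begin

text \<open>Both crossed modules arise from a reflexive graph of pro-C groups, that is, two homomorphisms
  \<open>d0, d1 : E \<rightarrow> F\<close> with a common section \<open>s\<close>, as the quotient of \<open>ker d0\<close> by its Peiffer subgroup:
  the closed normal subgroup generated by \<open>R\<close> is the kernel of the retraction that kills \<open>R\<close>. By the
  universal property, the degree 1 part of the simplicial group and the free group on \<open>X \<union> R\<close> are
  isomorphic reflexive graphs over \<open>F\<close>. It remains to identify \<open>d2 (NF2)\<close> with the Peiffer subgroup.
  Each Peiffer commutator \<open>\<langle>a, b\<rangle>\<close> is the image under \<open>d2\<close> of the element
  \<open>s1 a s1 b s1 a\<inverse> (s0 a s1 b s0 a\<inverse>)\<inverse>\<close> of \<open>NF2\<close>. Conversely, modulo the Peiffer subgroup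
  \<open>d1 w = d2 w (s d1 d0 w)\<inverse> d0 w\<close> for all \<open>w\<close> in degree 2, because both sides are homomorphisms that
  agree on degenerate elements, which generate; so \<open>d2 w\<close> is trivial for \<open>w\<close> in \<open>NF2\<close>.\<close>

section \<open>Topological groups\<close>

text \<open>Closures shape the argument. Two continuous homomorphisms can be compared on topological
  generators only when the target is Hausdorff, so working modulo the Peiffer subgroup requires
  \<open>P\<close> to be closed and normal in all of \<open>E\<close>, although it is introduced
  only as a closed subgroup of \<open>H\<close>. Conversely, the definition of
  \<open>d2 (NF2)\<close> involves no closure; that set is closed because \<open>NF2\<close> is
  compact. The word \<open>d2 w (s d1 d0 w)^-1 d0 w\<close> is the composite of the arrows
  \<open>d0 w\<close> and \<open>d2 w\<close> in the graph with source \<open>d0\<close> and target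
  \<open>d1\<close>; a 2-simplex relates it to the arrow \<open>d1 w\<close>. Composition respects
  multiplication as soon as the kernels of source and target commute, and this is what the Peiffer
  commutators enforce. Only the values of the three faces on the two kinds of degenerate 2-simplices
  enter, so the simplicial structure above degree 2 is never touched.\<close>

lemma topological_groupD:
  assumes "topological_group G"
  shows "group G" "topspace (gtop G) = carrier G"
  using assms by (auto simp: topological_group_def)

lemma continuous_map_group_mult:
  assumes "topological_group G" "continuous_map Z (gtop G) f" "continuous_map Z (gtop G) g"
  shows "continuous_map Z (gtop G) (\<lambda>z. f z \<otimes>\<^bsub>G\<^esub> g z)"
  using continuous_map_compose[of Z "prod_topology (gtop G) (gtop G)" "\<lambda>z. (f z, g z)" "gtop G"
      "\<lambda>(x, y). x \<otimes>\<^bsub>G\<^esub> y"] assms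
  by (auto simp: topological_group_def o_def continuous_map_paired)

lemma continuous_map_group_inv:
  assumes "topological_group G" "continuous_map Z (gtop G) f"
  shows "continuous_map Z (gtop G) (\<lambda>z. inv\<^bsub>G\<^esub> f z)"
  using continuous_map_compose[of Z "gtop G" f "gtop G" "\<lambda>x. inv\<^bsub>G\<^esub> x"] assms
  by (auto simp: topological_group_def o_def)

lemma continuous_map_group_const:
  assumes "topological_group G" "a \<in> carrier G"
  shows "continuous_map Z (gtop G) (\<lambda>z. a)"
  using assms by (simp add: topological_groupD)

lemma cont_homD:
  assumes "h \<in> cont_hom G K"
  shows "h \<in> hom G K" "continuous_map (gtop G) (gtop K) h"
  using assms by (auto simp: cont_hom_def)

lemma cont_hom_group_hom:
  assumes "h \<in> cont_hom G K" "topological_group G" "topological_group K"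
  shows "group_hom G K h"
  using assms by (auto simp: cont_hom_def group_hom_def group_hom_axioms_def topological_groupD)

lemma cont_hom_compose:
  assumes "f \<in> cont_hom A B" "g \<in> cont_hom B D"
  shows "(\<lambda>x. g (f x)) \<in> cont_hom A D"
  using assms hom_compose[of f A B g D] continuous_map_compose[of "gtop A" "gtop B" f "gtop D" g]
  by (auto simp: cont_hom_def o_def)

lemma cont_hom_id: "(\<lambda>x. x) \<in> cont_hom A A"
  by (auto simp: cont_hom_def hom_def continuous_map_id[unfolded id_def])

lemma closedin_group_preimage:
  assumes "topological_group G" "continuous_map (gtop G) Z f" "closedin Z S"
  shows "closedin (gtop G) {x \<in> carrier G. f x \<in> S}"
  using closedin_continuous_map_preimage[OF assms(2,3)] assms(1) by (simp add: topological_groupD)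

lemma kernel_closed_normal:
  assumes h: "h \<in> cont_hom G K" and G: "topological_group G" and K: "topological_group K"
    and T: "Hausdorff_space (gtop K)"
  shows "kernel G K h \<lhd> G" "closedin (gtop G) (kernel G K h)"
proof -
  interpret group_hom G K h
    by (rule cont_hom_group_hom[OF h G K])
  show "kernel G K h \<lhd> G"
    by (rule normal_kernel)
  have "closedin (gtop K) {\<one>\<^bsub>K\<^esub>}"
    using T K by (simp add: closedin_Hausdorff_singleton topological_groupD)
  then show "closedin (gtop G) (kernel G K h)"
    using closedin_group_preimage[OF G cont_homD(2)[OF h]] by (fastforce simp: kernel_def)
qed

section \<open>Subgroups with the subspace topology\<close>

lemma carrier_sub_tgroup [simp]: "carrier (sub_tgroup G H) = H"
  and mult_sub_tgroup [simp]: "mult (sub_tgroup G H) = mult G"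
  and one_sub_tgroup [simp]: "one (sub_tgroup G H) = one G"
  and gtop_sub_tgroup [simp]: "gtop (sub_tgroup G H) = subtopology (gtop G) H"
  and r_coset_sub_tgroup [simp]: "N #>\<^bsub>sub_tgroup G H\<^esub> x = N #>\<^bsub>G\<^esub> x"
  by (simp_all add: sub_tgroup_def r_coset_def)

lemma group_sub_tgroup:
  assumes "group G" "subgroup H G"
  shows "group (sub_tgroup G H)"
proof -
  interpret G: group G by fact
  interpret H: subgroup H G by fact
  show ?thesis
  proof (rule groupI)
    fix x assume "x \<in> carrier (sub_tgroup G H)"
    then show "\<exists>y\<in>carrier (sub_tgroup G H). y \<otimes>\<^bsub>sub_tgroup G H\<^esub> x = \<one>\<^bsub>sub_tgroup G H\<^esub>"
      by (intro bexI[of _ "inv\<^bsub>G\<^esub> x"]) auto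
  qed (auto simp: G.m_assoc)
qed

lemma inv_sub_tgroup [simp]:
  assumes "group G" "subgroup H G" "x \<in> H"
  shows "inv\<^bsub>sub_tgroup G H\<^esub> x = inv\<^bsub>G\<^esub> x"
proof -
  interpret G: group G by fact
  interpret H: subgroup H G by fact
  interpret S: group "sub_tgroup G H" by (rule group_sub_tgroup) fact+
  show ?thesis
    using assms S.inv_equality[of "inv\<^bsub>G\<^esub> x" x] by auto
qed

lemma subgroup_sub_tgroup:
  assumes "group G" "subgroup H G"
  shows "subgroup K (sub_tgroup G H) \<longleftrightarrow> subgroup K G \<and> K \<subseteq> H"
proof -
  have i: "inv\<^bsub>sub_tgroup G H\<^esub> x = inv\<^bsub>G\<^esub> x" if "x \<in> H" for x
    using assms that by simp
  show ?thesis
    using subgroup.subset[OF assms(2)] i by (auto simp: subgroup_def subset_iff)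
qed

lemma normal_sub_tgroup:
  assumes "group G" "subgroup H G" "N \<lhd> G"
  shows "N \<inter> H \<lhd> sub_tgroup G H"
proof -
  interpret G: group G by fact
  interpret H: subgroup H G by fact
  interpret N: normal N G by fact
  show ?thesis
  proof (rule group.normal_invI[OF group_sub_tgroup[OF assms(1,2)]])
    show "subgroup (N \<inter> H) (sub_tgroup G H)"
      using G.subgroups_Inter_pair[OF N.subgroup_axioms assms(2)]
      by (simp add: subgroup_sub_tgroup assms)
  qed (use assms N.inv_op_closed2 in auto)
qed

lemma topological_group_sub_tgroup:
  assumes G: "topological_group G" and H: "subgroup H G"
  shows "topological_group (sub_tgroup G H)"
proof -
  interpret G: group G using G by (rule topological_groupD)
  interpret H: subgroup H G by fact
  have tH: "topspace (subtopology (gtop G) H) = H"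
    using topological_groupD(2)[OF G] H.subset by auto
  have i: "continuous_map (subtopology (gtop G) H) (gtop G) (\<lambda>x. x)"
    using continuous_map_from_subtopology[OF continuous_map_id[unfolded id_def]] .
  let ?HH = "prod_topology (subtopology (gtop G) H) (subtopology (gtop G) H)"
  have "continuous_map ?HH (gtop G) (\<lambda>z. fst z \<otimes>\<^bsub>G\<^esub> snd z)"
    by (intro continuous_map_group_mult[OF G] continuous_map_compose[OF continuous_map_fst i, unfolded o_def]
        continuous_map_compose[OF continuous_map_snd i, unfolded o_def])
  then have 1: "continuous_map ?HH (subtopology (gtop G) H) (\<lambda>(x, y). x \<otimes>\<^bsub>G\<^esub> y)"
    unfolding case_prod_unfold by (rule continuous_map_into_subtopology) (auto simp: tH)
  have "continuous_map (subtopology (gtop G) H) (gtop G) (\<lambda>x. inv\<^bsub>sub_tgroup G H\<^esub> x)"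
    by (rule continuous_map_eq[OF continuous_map_group_inv[OF G i]])
      (simp add: H G.is_group tH)
  then have 2: "continuous_map (subtopology (gtop G) H) (subtopology (gtop G) H)
      (\<lambda>x. inv\<^bsub>sub_tgroup G H\<^esub> x)"
    by (rule continuous_map_into_subtopology) (auto simp: H G.is_group tH)
  show ?thesis
    unfolding topological_group_def using 1 2 tH by (simp add: group_sub_tgroup H G.is_group)
qed

lemma closedin_sub_tgroup:
  assumes "closedin (gtop G) H"
  shows "closedin (gtop (sub_tgroup G H)) K \<longleftrightarrow> closedin (gtop G) K \<and> K \<subseteq> H"
  using assms by (auto simp: closedin_closed_subtopology)

section \<open>Closed subgroups and closed normal subgroups generated by a set\<close>

lemma closed_gen_least:
  assumes "subgroup K G" "closedin (gtop G) K" "S \<subseteq> K"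
  shows "closed_gen G S \<subseteq> K"
  using assms by (auto simp: closed_gen_def)

lemma closed_gen_superset: "S \<subseteq> closed_gen G S"
  by (auto simp: closed_gen_def)

lemma closed_gen_closed_subgroup:
  assumes G: "topological_group G" and S: "S \<subseteq> carrier G"
  shows "subgroup (closed_gen G S) G" "closedin (gtop G) (closed_gen G S)"
proof -
  interpret G: group G using G by (rule topological_groupD)
  \<comment> \<open>The whole group is a member, so the intersection is not the one over the empty
    family, which would be \<open>UNIV\<close>.\<close>
  have *: "carrier G \<in> {K. subgroup K G \<and> closedin (gtop G) K \<and> S \<subseteq> K}"
    using S closedin_topspace[of "gtop G"] topological_groupD(2)[OF G] G.subgroup_self by simp
  show "subgroup (closed_gen G S) G"
    unfolding closed_gen_def by (rule G.subgroups_Inter) (use * in blast)+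
  show "closedin (gtop G) (closed_gen G S)"
    unfolding closed_gen_def by (rule closedin_Inter) (use * in blast)+
qed

lemma subgroup_preimage:
  assumes h: "group_hom G K h" and S: "subgroup S K"
  shows "subgroup {x \<in> carrier G. h x \<in> S} G"
proof -
  interpret group_hom G K h by fact
  interpret S: subgroup S K by fact
  show ?thesis
    using hom_one by (intro G.subgroupI) auto
qed

text \<open>The preimage of \<open>T\<close> is one of the closed subgroups being intersected. This
  serves as the induction principle for \<open>closed_gen\<close>: a closed condition is tested on
  generators.\<close>

lemma closed_gen_image_subset:
  assumes G: "topological_group G" and K: "topological_group K" and h: "h \<in> cont_hom G K"
    and S: "S \<subseteq> carrier G" and T: "subgroup T K" "closedin (gtop K) T" "h ` S \<subseteq> T"
  shows "h ` closed_gen G S \<subseteq> T"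
proof -
  have "closed_gen G S \<subseteq> {x \<in> carrier G. h x \<in> T}"
  proof (rule closed_gen_least)
    show "subgroup {x \<in> carrier G. h x \<in> T} G"
      by (rule subgroup_preimage[OF cont_hom_group_hom[OF h G K] T(1)])
    show "closedin (gtop G) {x \<in> carrier G. h x \<in> T}"
      by (rule closedin_group_preimage[OF G cont_homD(2)[OF h] T(2)])
  qed (use S T in auto)
  then show ?thesis by auto
qed

lemma closed_normal_gen_closed_normal:
  assumes G: "topological_group G" and S: "S \<subseteq> carrier G"
  shows "closed_normal_gen G S \<lhd> G" "closedin (gtop G) (closed_normal_gen G S)"
proof -
  interpret G: group G using G by (rule topological_groupD)
  have "carrier G \<lhd> G"
    by (rule G.normal_invI) (auto simp: G.subgroup_self)
  then have *: "carrier G \<in> {K. K \<lhd> G \<and> closedin (gtop G) K \<and> S \<subseteq> K}"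
    using S closedin_topspace[of "gtop G"] topological_groupD(2)[OF G] by simp
  have "subgroup (closed_normal_gen G S) G"
    unfolding closed_normal_gen_def
    by (rule G.subgroups_Inter) (use * normal_imp_subgroup in blast)+
  then show "closed_normal_gen G S \<lhd> G"
  proof (rule G.normal_invI)
    fix x h assume x: "x \<in> carrier G" and h: "h \<in> closed_normal_gen G S"
    have "x \<otimes>\<^bsub>G\<^esub> h \<otimes>\<^bsub>G\<^esub> inv\<^bsub>G\<^esub> x \<in> K"
      if "K \<lhd> G" "closedin (gtop G) K" "S \<subseteq> K" for K
      using normal.inv_op_closed2[OF that(1) x, of h] h that by (auto simp: closed_normal_gen_def)
    then show "x \<otimes>\<^bsub>G\<^esub> h \<otimes>\<^bsub>G\<^esub> inv\<^bsub>G\<^esub> x \<in> closed_normal_gen G S"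
      by (simp add: closed_normal_gen_def)
  qed
  show "closedin (gtop G) (closed_normal_gen G S)"
    unfolding closed_normal_gen_def by (rule closedin_Inter) (use * in blast)+
qed

section \<open>Quotient maps and quotient groups with the quotient topology\<close>

lemma open_map_prod:
  assumes f: "open_map X X' f" and g: "open_map Y Y' g"
  shows "open_map (prod_topology X Y) (prod_topology X' Y') (\<lambda>(x, y). (f x, g y))"
  unfolding open_map_def
proof (intro allI impI)
  fix W assume W: "openin (prod_topology X Y) W"
  show "openin (prod_topology X' Y') ((\<lambda>(x, y). (f x, g y)) ` W)"
    unfolding openin_prod_topology_alt
  proof clarify
    fix x y assume "(x, y) \<in> W"
    then obtain U V where "openin X U" "openin Y V" "x \<in> U" "y \<in> V" "U \<times> V \<subseteq> W"
      using W[unfolded openin_prod_topology_alt, rule_format] by metis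
    then show "\<exists>U' V'. openin X' U' \<and> openin Y' V' \<and> f x \<in> U' \<and> g y \<in> V' \<and>
        U' \<times> V' \<subseteq> (\<lambda>(x, y). (f x, g y)) ` W"
      using f g image_mono[of "U \<times> V" W "\<lambda>(x, y). (f x, g y)"]
      by (intro exI[of _ "f ` U"] exI[of _ "g ` V"]) (simp add: open_map_def image_paired_Times)
  qed
qed

text \<open>A product of quotient maps need not be a quotient map; openness of both factors repairs
  this. It yields joint continuity of the multiplication of a quotient group and of an action on
  it.\<close>

lemma quotient_map_prod_open:
  assumes f: "continuous_map X X' f" "open_map X X' f" "f ` topspace X = topspace X'"
    and g: "continuous_map Y Y' g" "open_map Y Y' g" "g ` topspace Y = topspace Y'"
  shows "quotient_map (prod_topology X Y) (prod_topology X' Y') (\<lambda>(x, y). (f x, g y))"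
proof (rule continuous_open_imp_quotient_map[OF _ open_map_prod[OF f(2) g(2)]])
  have "continuous_map (prod_topology X Y) X' (\<lambda>z. f (fst z))"
    using continuous_map_compose[OF continuous_map_fst f(1)] by (simp only: o_def)
  moreover have "continuous_map (prod_topology X Y) Y' (\<lambda>z. g (snd z))"
    using continuous_map_compose[OF continuous_map_snd g(1)] by (simp only: o_def)
  ultimately show "continuous_map (prod_topology X Y) (prod_topology X' Y') (\<lambda>(x, y). (f x, g y))"
    unfolding case_prod_unfold by (rule continuous_map_pairedI)
  show "(\<lambda>(x, y). (f x, g y)) ` topspace (prod_topology X Y) = topspace (prod_topology X' Y')"
    unfolding topspace_prod_topology image_paired_Times f(3) g(3) ..
qed

lemma (in normal) r_coset_eq_iff:
  assumes "a \<in> carrier G" "b \<in> carrier G"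
  shows "H #> a = H #> b \<longleftrightarrow> a \<otimes> inv b \<in> H"
proof
  assume "H #> a = H #> b"
  then have "a \<in> H #> b"
    using rcos_self[OF assms(1) is_subgroup] by simp
  then show "a \<otimes> inv b \<in> H"
    using rcos_module_imp[OF is_group assms(2)] by simp
next
  assume "a \<otimes> inv b \<in> H"
  then have "a \<in> H #> b"
    using rcos_module_rev[OF is_group assms(2,1)] by simp
  then show "H #> a = H #> b"
    using repr_independence[OF _ assms(2) is_subgroup] by simp
qed

lemma carrier_quot_tgroup: "carrier (quot_tgroup G N) = (\<lambda>x. N #>\<^bsub>G\<^esub> x) ` carrier G"
  by (auto simp: quot_tgroup_def FactGroup_def RCOSETS_def)

lemma gtop_quot_tgroup [simp]: "gtop (quot_tgroup G N) = quot_topology G N"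
  by (simp add: quot_tgroup_def)

lemma mult_quot_tgroup:
  assumes "N \<lhd> G" "x \<in> carrier G" "y \<in> carrier G"
  shows "(N #>\<^bsub>G\<^esub> x) \<otimes>\<^bsub>quot_tgroup G N\<^esub> (N #>\<^bsub>G\<^esub> y) = N #>\<^bsub>G\<^esub> (x \<otimes>\<^bsub>G\<^esub> y)"
  using normal.rcos_sum[OF assms] by (simp add: quot_tgroup_def)

lemma one_quot_tgroup:
  assumes "N \<lhd> G"
  shows "\<one>\<^bsub>quot_tgroup G N\<^esub> = N #>\<^bsub>G\<^esub> \<one>\<^bsub>G\<^esub>"
proof -
  interpret normal N G by fact
  show ?thesis
    using coset_join2[OF one_closed is_subgroup subgroup.one_closed[OF is_subgroup]]
    by (simp add: quot_tgroup_def FactGroup_def)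
qed

lemma group_quot_tgroup:
  assumes "N \<lhd> G"
  shows "group (quot_tgroup G N)"
proof -
  interpret N: normal N G by fact
  note [simp] = mult_quot_tgroup[OF assms] one_quot_tgroup[OF assms]
  show ?thesis
  proof (rule groupI)
    fix c assume "c \<in> carrier (quot_tgroup G N)"
    then obtain x where "x \<in> carrier G" "c = N #>\<^bsub>G\<^esub> x"
      by (auto simp: carrier_quot_tgroup)
    then show "\<exists>d\<in>carrier (quot_tgroup G N). d \<otimes>\<^bsub>quot_tgroup G N\<^esub> c = \<one>\<^bsub>quot_tgroup G N\<^esub>"
      by (intro bexI[of _ "N #>\<^bsub>G\<^esub> (inv\<^bsub>G\<^esub> x)"]) (auto simp: carrier_quot_tgroup)
  qed (auto simp: carrier_quot_tgroup N.m_assoc)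
qed

lemma quot_tgroup_hom:
  assumes "N \<lhd> G"
  shows "group_hom G (quot_tgroup G N) (\<lambda>x. N #>\<^bsub>G\<^esub> x)"
proof -
  interpret N: normal N G by fact
  show ?thesis
    by (simp add: group_hom_def group_hom_axioms_def group_quot_tgroup assms N.is_group hom_def
        carrier_quot_tgroup mult_quot_tgroup)
qed

lemma inv_quot_tgroup:
  assumes "N \<lhd> G" "x \<in> carrier G"
  shows "inv\<^bsub>quot_tgroup G N\<^esub> (N #>\<^bsub>G\<^esub> x) = N #>\<^bsub>G\<^esub> (inv\<^bsub>G\<^esub> x)"
  using group_hom.hom_inv[OF quot_tgroup_hom[OF assms(1)] assms(2)] by simp

lemma topspace_quot_topology:
  assumes "topological_group G"
  shows "topspace (quot_topology G N) = carrier (quot_tgroup G N)"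
proof
  show "topspace (quot_topology G N) \<subseteq> carrier (quot_tgroup G N)"
    using openin_topspace[of "quot_topology G N"] unfolding openin_quot_topology quot_tgroup_def
    by simp
  have *: "{x \<in> carrier G. N #>\<^bsub>G\<^esub> x \<in> carrier (G Mod N)} = topspace (gtop G)"
    using topological_groupD(2)[OF assms] by (auto simp: FactGroup_def RCOSETS_def)
  have "openin (quot_topology G N) (carrier (quot_tgroup G N))"
    unfolding openin_quot_topology by (simp add: quot_tgroup_def *)
  then show "carrier (quot_tgroup G N) \<subseteq> topspace (quot_topology G N)"
    by (rule openin_subset)
qed

lemma continuous_map_coset:
  assumes "topological_group G"
  shows "continuous_map (gtop G) (quot_topology G N) (\<lambda>x. N #>\<^bsub>G\<^esub> x)"
  using assms unfolding continuous_map_def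
  by (auto simp: topspace_quot_topology topological_groupD openin_quot_topology carrier_quot_tgroup)

text \<open>Universal property of the quotient topology. As \<open>f\<close> is given on cosets,
  well-definedness is built in and only the composite with the projection is tested.\<close>

lemma continuous_map_from_quot:
  assumes G: "topological_group G"
    and f: "continuous_map (gtop G) Z (\<lambda>x. f (N #>\<^bsub>G\<^esub> x))"
  shows "continuous_map (quot_topology G N) Z f"
  unfolding continuous_map_def
proof (intro conjI allI impI)
  have f': "f (N #>\<^bsub>G\<^esub> x) \<in> topspace Z" if "x \<in> carrier G" for x
    using continuous_map_image_subset_topspace[OF f] that G by (auto simp: topological_groupD)
  then show "f \<in> topspace (quot_topology G N) \<rightarrow> topspace Z"
    by (auto simp: topspace_quot_topology G carrier_quot_tgroup)
  fix U assume "openin Z U"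
  then have *: "openin (gtop G) {x \<in> carrier G. f (N #>\<^bsub>G\<^esub> x) \<in> U}"
    using openin_continuous_map_preimage[OF f] G by (simp add: topological_groupD)
  have "{x \<in> carrier G. N #>\<^bsub>G\<^esub> x \<in> {c \<in> carrier (quot_tgroup G N). f c \<in> U}} =
      {x \<in> carrier G. f (N #>\<^bsub>G\<^esub> x) \<in> U}"
    by (auto simp: carrier_quot_tgroup)
  then show "openin (quot_topology G N) {c \<in> topspace (quot_topology G N). f c \<in> U}"
    using * unfolding openin_quot_topology
    by (auto simp: topspace_quot_topology G) (simp add: quot_tgroup_def)
qed

text \<open>The saturation of \<open>U\<close> is the union over \<open>n\<close> in
  \<open>N\<close> of the preimages of \<open>U\<close> under left multiplication by
  \<open>n\<close>, each of them open.\<close>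

lemma open_map_coset:
  assumes G: "topological_group G" and N: "N \<lhd> G"
  shows "open_map (gtop G) (quot_topology G N) (\<lambda>x. N #>\<^bsub>G\<^esub> x)"
  unfolding open_map_def
proof (intro allI impI)
  interpret N: normal N G by fact
  fix U assume U: "openin (gtop G) U"
  then have UG: "U \<subseteq> carrier G"
    using openin_subset G by (force simp: topological_groupD)
  have "{x \<in> carrier G. N #>\<^bsub>G\<^esub> x \<in> (\<lambda>x. N #>\<^bsub>G\<^esub> x) ` U} = (\<Union>n\<in>N. {x \<in> carrier G. n \<otimes>\<^bsub>G\<^esub> x \<in> U})"
  proof (rule Set.set_eqI, rule iffI)
    fix x assume "x \<in> {x \<in> carrier G. N #>\<^bsub>G\<^esub> x \<in> (\<lambda>x. N #>\<^bsub>G\<^esub> x) ` U}"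
    then obtain u where u: "x \<in> carrier G" "u \<in> U" "N #>\<^bsub>G\<^esub> u = N #>\<^bsub>G\<^esub> x"
      by auto
    then have "u \<otimes>\<^bsub>G\<^esub> inv\<^bsub>G\<^esub> x \<in> N" "u \<otimes>\<^bsub>G\<^esub> inv\<^bsub>G\<^esub> x \<otimes>\<^bsub>G\<^esub> x = u"
      using UG N.r_coset_eq_iff[of u x] by (auto simp: N.m_assoc)
    then show "x \<in> (\<Union>n\<in>N. {x \<in> carrier G. n \<otimes>\<^bsub>G\<^esub> x \<in> U})"
      using u by (metis (mono_tags, lifting) UN_I mem_Collect_eq)
  next
    fix x assume "x \<in> (\<Union>n\<in>N. {x \<in> carrier G. n \<otimes>\<^bsub>G\<^esub> x \<in> U})"
    then obtain n where n: "n \<in> N" "x \<in> carrier G" "n \<otimes>\<^bsub>G\<^esub> x \<in> U"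
      by auto
    then have "N #>\<^bsub>G\<^esub> (n \<otimes>\<^bsub>G\<^esub> x) = N #>\<^bsub>G\<^esub> x"
      using N.r_coset_eq_iff[of "n \<otimes>\<^bsub>G\<^esub> x" x] by (simp add: N.m_assoc)
    then show "x \<in> {x \<in> carrier G. N #>\<^bsub>G\<^esub> x \<in> (\<lambda>x. N #>\<^bsub>G\<^esub> x) ` U}"
      using n by (metis (mono_tags, lifting) image_eqI mem_Collect_eq)
  qed
  moreover have "openin (gtop G) {x \<in> carrier G. n \<otimes>\<^bsub>G\<^esub> x \<in> U}" if "n \<in> N" for n
    using openin_continuous_map_preimage[OF continuous_map_group_mult[OF G
          continuous_map_group_const[OF G] continuous_map_id[unfolded id_def]] U, of n]
      that G by (simp add: topological_groupD)
  ultimately have "openin (gtop G) {x \<in> carrier G. N #>\<^bsub>G\<^esub> x \<in> (\<lambda>x. N #>\<^bsub>G\<^esub> x) ` U}"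
    by auto
  then show "openin (quot_topology G N) ((\<lambda>x. N #>\<^bsub>G\<^esub> x) ` U)"
    using UG unfolding openin_quot_topology by (auto simp: FactGroup_def RCOSETS_def)
qed

lemma topological_group_quot_tgroup:
  assumes G: "topological_group G" and N: "N \<lhd> G"
  shows "topological_group (quot_tgroup G N)"
proof -
  interpret N: normal N G by fact
  let ?Q = "quot_topology G N" and ?\<pi> = "\<lambda>x. N #>\<^bsub>G\<^esub> x"
  note \<pi> = continuous_map_coset[OF G, of N]
  have surj: "?\<pi> ` topspace (gtop G) = topspace ?Q"
    by (simp add: topspace_quot_topology G topological_groupD carrier_quot_tgroup)
  have q: "quotient_map (prod_topology (gtop G) (gtop G)) (prod_topology ?Q ?Q) (\<lambda>(x, y). (?\<pi> x, ?\<pi> y))"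
    by (intro quotient_map_prod_open \<pi> open_map_coset G N surj)
  have "continuous_map (prod_topology (gtop G) (gtop G)) ?Q (?\<pi> \<circ> (\<lambda>(x, y). x \<otimes>\<^bsub>G\<^esub> y))"
    using G by (intro continuous_map_compose[OF _ \<pi>]) (simp add: topological_group_def)
  then have "continuous_map (prod_topology (gtop G) (gtop G)) ?Q
      ((\<lambda>(c, d). c \<otimes>\<^bsub>quot_tgroup G N\<^esub> d) \<circ> (\<lambda>(x, y). (?\<pi> x, ?\<pi> y)))"
    by (rule continuous_map_eq) (auto simp: mult_quot_tgroup N topological_groupD G)
  then have mult: "continuous_map (prod_topology ?Q ?Q) ?Q (\<lambda>(c, d). c \<otimes>\<^bsub>quot_tgroup G N\<^esub> d)"
    by (rule continuous_compose_quotient_map[OF q])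
  have "continuous_map (gtop G) ?Q (?\<pi> \<circ> (\<lambda>x. inv\<^bsub>G\<^esub> x))"
    using G by (intro continuous_map_compose[OF _ \<pi>]) (simp add: topological_group_def)
  then have "continuous_map (gtop G) ?Q (\<lambda>x. inv\<^bsub>quot_tgroup G N\<^esub> (?\<pi> x))"
    by (rule continuous_map_eq) (auto simp: inv_quot_tgroup N topological_groupD G)
  then have "continuous_map ?Q ?Q (\<lambda>c. inv\<^bsub>quot_tgroup G N\<^esub> c)"
    by (rule continuous_map_from_quot[OF G])
  then show ?thesis
    unfolding topological_group_def using mult
    by (simp add: group_quot_tgroup N topspace_quot_topology G)
qed

text \<open>The cosets of \<open>x\<close> and \<open>y\<close> differ when \<open>x y^-1\<close>
  avoids the closed set \<open>N\<close>, an open condition on the pair. An open box around the pair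
  projects to disjoint sets, open because the projection is.\<close>

lemma Hausdorff_space_quot_topology:
  assumes G: "topological_group G" and N: "N \<lhd> G" and cl: "closedin (gtop G) N"
  shows "Hausdorff_space (quot_topology G N)"
  unfolding Hausdorff_space_def
proof (intro allI impI)
  interpret N: normal N G by fact
  fix c d assume cd: "c \<in> topspace (quot_topology G N) \<and> d \<in> topspace (quot_topology G N) \<and> c \<noteq> d"
  then have "c \<in> (\<lambda>x. N #>\<^bsub>G\<^esub> x) ` carrier G" "d \<in> (\<lambda>x. N #>\<^bsub>G\<^esub> x) ` carrier G"
    by (simp_all add: topspace_quot_topology G carrier_quot_tgroup)
  then obtain x y where xy: "x \<in> carrier G" "y \<in> carrier G" "c = N #>\<^bsub>G\<^esub> x" "d = N #>\<^bsub>G\<^esub> y"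
    by blast
  let ?W = "{z \<in> topspace (prod_topology (gtop G) (gtop G)).
      fst z \<otimes>\<^bsub>G\<^esub> inv\<^bsub>G\<^esub> snd z \<in> topspace (gtop G) - N}"
  have W: "openin (prod_topology (gtop G) (gtop G)) ?W"
    by (rule openin_continuous_map_preimage[OF continuous_map_group_mult[OF G continuous_map_fst
          continuous_map_group_inv[OF G continuous_map_snd]] openin_diff[OF openin_topspace cl]])
  have "(x, y) \<in> ?W"
    using xy cd N.r_coset_eq_iff[of x y] by (simp add: topological_groupD G)
  from W[unfolded openin_prod_topology_alt, rule_format, OF this]
  obtain U V where UV: "openin (gtop G) U" "openin (gtop G) V" "x \<in> U" "y \<in> V" "U \<times> V \<subseteq> ?W"
    by (elim exE conjE) (rule that)
  have "N #>\<^bsub>G\<^esub> u \<noteq> N #>\<^bsub>G\<^esub> v" if "u \<in> U" "v \<in> V" for u v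
    using that UV(5) N.r_coset_eq_iff[of u v] by (auto simp: topological_groupD G)
  then have "disjnt ((\<lambda>x. N #>\<^bsub>G\<^esub> x) ` U) ((\<lambda>x. N #>\<^bsub>G\<^esub> x) ` V)"
    by (auto simp: disjnt_iff)
  then show "\<exists>U V. openin (quot_topology G N) U \<and> openin (quot_topology G N) V \<and>
      c \<in> U \<and> d \<in> V \<and> disjnt U V"
    using open_map_coset[OF G N] UV xy unfolding open_map_def by blast
qed

section \<open>Pro-C groups\<close>

lemma group_classD:
  assumes "group_class C" "K \<in> C"
  shows "group K" "subgroup H K \<Longrightarrow> in_class C (K\<lparr>carrier := H\<rparr>)"
    "N \<lhd> K \<Longrightarrow> in_class C (K Mod N)"
  using assms(1)[unfolded group_class_def, THEN conjunct1]
    assms(1)[unfolded group_class_def, THEN conjunct2, THEN conjunct1]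
    assms(1)[unfolded group_class_def, THEN conjunct2, THEN conjunct2, THEN conjunct1] assms(2)
  by blast+

lemma in_class_iso:
  assumes "in_class C A" "A \<cong> B" "group B"
  shows "in_class C B"
  using assms group.iso_sym[of A B] iso_trans by (auto simp: in_class_def)

text \<open>The closure properties of \<open>C\<close> concern representatives on \<open>nat\<close>
  only, so \<open>A\<close> is first replaced by its representative \<open>K\<close>; then
  \<open>B\<close> is a quotient of \<open>K\<close> by the first isomorphism theorem.
  \<open>in_class_hom_inj\<close> uses the same replacement, with a subgroup in place of a
  quotient.\<close>

lemma in_class_hom_image:
  assumes C: "group_class C" and A: "in_class C A" and f: "group_hom A B f"
    and surj: "f ` carrier A = carrier B"
  shows "in_class C B"
proof -
  interpret f: group_hom A B f by fact
  obtain K where K: "K \<in> C" "A \<cong> K"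
    using A by (auto simp: in_class_def)
  then obtain j where j: "j \<in> iso K A"
    using f.G.iso_sym unfolding is_iso_def by blast
  have "group K"
    by (rule group_classD(1)[OF C K(1)])
  then interpret fj: group_hom K B "f \<circ> j"
    using j hom_compose[of j K A f B] f.homh
    by (simp add: group_hom_def group_hom_axioms_def iso_def)
  have "in_class C (K Mod kernel K B (f \<circ> j))"
    by (rule group_classD(3)[OF C K(1) fj.normal_kernel])
  moreover have "(f \<circ> j) ` carrier K = carrier B"
    using surj j by (simp only: image_comp[symmetric] iso_def bij_betw_def mem_Collect_eq)
  ultimately show ?thesis
    using in_class_iso fj.FactGroup_iso by blast
qed

lemma in_class_hom_inj:
  assumes C: "group_class C" and B: "in_class C B" and f: "group_hom A B f"
    and inj: "inj_on f (carrier A)"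
  shows "in_class C A"
proof -
  interpret f: group_hom A B f by fact
  obtain K e where K: "K \<in> C" "e \<in> iso B K"
    using B by (auto simp: in_class_def is_iso_def)
  have "group K"
    by (rule group_classD(1)[OF C K(1)])
  then interpret ef: group_hom A K "e \<circ> f"
    using K hom_compose[of f A B e K] f.homh
    by (simp add: group_hom_def group_hom_axioms_def iso_def)
  define I where "I = (e \<circ> f) ` carrier A"
  have I: "in_class C (K\<lparr>carrier := I\<rparr>)"
    unfolding I_def by (rule group_classD(2)[OF C K(1) ef.img_is_subgroup])
  have "inj_on e (f ` carrier A)"
    using K inj_on_subset[of e "carrier B" "f ` carrier A"] 
    by (simp add: iso_def bij_betw_def image_subset_iff)
  then have "e \<circ> f \<in> iso A (K\<lparr>carrier := I\<rparr>)"
    using comp_inj_on[OF inj] ef.homh by (auto simp: iso_def bij_betw_def I_def hom_def)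
  then have "A \<cong> K\<lparr>carrier := I\<rparr>"
    by (rule is_isoI)
  then show ?thesis
    using I f.G.iso_sym in_class_iso f.G.is_group by blast
qed

lemma proC_groupD:
  assumes "proC_group C G"
  shows "topological_group G" "group G" "compact_space (gtop G)" "Hausdorff_space (gtop G)"
    "topspace (gtop G) = carrier G"
  using assms by (auto simp: proC_group_def topological_group_def)

text \<open>A basic open normal subgroup \<open>N\<close> of \<open>G\<close> is traced on
  \<open>H\<close>; the quotient of \<open>H\<close> by \<open>N \<inter> H\<close> embeds in
  \<open>G Mod N\<close> and so stays in the class.\<close>

lemma proC_group_sub_tgroup:
  assumes C: "group_class C" and G: "proC_group C G" and H: "subgroup H G" "closedin (gtop G) H"
  shows "proC_group C (sub_tgroup G H)"
  unfolding proC_group_def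
proof (intro conjI allI impI)
  note GD = proC_groupD[OF G]
  show "topological_group (sub_tgroup G H)"
    by (rule topological_group_sub_tgroup[OF GD(1) H(1)])
  show "compact_space (gtop (sub_tgroup G H))"
    using closedin_compact_space[OF GD(3) H(2)] by (simp add: compact_space_subtopology)
  show "Hausdorff_space (gtop (sub_tgroup G H))"
    using GD(4) by (simp add: Hausdorff_space_subtopology)
  fix U assume "openin (gtop (sub_tgroup G H)) U \<and> \<one>\<^bsub>sub_tgroup G H\<^esub> \<in> U"
  then obtain V where V: "openin (gtop G) V" "U = V \<inter> H" "\<one>\<^bsub>G\<^esub> \<in> V"
    by (auto simp: openin_subtopology)
  then obtain N where N: "N \<lhd> G" "openin (gtop G) N" "in_class C (G Mod N)" "N \<subseteq> V"
    using G unfolding proC_group_def by blast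
  interpret N: normal N G by fact
  have "group (sub_tgroup G H)" "group (G Mod N)"
    using group_sub_tgroup GD H N.factorgroup_is_group by auto
  moreover have "(\<lambda>x. N #>\<^bsub>G\<^esub> x) \<in> hom (sub_tgroup G H) (G Mod N)"
    using N.r_coset_hom_Mod subgroup.subset[OF H(1)] by (auto simp: hom_def subset_iff)
  ultimately interpret f: group_hom "sub_tgroup G H" "G Mod N" "\<lambda>x. N #>\<^bsub>G\<^esub> x"
    by (simp add: group_hom_def group_hom_axioms_def)
  have ker: "kernel (sub_tgroup G H) (G Mod N) (\<lambda>x. N #>\<^bsub>G\<^esub> x) = N \<inter> H"
    using N.coset_join1[OF _ _ N.is_subgroup] N.coset_join2[OF _ N.is_subgroup] subgroup.subset[OF H(1)]
    by (auto simp: kernel_def FactGroup_def)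
  have "in_class C (sub_tgroup G H Mod (N \<inter> H))"
    using in_class_hom_inj[OF C N(3) _ f.FactGroup_inj_on] f.FactGroup_hom
      normal.factorgroup_is_group[OF f.normal_kernel] \<open>group (G Mod N)\<close>
    unfolding ker by (simp add: group_hom_def group_hom_axioms_def)
  moreover have "openin (gtop (sub_tgroup G H)) (N \<inter> H)"
    using N(2) by (auto simp: openin_subtopology)
  ultimately show "\<exists>M. M \<lhd> sub_tgroup G H \<and> openin (gtop (sub_tgroup G H)) M \<and>
      in_class C (sub_tgroup G H Mod M) \<and> M \<subseteq> U"
    using normal_sub_tgroup[OF GD(2) H(1) N(1)] N(4) V(2) by blast
qed

text \<open>Basic open normal subgroups of the quotient are the images of those \<open>M\<close> of
  \<open>G\<close>, and dividing by such an image gives a homomorphic image of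
  \<open>G Mod M\<close>.\<close>

lemma proC_group_quot_tgroup:
  assumes C: "group_class C" and G: "proC_group C G" and N: "N \<lhd> G" "closedin (gtop G) N"
  shows "proC_group C (quot_tgroup G N)"
  unfolding proC_group_def
proof (intro conjI allI impI)
  note GD = proC_groupD[OF G]
  let ?Q = "quot_tgroup G N" and ?\<pi> = "\<lambda>x. N #>\<^bsub>G\<^esub> x"
  show "topological_group ?Q"
    by (rule topological_group_quot_tgroup[OF GD(1) N(1)])
  show "Hausdorff_space (gtop ?Q)"
    using Hausdorff_space_quot_topology[OF GD(1) N] by simp
  have surj: "?\<pi> ` carrier G = carrier ?Q"
    by (simp add: carrier_quot_tgroup)
  have "compactin (quot_topology G N) (?\<pi> ` topspace (gtop G))"
    using image_compactin[OF _ continuous_map_coset[OF GD(1)]] GD(3) by (simp add: compact_space_def)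
  then show "compact_space (gtop ?Q)"
    by (simp add: compact_space_def topspace_quot_topology GD surj)
  fix U assume U: "openin (gtop ?Q) U \<and> \<one>\<^bsub>?Q\<^esub> \<in> U"
  then have "openin (gtop G) {x \<in> topspace (gtop G). ?\<pi> x \<in> U}"
    using openin_continuous_map_preimage[OF continuous_map_coset[OF GD(1)]] by simp
  moreover have "\<one>\<^bsub>G\<^esub> \<in> {x \<in> topspace (gtop G). ?\<pi> x \<in> U}"
    using U one_quot_tgroup[OF N(1)] GD by (simp add: group.is_monoid)
  ultimately obtain M where M: "M \<lhd> G" "openin (gtop G) M" "in_class C (G Mod M)"
      "M \<subseteq> {x \<in> topspace (gtop G). ?\<pi> x \<in> U}"
    using G unfolding proC_group_def by meson
  interpret \<pi>: group_hom G ?Q ?\<pi>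
    by (rule quot_tgroup_hom[OF N(1)])
  interpret M: normal M G by fact
  define M' where "M' = ?\<pi> ` M"
  have M': "M' \<lhd> ?Q"
    unfolding M'_def by (rule M.surj_hom_normal_subgroup[OF \<pi>.group_hom_axioms surj])
  then interpret M': normal M' ?Q .
  have hq: "(\<lambda>x. M' #>\<^bsub>?Q\<^esub> ?\<pi> x) \<in> hom G (?Q Mod M')"
    using hom_compose[OF \<pi>.homh M'.r_coset_hom_Mod] by (simp add: o_def)
  have gQ: "group (?Q Mod M')"
    by (rule M'.factorgroup_is_group)
  interpret h: group_hom G "?Q Mod M'" "\<lambda>x. M' #>\<^bsub>?Q\<^esub> ?\<pi> x"
    using hq gQ by (simp add: group_hom_def group_hom_axioms_def)
  have "M \<subseteq> kernel G (?Q Mod M') (\<lambda>x. M' #>\<^bsub>?Q\<^esub> ?\<pi> x)"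
    using \<pi>.H.coset_join2[OF _ M'.is_subgroup] M.subset
    by (auto simp: kernel_def FactGroup_def M'_def)
  from h.FactGroup_universal_kernel[OF M(1) this]
  obtain g where g: "g \<in> hom (G Mod M) (?Q Mod M')"
    and gx: "\<And>x. x \<in> carrier G \<Longrightarrow> g (M #>\<^bsub>G\<^esub> x) = M' #>\<^bsub>?Q\<^esub> ?\<pi> x"
    by blast
  have gsurj: "g ` carrier (G Mod M) = carrier (?Q Mod M')"
    using gx by (auto simp: FactGroup_def RCOSETS_def surj[symmetric] image_iff)
  have "group_hom (G Mod M) (?Q Mod M') g"
    using g gQ M.factorgroup_is_group by (simp only: group_hom_def group_hom_axioms_def simp_thms)
  then have "in_class C (?Q Mod M')"
    by (rule in_class_hom_image[OF C M(3) _ gsurj])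
  moreover have "openin (gtop ?Q) M'"
    using open_map_coset[OF GD(1) N(1)] M(2) by (simp add: open_map_def M'_def)
  ultimately show "\<exists>M. M \<lhd> ?Q \<and> openin (gtop ?Q) M \<and> in_class C (?Q Mod M) \<and> M \<subseteq> U"
    using M' M(4) by (intro exI[of _ M']) (auto simp: M'_def)
qed

section \<open>The crossed module of a reflexive graph of pro-C groups\<close>

text \<open>With products nested to the right, these rules cancel an inverse pair inside a longer
  word; together with associativity they settle the word identities for Peiffer commutators.\<close>

lemma (in group) inv_cancel:
  assumes "x \<in> carrier G" "y \<in> carrier G"
  shows "x \<otimes> (inv x \<otimes> y) = y" "inv x \<otimes> (x \<otimes> y) = y"
  using assms by (simp_all flip: m_assoc)

lemma conj_by_cont_hom:
  assumes E: "topological_group E" and g: "g \<in> carrier E"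
  shows "conj_by E g \<in> cont_hom E E"
proof -
  interpret E: group E using E by (rule topological_groupD)
  have "continuous_map (gtop E) (gtop E) (\<lambda>x. g \<otimes>\<^bsub>E\<^esub> x \<otimes>\<^bsub>E\<^esub> inv\<^bsub>E\<^esub> g)"
    by (rule continuous_map_group_mult[OF E continuous_map_group_mult[OF E
            continuous_map_group_const[OF E g] continuous_map_id[unfolded id_def]]
          continuous_map_group_const[OF E]]) (simp add: g)
  moreover have "conj_by E g \<in> hom E E"
    using g by (auto simp: hom_def conj_by_def E.m_assoc E.inv_cancel)
  ultimately show ?thesis
    by (simp add: cont_hom_def conj_by_def[abs_def])
qed

lemma cont_hom_sub_tgroup:
  assumes "h \<in> cont_hom G K" "H \<subseteq> carrier G"
  shows "h \<in> cont_hom (sub_tgroup G H) K"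
  using assms by (auto simp: cont_hom_def hom_def subset_iff intro: continuous_map_from_subtopology)

text \<open>Through \<open>s\<close>, \<open>E\<close> is the semidirect product of the kernel of
  \<open>d0\<close> with \<open>F\<close>, and \<open>d1\<close> on that kernel is a precrossed
  module (a pre-cat1-group in Loday's terms). Dividing by Peiffer commutators forces CM2.\<close>

locale reflexive_graph =
  fixes C :: "nat monoid set" and E :: "'e tgroup" and F :: "'f tgroup"
    and d0 d1 :: "'e \<Rightarrow> 'f" and s :: "'f \<Rightarrow> 'e"
  assumes C: "group_class C" and E: "proC_group C E" and F: "proC_group C F"
    and d0: "d0 \<in> cont_hom E F" and d1: "d1 \<in> cont_hom E F" and s: "s \<in> cont_hom F E"
    and d0_s [simp]: "g \<in> carrier F \<Longrightarrow> d0 (s g) = g"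
    and d1_s [simp]: "g \<in> carrier F \<Longrightarrow> d1 (s g) = g"
begin

sublocale E: group E by (rule proC_groupD[OF E])
sublocale F: group F by (rule proC_groupD[OF F])
sublocale d0: group_hom E F d0 by (rule cont_hom_group_hom[OF d0 proC_groupD(1)[OF E] proC_groupD(1)[OF F]])
sublocale d1: group_hom E F d1 by (rule cont_hom_group_hom[OF d1 proC_groupD(1)[OF E] proC_groupD(1)[OF F]])
sublocale s: group_hom F E s by (rule cont_hom_group_hom[OF s proC_groupD(1)[OF F] proC_groupD(1)[OF E]])

definition H :: "'e set" where
  "H = kernel E F d0"

definition peiffer :: "'e \<Rightarrow> 'e \<Rightarrow> 'e" where
  "peiffer a b = a \<otimes>\<^bsub>E\<^esub> b \<otimes>\<^bsub>E\<^esub> inv\<^bsub>E\<^esub> a \<otimes>\<^bsub>E\<^esub> inv\<^bsub>E\<^esub> (conj_by E (s (d1 a)) b)"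

definition P :: "'e set" where
  "P = closed_gen (sub_tgroup E H) {peiffer a b | a b. a \<in> H \<and> b \<in> H}"

text \<open>Spelled with images of cosets exactly like \<open>moore_crossed\<close> and
  \<open>pres_crossed\<close>, so that each of these turns out equal to an instance of it.\<close>

definition crossed :: "('e set, 'f) crossed" where
  "crossed = \<lparr>cm_top = quot_tgroup (sub_tgroup E H) P, cm_base = F,
     cm_act = (\<lambda>g c. conj_by E (s g) ` c), cm_bd = (\<lambda>c. the_elem (d1 ` c))\<rparr>"

lemmas tE = proC_groupD(1)[OF E]
lemmas tF = proC_groupD(1)[OF F]
lemmas E_simps = E.m_assoc E.inv_mult_group E.inv_cancel

lemma H_iff: "x \<in> H \<longleftrightarrow> x \<in> carrier E \<and> d0 x = \<one>\<^bsub>F\<^esub>"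
  by (auto simp: H_def kernel_def)

lemma H_carrier: "x \<in> H \<Longrightarrow> x \<in> carrier E"
  by (simp add: H_iff)

lemma H_normal: "H \<lhd> E" and H_closed: "closedin (gtop E) H"
  unfolding H_def by (rule kernel_closed_normal[OF d0 tE tF proC_groupD(4)[OF F]])+

lemma H_subgroup: "subgroup H E"
  by (rule normal_imp_subgroup[OF H_normal])

lemma tH: "topological_group (sub_tgroup E H)"
  by (rule topological_group_sub_tgroup[OF tE H_subgroup])

section \<open>Peiffer commutators and the normality of the subgroup they generate\<close>

lemma peiffer_in_H:
  assumes "a \<in> H" "b \<in> H"
  shows "peiffer a b \<in> H"
  using assms by (simp add: H_iff peiffer_def conj_by_def)

lemma P_closed_subgroup_H:
  "subgroup P (sub_tgroup E H)" "closedin (gtop (sub_tgroup E H)) P"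
  unfolding P_def
  by (rule closed_gen_closed_subgroup[OF tH]; use peiffer_in_H in auto)+

lemma P_subgroup: "subgroup P E" and P_subset: "P \<subseteq> H"
  using P_closed_subgroup_H(1) by (auto simp: subgroup_sub_tgroup E.is_group H_subgroup)

lemma P_closed: "closedin (gtop E) P"
  using P_closed_subgroup_H(2) by (simp add: closedin_sub_tgroup H_closed del: gtop_sub_tgroup)

lemma peiffer_in_P: "a \<in> H \<Longrightarrow> b \<in> H \<Longrightarrow> peiffer a b \<in> P"
  unfolding P_def by (rule subsetD[OF closed_gen_superset]) auto

lemma cont_hom_image_P:
  assumes K: "topological_group K" and h: "h \<in> cont_hom E K"
    and T: "subgroup T K" "closedin (gtop K) T"
    and gen: "\<And>a b. a \<in> H \<Longrightarrow> b \<in> H \<Longrightarrow> h (peiffer a b) \<in> T"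
  shows "h ` P \<subseteq> T"
  unfolding P_def
proof (rule closed_gen_image_subset[OF tH K _ _ T])
  show "h \<in> cont_hom (sub_tgroup E H) K"
    by (rule cont_hom_sub_tgroup[OF h subgroup.subset[OF H_subgroup]])
qed (use gen peiffer_in_H in auto)

text \<open>Since \<open>d1 (s f) = f\<close>, conjugating \<open>a\<close> by \<open>s f\<close>
  conjugates \<open>s (d1 a)\<close> by \<open>s f\<close> as well. This fails for a general element
  of \<open>E\<close> in place of \<open>s f\<close>.\<close>

lemma conj_peiffer:
  assumes "f \<in> carrier F" "a \<in> H" "b \<in> H"
  shows "conj_by E (s f) (peiffer a b) = peiffer (conj_by E (s f) a) (conj_by E (s f) b)"
  using assms by (simp add: peiffer_def conj_by_def H_iff E_simps)

text \<open>Solved for its first factor, this identity writes the conjugate of a Peiffer commutator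
  by an element of \<open>H\<close> as a product of a Peiffer commutator and the inverse of
  another.\<close>

lemma peiffer_mult_left:
  assumes "h \<in> H" "a \<in> H" "b \<in> H"
  shows "peiffer (h \<otimes>\<^bsub>E\<^esub> a) b = conj_by E h (peiffer a b) \<otimes>\<^bsub>E\<^esub> peiffer h (conj_by E (s (d1 a)) b)"
  using assms by (simp add: peiffer_def conj_by_def H_iff E_simps)

lemma conj_by_in_H: "g \<in> carrier E \<Longrightarrow> x \<in> H \<Longrightarrow> conj_by E g x \<in> H"
  by (simp add: conj_by_def normal.inv_op_closed2[OF H_normal])

text \<open>Every \<open>g\<close> is \<open>h s (d0 g)\<close> with \<open>h\<close> in
  \<open>H\<close>. Conjugation by \<open>s (d0 g)\<close> is handled by
  \<open>conj_peiffer\<close>, conjugation by \<open>h\<close> by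
  \<open>peiffer_mult_left\<close>.\<close>

lemma conj_peiffer_in_P:
  assumes g: "g \<in> carrier E" and ab: "a \<in> H" "b \<in> H"
  shows "conj_by E g (peiffer a b) \<in> P"
proof -
  let ?f = "d0 g"
  define h where "h = g \<otimes>\<^bsub>E\<^esub> inv\<^bsub>E\<^esub> s ?f"
  define a' b' where "a' = conj_by E (s ?f) a" and "b' = conj_by E (s ?f) b"
  have h: "h \<in> H"
    using g by (simp add: h_def H_iff)
  have ab': "a' \<in> H" "b' \<in> H"
    using g ab by (simp_all add: a'_def b'_def conj_by_in_H)
  have "conj_by E g (peiffer a b) = conj_by E h (conj_by E (s ?f) (peiffer a b))"
    using g peiffer_in_H[OF ab] by (simp add: h_def conj_by_def H_carrier E_simps)
  also have "\<dots> = conj_by E h (peiffer a' b')"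
    using g ab by (simp add: conj_peiffer a'_def b'_def)
  also have "\<dots> = peiffer (h \<otimes>\<^bsub>E\<^esub> a') b' \<otimes>\<^bsub>E\<^esub> inv\<^bsub>E\<^esub> peiffer h (conj_by E (s (d1 a')) b')"
    using h ab' peiffer_in_H[OF ab'] peiffer_in_H[of h "conj_by E (s (d1 a')) b'"]
    by (simp add: peiffer_mult_left conj_by_in_H H_carrier E_simps)
  also have "\<dots> \<in> P"
    using h ab' subgroup.m_closed[OF H_subgroup]
    by (intro subgroup.m_closed[OF P_subgroup] subgroup.m_inv_closed[OF P_subgroup] peiffer_in_P
        conj_by_in_H) (auto simp: H_carrier)
  finally show ?thesis .
qed

text \<open>Conjugation is a continuous endomorphism, so Peiffer commutators suffice. Normality in
  \<open>E\<close>, not only in \<open>H\<close>, lets the degree 2 argument take place in the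
  quotient of \<open>E\<close> by \<open>P\<close>.\<close>

lemma P_normal: "P \<lhd> E"
proof (rule E.normal_invI[OF P_subgroup])
  fix g x assume g: "g \<in> carrier E" and x: "x \<in> P"
  have "conj_by E g ` P \<subseteq> P"
    by (rule cont_hom_image_P[OF tE conj_by_cont_hom[OF tE g] P_subgroup P_closed])
      (rule conj_peiffer_in_P[OF g])
  then show "g \<otimes>\<^bsub>E\<^esub> x \<otimes>\<^bsub>E\<^esub> inv\<^bsub>E\<^esub> g \<in> P"
    using x by (auto simp: conj_by_def)
qed

text \<open>CM1 holds before dividing: \<open>d1\<close> sends \<open>a b a^-1\<close> and the
  conjugate of \<open>b\<close> by \<open>s (d1 a)\<close> to the same element. Hence
  \<open>d1\<close> is constant on cosets of \<open>P\<close>.\<close>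

lemma d1_P:
  assumes "x \<in> P"
  shows "d1 x = \<one>\<^bsub>F\<^esub>"
proof -
  have "d1 ` P \<subseteq> {\<one>\<^bsub>F\<^esub>}"
  proof (rule cont_hom_image_P[OF tF d1 F.triv_subgroup])
    show "closedin (gtop F) {\<one>\<^bsub>F\<^esub>}"
      using proC_groupD[OF F] by (simp add: closedin_Hausdorff_singleton)
  qed (simp add: peiffer_def conj_by_def H_iff F.m_assoc)
  then show ?thesis
    using assms by auto
qed

text \<open>With \<open>a = s (d0 k)^-1 k\<close>, the condition \<open>d1 k = 1\<close> gives
  \<open>s (d1 a) = s (d0 k)^-1\<close>. Conjugating \<open>peiffer a h\<close> by
  \<open>s (d0 k)\<close> therefore cancels the action in its second half and leaves the ordinary
  commutator of \<open>k\<close> and \<open>h\<close>.\<close>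

lemma commutator_in_P:
  assumes k: "k \<in> carrier E" "d1 k = \<one>\<^bsub>F\<^esub>" and h: "h \<in> H"
  shows "k \<otimes>\<^bsub>E\<^esub> h \<otimes>\<^bsub>E\<^esub> inv\<^bsub>E\<^esub> k \<otimes>\<^bsub>E\<^esub> inv\<^bsub>E\<^esub> h \<in> P"
proof -
  define a where "a = inv\<^bsub>E\<^esub> s (d0 k) \<otimes>\<^bsub>E\<^esub> k"
  have a: "a \<in> H"
    using k by (simp add: a_def H_iff)
  have "k \<otimes>\<^bsub>E\<^esub> h \<otimes>\<^bsub>E\<^esub> inv\<^bsub>E\<^esub> k \<otimes>\<^bsub>E\<^esub> inv\<^bsub>E\<^esub> h = conj_by E (s (d0 k)) (peiffer a h)"
    using k H_carrier[OF h] by (simp add: a_def peiffer_def conj_by_def E_simps)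
  then show ?thesis
    using conj_peiffer_in_P[OF _ a h, of "s (d0 k)"] k by simp
qed

section \<open>The quotient by the Peiffer subgroup as a crossed module\<close>

lemma P_normal_H: "P \<lhd> sub_tgroup E H"
  using normal_sub_tgroup[OF E.is_group H_subgroup P_normal] P_subset by (simp add: Int_absorb2)

lemma carrier_crossed: "carrier (quot_tgroup (sub_tgroup E H) P) = (\<lambda>x. P #>\<^bsub>E\<^esub> x) ` H"
  by (simp add: carrier_quot_tgroup)

lemma mult_crossed:
  "x \<in> H \<Longrightarrow> y \<in> H \<Longrightarrow> (P #>\<^bsub>E\<^esub> x) \<otimes>\<^bsub>quot_tgroup (sub_tgroup E H) P\<^esub> (P #>\<^bsub>E\<^esub> y) = P #>\<^bsub>E\<^esub> (x \<otimes>\<^bsub>E\<^esub> y)"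
  using mult_quot_tgroup[OF P_normal_H, of x y] by simp

lemma inv_crossed:
  "x \<in> H \<Longrightarrow> inv\<^bsub>quot_tgroup (sub_tgroup E H) P\<^esub> (P #>\<^bsub>E\<^esub> x) = P #>\<^bsub>E\<^esub> (inv\<^bsub>E\<^esub> x)"
  using inv_quot_tgroup[OF P_normal_H, of x] by (simp add: E.is_group H_subgroup)

lemma act_crossed:
  assumes "g \<in> carrier E" "x \<in> carrier E"
  shows "conj_by E g ` (P #>\<^bsub>E\<^esub> x) = P #>\<^bsub>E\<^esub> conj_by E g x"
proof -
  interpret P: normal P E by (rule P_normal)
  have "conj_by E g ` (P #>\<^bsub>E\<^esub> x) = (\<lambda>p. conj_by E g p \<otimes>\<^bsub>E\<^esub> conj_by E g x) ` P"
    using assms by (force simp: r_coset_def conj_by_def E_simps)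
  also have "\<dots> = (\<lambda>p. p \<otimes>\<^bsub>E\<^esub> conj_by E g x) ` conj_by E g ` P"
    by (simp add: image_image)
  also have "conj_by E g ` P = P"
  proof
    show "conj_by E g ` P \<subseteq> P"
      using P.inv_op_closed2 assms by (auto simp: conj_by_def)
    show "P \<subseteq> conj_by E g ` P"
    proof
      fix p assume p: "p \<in> P"
      then have "p = conj_by E g (inv\<^bsub>E\<^esub> g \<otimes>\<^bsub>E\<^esub> p \<otimes>\<^bsub>E\<^esub> g)"
        using assms by (simp add: conj_by_def E_simps)
      then show "p \<in> conj_by E g ` P"
        using P.inv_op_closed1[OF assms(1) p] by blast
    qed
  qed
  finally show ?thesis
    by (auto simp: r_coset_def)
qed

lemma bd_crossed:
  assumes "x \<in> carrier E"
  shows "the_elem (d1 ` (P #>\<^bsub>E\<^esub> x)) = d1 x"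
proof -
  have "d1 ` (P #>\<^bsub>E\<^esub> x) = {d1 x}"
    using assms subgroup.mem_carrier[OF P_subgroup] subgroup.one_closed[OF P_subgroup]
    by (auto simp: r_coset_def d1_P image_iff intro!: bexI[of _ "\<one>\<^bsub>E\<^esub>"])
  then show ?thesis
    by simp
qed

lemma coset_crossed_eq_iff:
  assumes "x \<in> carrier E" "y \<in> carrier E"
  shows "P #>\<^bsub>E\<^esub> x = P #>\<^bsub>E\<^esub> y \<longleftrightarrow> x \<otimes>\<^bsub>E\<^esub> inv\<^bsub>E\<^esub> y \<in> P"
  by (rule normal.r_coset_eq_iff[OF P_normal assms])

text \<open>Joint continuity is checked before dividing and descends along the product of the
  identity of \<open>F\<close> with the coset projection, a quotient map because both factors are
  open.\<close>

lemma continuous_map_act: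
  "continuous_map (prod_topology (gtop F) (quot_topology (sub_tgroup E H) P))
     (quot_topology (sub_tgroup E H) P) (\<lambda>(g, c). conj_by E (s g) ` c)"
proof -
  let ?S = "subtopology (gtop E) H" and ?Q = "quot_topology (sub_tgroup E H) P"
  let ?Z = "prod_topology (gtop F) ?S" and ?\<pi> = "\<lambda>x. P #>\<^bsub>E\<^esub> x"
  have \<pi>: "continuous_map ?S ?Q ?\<pi>"
    using continuous_map_coset[OF tH, of P] by simp
  have tS: "topspace ?S = H"
    using topological_groupD(2)[OF tH] by simp
  have q: "quotient_map ?Z (prod_topology (gtop F) ?Q) (\<lambda>(x, y). (x, ?\<pi> y))"
  proof (rule quotient_map_prod_open[OF _ _ _ \<pi>])
    show "continuous_map (gtop F) (gtop F) (\<lambda>x. x)"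
      by (rule continuous_map_id[unfolded id_def])
    show "open_map ?S ?Q ?\<pi>"
      using open_map_coset[OF tH P_normal_H] by simp
    show "?\<pi> ` topspace ?S = topspace ?Q"
      using carrier_crossed tS by (simp only: topspace_quot_topology[OF tH])
  qed (simp_all add: open_map_def)
  have "continuous_map ?Z (gtop E) (\<lambda>z. s (fst z))"
    using continuous_map_compose[OF continuous_map_fst cont_homD(2)[OF s]] by (simp only: o_def)
  moreover have "continuous_map ?Z (gtop E) snd"
    using continuous_map_compose[OF continuous_map_snd
        continuous_map_from_subtopology[OF continuous_map_id[unfolded id_def]]] by (simp only: o_def)
  ultimately have "continuous_map ?Z (gtop E) (\<lambda>z. conj_by E (s (fst z)) (snd z))"
    unfolding conj_by_def
    by (intro continuous_map_group_mult[OF tE] continuous_map_group_inv[OF tE])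
  then have "continuous_map ?Z ?S (\<lambda>z. conj_by E (s (fst z)) (snd z))"
    by (rule continuous_map_into_subtopology)
      (auto simp: tS topological_groupD[OF tF] conj_by_in_H)
  from continuous_map_compose[OF this \<pi>]
  have "continuous_map ?Z ?Q ((\<lambda>(g, c). conj_by E (s g) ` c) \<circ> (\<lambda>(x, y). (x, ?\<pi> y)))"
  proof (rule continuous_map_eq)
    fix z assume "z \<in> topspace ?Z"
    then have "s (fst z) \<in> carrier E" "snd z \<in> carrier E"
      by (auto simp: topological_groupD[OF tF] H_carrier)
    from act_crossed[OF this]
    show "(?\<pi> \<circ> (\<lambda>z. conj_by E (s (fst z)) (snd z))) z =
        ((\<lambda>(g, c). conj_by E (s g) ` c) \<circ> (\<lambda>(x, y). (x, ?\<pi> y))) z"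
      by (simp add: case_prod_unfold)
  qed
  then show ?thesis
    by (rule continuous_compose_quotient_map[OF q])
qed

theorem proC_crossed_module_crossed: "proC_crossed_module C crossed"
proof -
  let ?M = "quot_tgroup (sub_tgroup E H) P"
  have M: "proC_group C ?M"
    by (intro proC_group_quot_tgroup proC_group_sub_tgroup C E H_subgroup H_closed P_normal_H
        P_closed_subgroup_H)
  have bd: "(\<lambda>c. the_elem (d1 ` c)) \<in> cont_hom ?M F"
  proof -
    have "continuous_map (subtopology (gtop E) H) (gtop F) (\<lambda>x. the_elem (d1 ` (P #>\<^bsub>E\<^esub> x)))"
      by (rule continuous_map_eq[OF continuous_map_from_subtopology[OF cont_homD(2)[OF d1]]])
        (simp add: bd_crossed topological_groupD[OF tE])
    then have "continuous_map (quot_topology (sub_tgroup E H) P) (gtop F) (\<lambda>c. the_elem (d1 ` c))"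
      by (intro continuous_map_from_quot[OF tH]) simp
    then show ?thesis
      by (auto simp: cont_hom_def hom_def carrier_crossed mult_crossed bd_crossed H_carrier)
  qed
  have act: "conj_by E (s g) ` (P #>\<^bsub>E\<^esub> x) = P #>\<^bsub>E\<^esub> conj_by E (s g) x" "conj_by E (s g) x \<in> H"
    if "g \<in> carrier F" "x \<in> H" for g x
    using that by (simp_all add: act_crossed H_carrier conj_by_in_H)
  have "conj_by E (s g) ` c \<in> carrier ?M"
      "conj_by E (s g) ` (c \<otimes>\<^bsub>?M\<^esub> d) = conj_by E (s g) ` c \<otimes>\<^bsub>?M\<^esub> conj_by E (s g) ` d"
    if "g \<in> carrier F" "c \<in> carrier ?M" "d \<in> carrier ?M" for g c d
  proof -
    obtain x y where xy: "x \<in> H" "y \<in> H" "c = P #>\<^bsub>E\<^esub> x" "d = P #>\<^bsub>E\<^esub> y"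
      using \<open>c \<in> carrier ?M\<close> \<open>d \<in> carrier ?M\<close> unfolding carrier_crossed by blast
    show "conj_by E (s g) ` c \<in> carrier ?M"
      using act[OF that(1) xy(1)] xy by (simp add: carrier_crossed)
    have "conj_by E (s g) (x \<otimes>\<^bsub>E\<^esub> y) = conj_by E (s g) x \<otimes>\<^bsub>E\<^esub> conj_by E (s g) y"
      using that xy by (simp add: conj_by_def H_carrier E_simps)
    then show "conj_by E (s g) ` (c \<otimes>\<^bsub>?M\<^esub> d) = conj_by E (s g) ` c \<otimes>\<^bsub>?M\<^esub> conj_by E (s g) ` d"
      using act that(1) xy subgroup.m_closed[OF H_subgroup xy(1,2)] by (simp add: mult_crossed)
  qed
  then have act_hom: "(\<lambda>c. conj_by E (s g) ` c) \<in> hom ?M ?M" if "g \<in> carrier F" for g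
    using that by (intro homI) auto
  have act_one: "conj_by E (s \<one>\<^bsub>F\<^esub>) ` c = c" if "c \<in> carrier ?M" for c
    using that act[OF F.one_closed] by (auto simp: carrier_crossed conj_by_def H_carrier)
  have act_mult: "conj_by E (s (g \<otimes>\<^bsub>F\<^esub> g')) ` c = conj_by E (s g) ` (conj_by E (s g') ` c)"
    if "g \<in> carrier F" "g' \<in> carrier F" "c \<in> carrier ?M" for g g' c
  proof -
    obtain x where x: "x \<in> H" "c = P #>\<^bsub>E\<^esub> x"
      using \<open>c \<in> carrier ?M\<close> unfolding carrier_crossed by blast
    have "conj_by E (s (g \<otimes>\<^bsub>F\<^esub> g')) x = conj_by E (s g) (conj_by E (s g') x)"
      using that x by (simp add: conj_by_def H_carrier E_simps)
    then show ?thesis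
      using that(1,2) x by (simp only: act F.m_closed)
  qed
  have cm1: "the_elem (d1 ` (conj_by E (s g) ` c)) = g \<otimes>\<^bsub>F\<^esub> the_elem (d1 ` c) \<otimes>\<^bsub>F\<^esub> inv\<^bsub>F\<^esub> g"
    if "g \<in> carrier F" "c \<in> carrier ?M" for g c
  proof -
    obtain x where x: "x \<in> H" "c = P #>\<^bsub>E\<^esub> x"
      using \<open>c \<in> carrier ?M\<close> unfolding carrier_crossed by blast
    show ?thesis
      using that(1) x by (simp only: act bd_crossed H_carrier) (simp add: conj_by_def H_carrier)
  qed
  have cm2: "conj_by E (s (the_elem (d1 ` c))) ` c' = c \<otimes>\<^bsub>?M\<^esub> c' \<otimes>\<^bsub>?M\<^esub> inv\<^bsub>?M\<^esub> c"
    if "c \<in> carrier ?M" "c' \<in> carrier ?M" for c c'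
  proof -
    obtain x y where xy: "x \<in> H" "y \<in> H" "c = P #>\<^bsub>E\<^esub> x" "c' = P #>\<^bsub>E\<^esub> y"
      using \<open>c \<in> carrier ?M\<close> \<open>c' \<in> carrier ?M\<close> unfolding carrier_crossed by blast
    note cl = subgroup.m_closed[OF H_subgroup] subgroup.m_inv_closed[OF H_subgroup] H_carrier
    have "conj_by E (s (the_elem (d1 ` c))) ` c' = P #>\<^bsub>E\<^esub> conj_by E (s (d1 x)) y"
      using xy by (simp add: act bd_crossed H_carrier)
    \<comment> \<open>The two representatives differ by \<open>peiffer x y\<close>: this is
      CM2.\<close>
    also have "\<dots> = P #>\<^bsub>E\<^esub> (x \<otimes>\<^bsub>E\<^esub> y \<otimes>\<^bsub>E\<^esub> inv\<^bsub>E\<^esub> x)"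
    proof (rule sym, subst coset_crossed_eq_iff)
      show "x \<otimes>\<^bsub>E\<^esub> y \<otimes>\<^bsub>E\<^esub> inv\<^bsub>E\<^esub> x \<otimes>\<^bsub>E\<^esub> inv\<^bsub>E\<^esub> conj_by E (s (d1 x)) y \<in> P"
        using peiffer_in_P[OF xy(1,2)] by (simp add: peiffer_def)
    qed (use xy in \<open>simp_all add: H_carrier conj_by_def\<close>)
    also have "\<dots> = c \<otimes>\<^bsub>?M\<^esub> c' \<otimes>\<^bsub>?M\<^esub> inv\<^bsub>?M\<^esub> c"
      using xy cl by (simp add: mult_crossed inv_crossed)
    finally show ?thesis .
  qed
  show ?thesis
    unfolding proC_crossed_module_def crossed_def Let_def crossed.simps gtop_quot_tgroup
    by (intro conjI ballI M F bd act_hom act_one act_mult continuous_map_act cm1 cm2)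
qed

end

section \<open>Degree 2: the image of the Moore complex is the Peiffer subgroup\<close>

lemma equalizer_closed_subgroup:
  assumes f: "f \<in> cont_hom G K" and g: "g \<in> cont_hom G K"
    and G: "topological_group G" and K: "topological_group K" "Hausdorff_space (gtop K)"
  shows "subgroup {x \<in> carrier G. f x = g x} G" "closedin (gtop G) {x \<in> carrier G. f x = g x}"
proof -
  interpret f: group_hom G K f by (rule cont_hom_group_hom[OF f G K(1)])
  interpret g: group_hom G K g by (rule cont_hom_group_hom[OF g G K(1)])
  show "subgroup {x \<in> carrier G. f x = g x} G"
    using f.hom_one g.hom_one by (intro f.G.subgroupI) auto
  have "closedin (gtop G) {x \<in> topspace (gtop G). f x = g x}"
    by (rule closedin_continuous_maps_eq[OF K(2) cont_homD(2)[OF f] cont_homD(2)[OF g]])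
  then show "closedin (gtop G) {x \<in> carrier G. f x = g x}"
    by (simp add: topological_groupD[OF G])
qed

context reflexive_graph
begin

text \<open>The reflexive graph is the bottom of a simplicial group whose degree 2 part \<open>L\<close>, with faces
  \<open>e0\<close>, \<open>e1\<close>, \<open>e2\<close> and degeneracies \<open>t0\<close>, \<open>t1\<close>, is generated by degenerate elements. Modulo
  \<open>P\<close> the kernels of \<open>d0\<close> and \<open>d1\<close> commute, so composition of arrows is a homomorphism, and on
  degenerate 2-simplices \<open>e1\<close> is the composite of \<open>e2\<close> and \<open>e0\<close>; hence it is so on all of \<open>L\<close>.\<close>

proposition peiffer_eq_image_moore:
  fixes L :: "'l tgroup"
  assumes L: "proC_group C L"
    and e0: "e0 \<in> cont_hom L E" and e1: "e1 \<in> cont_hom L E" and e2: "e2 \<in> cont_hom L E"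
    and t0: "t0 \<in> hom E L" and t1: "t1 \<in> hom E L"
    and et [simp]: "\<And>x. x \<in> carrier E \<Longrightarrow> e0 (t0 x) = x" "\<And>x. x \<in> carrier E \<Longrightarrow> e1 (t0 x) = x"
      "\<And>x. x \<in> carrier E \<Longrightarrow> e2 (t0 x) = s (d1 x)" "\<And>x. x \<in> carrier E \<Longrightarrow> e0 (t1 x) = s (d0 x)"
      "\<And>x. x \<in> carrier E \<Longrightarrow> e1 (t1 x) = x" "\<And>x. x \<in> carrier E \<Longrightarrow> e2 (t1 x) = x"
    and gen: "\<And>S. \<lbrakk>subgroup S L; closedin (gtop L) S; t0 ` carrier E \<subseteq> S; t1 ` carrier E \<subseteq> S\<rbrakk> \<Longrightarrow>
      carrier L \<subseteq> S"
  shows "e2 ` {w \<in> carrier L. e0 w = \<one>\<^bsub>E\<^esub> \<and> e1 w = \<one>\<^bsub>E\<^esub>} = P"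
proof
  note tL = proC_groupD(1)[OF L]
  interpret L: group L by (rule proC_groupD[OF L])
  interpret e0: group_hom L E e0 by (rule cont_hom_group_hom[OF e0 tL tE])
  interpret e1: group_hom L E e1 by (rule cont_hom_group_hom[OF e1 tL tE])
  interpret e2: group_hom L E e2 by (rule cont_hom_group_hom[OF e2 tL tE])
  interpret t0: group_hom E L t0 by unfold_locales (rule t0)
  interpret t1: group_hom E L t1 by unfold_locales (rule t1)
  define M where "M = {w \<in> carrier L. e0 w = \<one>\<^bsub>E\<^esub> \<and> e1 w = \<one>\<^bsub>E\<^esub>}"
  have M_eq: "M = kernel L E e0 \<inter> kernel L E e1"
    by (auto simp: M_def kernel_def)
  have M_sub: "subgroup M L"
    unfolding M_eq by (intro L.subgroups_Inter_pair e0.subgroup_kernel e1.subgroup_kernel)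
  have "closedin (gtop L) M"
    unfolding M_eq by (intro closedin_Int kernel_closed_normal(2)[OF _ tL tE proC_groupD(4)[OF E]] e0 e1)
  \<comment> \<open>\<open>P\<close> is a closed hull, so its generators can be tested only against
    a closed set. The image of \<open>M\<close> is closed as a compact subset of a Hausdorff
    space.\<close>
  then have "compactin (gtop E) (e2 ` M)"
    using image_compactin[OF closedin_compact_space cont_homD(2)[OF e2]] proC_groupD(3)[OF L] by blast
  then have clos: "closedin (gtop E) (e2 ` M)"
    by (rule compactin_imp_closedin[OF proC_groupD(4)[OF E]])
  have sub: "subgroup (e2 ` M) E"
    by (rule e2.subgroup_img_is_subgroup[OF M_sub])
  have "(\<lambda>x. x) ` P \<subseteq> e2 ` M"
  proof (rule cont_hom_image_P[OF tE cont_hom_id sub clos])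
    fix a b assume ab: "a \<in> H" "b \<in> H"
    let ?w = "t1 a \<otimes>\<^bsub>L\<^esub> t1 b \<otimes>\<^bsub>L\<^esub> inv\<^bsub>L\<^esub> t1 a \<otimes>\<^bsub>L\<^esub> inv\<^bsub>L\<^esub> (t0 a \<otimes>\<^bsub>L\<^esub> t1 b \<otimes>\<^bsub>L\<^esub> inv\<^bsub>L\<^esub> t0 a)"
    \<comment> \<open>As \<open>d0 a\<close> and \<open>d0 b\<close> are trivial, \<open>e0\<close>
      kills \<open>t1 a\<close> and \<open>t1 b\<close>; \<open>e1\<close> sends both halves of the
      word to \<open>a b a^-1\<close>. Under \<open>e2\<close>, \<open>t0 a\<close> becomes
      \<open>s (d1 a)\<close>, which turns the second half into the action.\<close>
    have "?w \<in> M"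
      using ab by (simp add: M_def H_iff E_simps)
    moreover have "e2 ?w = peiffer a b"
      using ab by (simp add: H_iff peiffer_def conj_by_def)
    ultimately show "peiffer a b \<in> e2 ` M"
      by (metis imageI)
  qed
  then show "P \<subseteq> e2 ` {w \<in> carrier L. e0 w = \<one>\<^bsub>E\<^esub> \<and> e1 w = \<one>\<^bsub>E\<^esub>}"
    by (simp add: M_def)

  \<comment> \<open>The arrows \<open>e0 w\<close> and \<open>e2 w\<close> are composable. This
    simplicial identity is recovered from the generators; it places the element \<open>h\<close>
    below in \<open>H\<close>.\<close>
  have de: "d0 (e2 w) = d1 (e0 w)" if "w \<in> carrier L" for w
  proof -
    have "carrier L \<subseteq> {w \<in> carrier L. d0 (e2 w) = d1 (e0 w)}"
    proof (rule gen)
      show "subgroup {w \<in> carrier L. d0 (e2 w) = d1 (e0 w)} L"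
          "closedin (gtop L) {w \<in> carrier L. d0 (e2 w) = d1 (e0 w)}"
        by (rule equalizer_closed_subgroup[OF cont_hom_compose[OF e2 d0] cont_hom_compose[OF e0 d1]
              tL tF proC_groupD(4)[OF F]])+
    qed auto
    then show ?thesis
      using that by blast
  qed
  let ?Q = "quot_tgroup E P" and ?\<pi> = "\<lambda>x. P #>\<^bsub>E\<^esub> x"
  note tQ = topological_group_quot_tgroup[OF tE P_normal]
  have HQ: "Hausdorff_space (gtop ?Q)"
    using Hausdorff_space_quot_topology[OF tE P_normal P_closed] by simp
  have \<pi>: "?\<pi> \<in> cont_hom E ?Q"
    using group_hom.homh[OF quot_tgroup_hom[OF P_normal]] continuous_map_coset[OF tE, of P]
    by (simp add: cont_hom_def)
  define f where "f w = e2 w \<otimes>\<^bsub>E\<^esub> inv\<^bsub>E\<^esub> s (d1 (e0 w)) \<otimes>\<^bsub>E\<^esub> e0 w" for w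
  have f_in [simp]: "f w \<in> carrier E" if "w \<in> carrier L" for w
    using that by (simp add: f_def)
  \<comment> \<open>Multiplicativity holds only modulo \<open>P\<close>: with
    \<open>f v = e2 v k\<close> and \<open>f w = h e0 w\<close>, the product contains
    \<open>k h\<close> where \<open>f\<close> of the product contains \<open>h k\<close>. As
    \<open>h\<close> has trivial \<open>d0\<close> and \<open>k\<close> trivial \<open>d1\<close>,
    the commutator lies in \<open>P\<close>.\<close>
  have f_hom: "?\<pi> (f (v \<otimes>\<^bsub>L\<^esub> w)) = ?\<pi> (f v \<otimes>\<^bsub>E\<^esub> f w)" if v: "v \<in> carrier L" and w: "w \<in> carrier L" for v w
  proof -
    define h where "h = e2 w \<otimes>\<^bsub>E\<^esub> inv\<^bsub>E\<^esub> s (d1 (e0 w))"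
    define k where "k = inv\<^bsub>E\<^esub> s (d1 (e0 v)) \<otimes>\<^bsub>E\<^esub> e0 v"
    have h: "h \<in> H" and k: "k \<in> carrier E" "d1 k = \<one>\<^bsub>F\<^esub>"
      using v w by (simp_all add: h_def k_def H_iff de)
    let ?c = "k \<otimes>\<^bsub>E\<^esub> h \<otimes>\<^bsub>E\<^esub> inv\<^bsub>E\<^esub> k \<otimes>\<^bsub>E\<^esub> inv\<^bsub>E\<^esub> h"
    have "f (v \<otimes>\<^bsub>L\<^esub> w) \<otimes>\<^bsub>E\<^esub> inv\<^bsub>E\<^esub> (f v \<otimes>\<^bsub>E\<^esub> f w) = e2 v \<otimes>\<^bsub>E\<^esub> inv\<^bsub>E\<^esub> ?c \<otimes>\<^bsub>E\<^esub> inv\<^bsub>E\<^esub> e2 v"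
      using v w by (simp add: f_def h_def k_def E_simps)
    also have "\<dots> \<in> P"
      using v commutator_in_P[OF k h]
      by (intro normal.inv_op_closed2[OF P_normal] subgroup.m_inv_closed[OF P_subgroup]) auto
    finally show ?thesis
      using v w by (simp add: coset_crossed_eq_iff)
  qed
  have f_cont: "continuous_map (gtop L) (gtop E) f"
    unfolding f_def
    by (intro continuous_map_group_mult[OF tE] continuous_map_group_inv[OF tE] cont_homD(2)[OF e2]
        cont_homD(2)[OF cont_hom_compose[OF cont_hom_compose[OF e0 d1] s]] cont_homD(2)[OF e0])
  have \<pi>f: "(\<lambda>w. ?\<pi> (f w)) \<in> cont_hom L ?Q"
    using continuous_map_compose[OF f_cont cont_homD(2)[OF \<pi>]]
    by (auto simp: cont_hom_def hom_def o_def f_hom mult_quot_tgroup P_normal carrier_quot_tgroup)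
  have "carrier L \<subseteq> {w \<in> carrier L. ?\<pi> (f w) = ?\<pi> (e1 w)}"
  proof (rule gen)
    show "subgroup {w \<in> carrier L. ?\<pi> (f w) = ?\<pi> (e1 w)} L"
        "closedin (gtop L) {w \<in> carrier L. ?\<pi> (f w) = ?\<pi> (e1 w)}"
      by (rule equalizer_closed_subgroup[OF \<pi>f cont_hom_compose[OF e1 \<pi>] tL tQ HQ])+
  qed (auto simp: f_def E_simps)
  then have "f w \<otimes>\<^bsub>E\<^esub> inv\<^bsub>E\<^esub> e1 w \<in> P" if "w \<in> carrier L" for w
    using that by (subst coset_crossed_eq_iff[symmetric]) auto
  then show "e2 ` {w \<in> carrier L. e0 w = \<one>\<^bsub>E\<^esub> \<and> e1 w = \<one>\<^bsub>E\<^esub>} \<subseteq> P"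
    by (fastforce simp: f_def)
qed

end

section \<open>Morphisms of reflexive graphs over a fixed base\<close>

locale reflexive_graph_hom =
  A: reflexive_graph C E F d0 d1 s + B: reflexive_graph C E' F d0' d1' s'
  for C :: "nat monoid set" and E :: "'e tgroup" and F :: "'f tgroup" and d0 d1 s
    and E' :: "'h tgroup" and d0' d1' s' +
  fixes f :: "'e \<Rightarrow> 'h"
  assumes f: "f \<in> cont_hom E E'"
    and f_d0: "x \<in> carrier E \<Longrightarrow> d0' (f x) = d0 x"
    and f_d1: "x \<in> carrier E \<Longrightarrow> d1' (f x) = d1 x"
    and f_s: "g \<in> carrier F \<Longrightarrow> f (s g) = s' g"
begin

sublocale f: group_hom E E' f by (rule cont_hom_group_hom[OF f A.tE B.tE])

lemma f_H: "x \<in> A.H \<Longrightarrow> f x \<in> B.H"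
  by (simp add: A.H_iff B.H_iff f_d0)

lemma f_P: "f ` A.P \<subseteq> B.P"
proof (rule A.cont_hom_image_P[OF B.tE f B.P_subgroup B.P_closed])
  fix a b assume ab: "a \<in> A.H" "b \<in> A.H"
  have "f (A.peiffer a b) = B.peiffer (f a) (f b)"
    using ab by (simp add: A.peiffer_def B.peiffer_def conj_by_def A.H_carrier f_d1 f_s)
  then show "f (A.peiffer a b) \<in> B.P"
    using B.peiffer_in_P ab f_H by simp
qed

text \<open>The induced map on cosets is the direct image, so \<open>f\<close> must carry
  \<open>A.P\<close> onto \<open>B.P\<close>; an inclusion would only produce a subset of a
  coset.\<close>

lemma image_coset:
  assumes "f ` A.P = B.P" "x \<in> carrier E"
  shows "f ` (A.P #>\<^bsub>E\<^esub> x) = B.P #>\<^bsub>E'\<^esub> f x"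
proof -
  have "f ` (A.P #>\<^bsub>E\<^esub> x) = (\<lambda>p. f p \<otimes>\<^bsub>E'\<^esub> f x) ` A.P"
    using assms(2) subgroup.mem_carrier[OF A.P_subgroup] by (force simp: r_coset_def)
  also have "\<dots> = (\<lambda>p. p \<otimes>\<^bsub>E'\<^esub> f x) ` (f ` A.P)"
    by (simp add: image_image)
  finally show ?thesis
    by (auto simp: assms(1) r_coset_def)
qed

lemma continuous_map_image_coset:
  assumes P: "f ` A.P = B.P"
  shows "continuous_map (quot_topology (sub_tgroup E A.H) A.P) (quot_topology (sub_tgroup E' B.H) B.P)
    (\<lambda>c. f ` c)"
proof (rule continuous_map_from_quot[OF A.tH])
  have "continuous_map (subtopology (gtop E) A.H) (subtopology (gtop E') B.H) f"
    using continuous_map_from_subtopology[OF cont_homD(2)[OF f]] f_H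
    by (auto simp: continuous_map_in_subtopology)
  from continuous_map_compose[OF this, of "quot_topology (sub_tgroup E' B.H) B.P" "\<lambda>x. B.P #>\<^bsub>E'\<^esub> x"]
  have "continuous_map (subtopology (gtop E) A.H) (quot_topology (sub_tgroup E' B.H) B.P)
      (\<lambda>x. B.P #>\<^bsub>E'\<^esub> f x)"
    using continuous_map_coset[OF B.tH, of B.P] by (simp add: o_def)
  then have "continuous_map (subtopology (gtop E) A.H) (quot_topology (sub_tgroup E' B.H) B.P)
      (\<lambda>x. f ` (A.P #>\<^bsub>E\<^esub> x))"
    by (rule continuous_map_eq) (simp add: image_coset P topological_groupD[OF A.tE])
  then show "continuous_map (gtop (sub_tgroup E A.H)) (quot_topology (sub_tgroup E' B.H) B.P)
      (\<lambda>x. f ` (A.P #>\<^bsub>sub_tgroup E A.H\<^esub> x))"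
    by simp
qed

end

proposition crossed_iso_over_base_reflexive_graph:
  assumes f: "reflexive_graph_hom C E F d0 d1 s E' d0' d1' s' f"
    and g: "reflexive_graph_hom C E' F d0' d1' s' E d0 d1 s g"
    and gf: "\<And>x. x \<in> carrier E \<Longrightarrow> g (f x) = x" and fg: "\<And>y. y \<in> carrier E' \<Longrightarrow> f (g y) = y"
  shows "crossed_iso_over_base (reflexive_graph.crossed E F d0 d1 s)
    (reflexive_graph.crossed E' F d0' d1' s')"
proof -
  interpret f: reflexive_graph_hom C E F d0 d1 s E' d0' d1' s' f by fact
  interpret g: reflexive_graph_hom C E' F d0' d1' s' E d0 d1 s g by fact
  let ?M = "quot_tgroup (sub_tgroup E f.A.H) f.A.P" and ?M' = "quot_tgroup (sub_tgroup E' f.B.H) f.B.P"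
  \<comment> \<open>Each morphism alone gives an inclusion; applying the inverse \<open>g\<close> as
    well gives equality.\<close>
  have fP: "f ` f.A.P = f.B.P"
  proof
    show "f.B.P \<subseteq> f ` f.A.P"
    proof
      fix y assume y: "y \<in> f.B.P"
      then have "g y \<in> f.A.P" "f (g y) = y"
        using g.f_P fg subgroup.mem_carrier[OF f.B.P_subgroup] by auto
      then show "y \<in> f ` f.A.P"
        by force
    qed
  qed (rule f.f_P)
  have "(\<lambda>x. g (f x)) ` f.A.P = (\<lambda>x. x) ` f.A.P"
    by (rule image_cong[OF refl]) (simp add: gf subgroup.mem_carrier[OF f.A.P_subgroup])
  then have gP: "g ` f.B.P = f.A.P"
    by (simp add: fP[symmetric] image_image)
  note fc = f.image_coset[OF fP] and gc = g.image_coset[OF gP]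
  have gfc: "g ` (f ` c) = c" if "c \<in> carrier ?M" for c
    using that unfolding f.A.carrier_crossed
    by (elim imageE) (simp add: fc gc gf f.A.H_carrier)
  have fgc: "f ` (g ` c) = c" if "c \<in> carrier ?M'" for c
    using that unfolding f.B.carrier_crossed
    by (elim imageE) (simp add: fc gc fg f.B.H_carrier)
  have fM: "f ` c \<in> carrier ?M'" if "c \<in> carrier ?M" for c
    using that unfolding f.A.carrier_crossed f.B.carrier_crossed
    by (elim imageE) (simp add: fc f.A.H_carrier f.f_H)
  have gM: "g ` c \<in> carrier ?M" if "c \<in> carrier ?M'" for c
    using that unfolding f.A.carrier_crossed f.B.carrier_crossed
    by (elim imageE) (simp add: gc f.B.H_carrier g.f_H)
  have "(\<lambda>c. f ` c) \<in> hom ?M ?M'"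
  proof (rule homI)
    fix c d assume "c \<in> carrier ?M" "d \<in> carrier ?M"
    then obtain x y where xy: "x \<in> f.A.H" "y \<in> f.A.H" "c = f.A.P #>\<^bsub>E\<^esub> x" "d = f.A.P #>\<^bsub>E\<^esub> y"
      unfolding f.A.carrier_crossed by blast
    then show "f ` (c \<otimes>\<^bsub>?M\<^esub> d) = f ` c \<otimes>\<^bsub>?M'\<^esub> f ` d"
      by (simp add: f.A.mult_crossed f.B.mult_crossed fc f.A.H_carrier f.f_H)
  qed (rule fM)
  moreover have "bij_betw (\<lambda>c. f ` c) (carrier ?M) (carrier ?M')"
    by (rule bij_betwI[of _ _ _ "\<lambda>c. g ` c"]) (use fM gM gfc fgc in auto)
  ultimately have iso: "(\<lambda>c. f ` c) \<in> iso ?M ?M'"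
    by (simp add: iso_def)
  have "homeomorphic_maps (gtop ?M) (gtop ?M') (\<lambda>c. f ` c) (\<lambda>c. g ` c)"
    using f.continuous_map_image_coset[OF fP] g.continuous_map_image_coset[OF gP] gfc fgc
    by (simp add: homeomorphic_maps_def topspace_quot_topology f.A.tH f.B.tH)
  then have homeo: "homeomorphic_map (gtop ?M) (gtop ?M') (\<lambda>c. f ` c)"
    by (auto simp: homeomorphic_map_maps)
  have act: "f ` (conj_by E (s a) ` c) = conj_by E' (s' a) ` (f ` c)"
    if "a \<in> carrier F" "c \<in> carrier ?M" for a c
  proof -
    obtain x where x: "x \<in> f.A.H" "c = f.A.P #>\<^bsub>E\<^esub> x"
      using \<open>c \<in> carrier ?M\<close> unfolding f.A.carrier_crossed by blast
    have "f (conj_by E (s a) x) = conj_by E' (s' a) (f x)"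
      using that x by (simp add: conj_by_def f.A.H_carrier f.f_s)
    then show ?thesis
      using that x by (simp add: f.A.act_crossed f.B.act_crossed fc f.A.H_carrier f.A.conj_by_in_H)
  qed
  have bd: "the_elem (d1' ` (f ` c)) = the_elem (d1 ` c)" if "c \<in> carrier ?M" for c
    using that unfolding f.A.carrier_crossed
    by (elim imageE) (simp add: fc f.A.bd_crossed f.B.bd_crossed f.A.H_carrier f.f_d1)
  show ?thesis
    unfolding crossed_iso_over_base_def f.A.crossed_def f.B.crossed_def crossed.simps
    by (intro conjI refl exI[of _ "\<lambda>c. f ` c"] ballI iso homeo act bd)
qed

section \<open>Free pro-C groups\<close>

lemma free_proCD:
  assumes "free_proC C Y F \<iota>"
  shows "proC_group C F" "continuous_map Y (gtop F) \<iota>" "y \<in> topspace Y \<Longrightarrow> \<iota> y \<in> carrier F"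
proof -
  show "proC_group C F" "continuous_map Y (gtop F) \<iota>"
    using assms by (simp_all add: free_proC_def)
  then show "y \<in> topspace Y \<Longrightarrow> \<iota> y \<in> carrier F"
    using continuous_map_image_subset_topspace[of Y "gtop F" \<iota>] proC_groupD(5)[of C F] by blast
qed

text \<open>The maps \<open>\<eta> 0 (Inl x)\<close> and \<open>\<iota> x\<close> are assumed equal
  only on points of \<open>X\<close>, so freeness has to be carried over from one to the
  other.\<close>

lemma free_proC_cong:
  fixes F :: "'f tgroup" and Y :: "'y topology"
  assumes "free_proC C Y F \<iota>" and eq: "\<And>y. y \<in> topspace Y \<Longrightarrow> \<iota> y = \<kappa> y"
  shows "free_proC C Y F \<kappa>"
proof -
  have "continuous_map Y (gtop F) \<kappa>"
    using free_proCD(2)[OF assms(1)] eq by (rule continuous_map_eq)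
  moreover have "(\<forall>y\<in>topspace Y. h (\<kappa> y) = f y) \<longleftrightarrow> (\<forall>y\<in>topspace Y. h (\<iota> y) = f y)"
    for h f :: "_ \<Rightarrow> 'f + nat"
    using eq by simp
  ultimately show ?thesis
    using assms(1) unfolding free_proC_def by simp
qed

text \<open>The description in \<open>free_ext\<close> denotes by
  \<open>free_proC_universal\<close>, which covers test groups on every type; the groups compared
  here live on different types.\<close>

lemma free_ext:
  assumes "group_class C" "free_proC C Y F \<iota>" "proC_group C K" "continuous_map Y (gtop K) f"
  shows "free_ext Y F \<iota> K f \<in> cont_hom F K"
    and "y \<in> topspace Y \<Longrightarrow> free_ext Y F \<iota> K f (\<iota> y) = f y"
  using theI'[OF free_proC_universal[OF assms]] unfolding free_ext_def by blast+

text \<open>The extension of \<open>\<iota>\<close> to a homomorphism into the closed subgroup is the identity.\<close>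

lemma free_proC_generators:
  assumes C: "group_class C" and F: "free_proC C Y F \<iota>"
    and S: "subgroup S F" "closedin (gtop F) S" "\<iota> ` topspace Y \<subseteq> S"
  shows "carrier F \<subseteq> S"
proof
  fix x assume x: "x \<in> carrier F"
  note FC = free_proCD(1)[OF F] and \<iota> = free_proCD(2)[OF F]
  interpret F: group F by (rule proC_groupD(2)[OF FC])
  have KC: "proC_group C (sub_tgroup F S)"
    by (rule proC_group_sub_tgroup[OF C FC S(1,2)])
  have c: "continuous_map Y (gtop (sub_tgroup F S)) \<iota>"
    using \<iota> S(3) by (auto simp: continuous_map_in_subtopology)
  let ?h = "free_ext Y F \<iota> (sub_tgroup F S) \<iota>"
  have h: "?h \<in> cont_hom F (sub_tgroup F S)" "?h x \<in> S"
    using free_ext(1)[OF C F KC c] x by (auto simp: cont_hom_def hom_def)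
  \<comment> \<open>Uniqueness in the universal property concerns functions extensional on the
    carrier, so both competitors are cut down to it.\<close>
  let ?h' = "restrict ?h (carrier F)" and ?i = "restrict (\<lambda>x. x) (carrier F)"
  have "?h' \<in> hom F F"
    using h(1) subgroup.subset[OF S(1)] by (auto simp: cont_hom_def hom_def)
  moreover have "continuous_map (gtop F) (gtop F) ?h"
    using h(1) by (auto simp: cont_hom_def continuous_map_in_subtopology)
  then have "continuous_map (gtop F) (gtop F) ?h'"
    by (rule continuous_map_eq) (simp add: proC_groupD(5)[OF FC])
  ultimately have 1: "?h' \<in> cont_hom F F \<inter> extensional (carrier F)" "\<forall>y\<in>topspace Y. ?h' (\<iota> y) = \<iota> y"
    using free_ext(2)[OF C F KC c] free_proCD(3)[OF F] by (auto simp: cont_hom_def)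
  have "continuous_map (gtop F) (gtop F) ?i"
    by (rule continuous_map_eq[OF continuous_map_id]) (simp add: proC_groupD(5)[OF FC])
  then have 2: "?i \<in> cont_hom F F \<inter> extensional (carrier F)" "\<forall>y\<in>topspace Y. ?i (\<iota> y) = \<iota> y"
    using free_proCD(3)[OF F] by (auto simp: cont_hom_def hom_def)
  have "?h' = ?i"
    by (rule ex1E[OF free_proC_universal[OF C F FC \<iota>]]) (use 1 2 in blast)
  then have "?h x = x"
    using x by (metis restrict_apply')
  then show "x \<in> S"
    using h(2) by simp
qed

text \<open>The equalizer is a closed subgroup containing the generators. Values are compared on the
  carrier only, so composites and \<open>\<lambda>x. x\<close> can be used although they are not
  extensional.\<close>

lemma free_proC_hom_eq:
  assumes C: "group_class C" and F: "free_proC C Y F \<iota>" and K: "proC_group C K"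
    and fg: "f \<in> cont_hom F K" "g \<in> cont_hom F K"
    and eq: "\<And>y. y \<in> topspace Y \<Longrightarrow> f (\<iota> y) = g (\<iota> y)"
    and x: "x \<in> carrier F"
  shows "f x = g x"
proof -
  note FC = free_proCD(1)[OF F]
  have "carrier F \<subseteq> {x \<in> carrier F. f x = g x}"
    by (rule free_proC_generators[OF C F
          equalizer_closed_subgroup[OF fg proC_groupD(1)[OF FC] proC_groupD(1,4)[OF K]]])
      (use eq free_proCD(3)[OF F] in auto)
  then show ?thesis
    using x by auto
qed

section \<open>Sums of spaces and the generating spaces\<close>

lemma topspace_disjoint_sum [simp]:
  "topspace (disjoint_sum X Y) = Inl ` topspace X \<union> Inr ` topspace Y"
proof
  have *: "{x. Inl x \<in> Inl ` topspace X \<union> Inr ` topspace Y} = topspace X"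
    "{y. Inr y \<in> Inl ` topspace X \<union> Inr ` topspace Y} = topspace Y"
    by auto
  have "openin (disjoint_sum X Y) (Inl ` topspace X \<union> Inr ` topspace Y)"
    unfolding openin_disjoint_sum * by simp
  then show "Inl ` topspace X \<union> Inr ` topspace Y \<subseteq> topspace (disjoint_sum X Y)"
    by (rule openin_subset)
  show "topspace (disjoint_sum X Y) \<subseteq> Inl ` topspace X \<union> Inr ` topspace Y"
    using openin_topspace[of "disjoint_sum X Y"] unfolding openin_disjoint_sum by blast
qed

lemma continuous_map_disjoint_sum:
  "continuous_map (disjoint_sum X Y) Z f \<longleftrightarrow>
     continuous_map X Z (\<lambda>x. f (Inl x)) \<and> continuous_map Y Z (\<lambda>y. f (Inr y))"
proof -
  have *: "{x. Inl x \<in> {z \<in> topspace (disjoint_sum X Y). f z \<in> U}} = {x \<in> topspace X. f (Inl x) \<in> U}"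
    "{y. Inr y \<in> {z \<in> topspace (disjoint_sum X Y). f z \<in> U}} = {y \<in> topspace Y. f (Inr y) \<in> U}" for U
    by auto
  have **: "{z \<in> topspace (disjoint_sum X Y). f z \<in> U} \<subseteq> Inl ` topspace X \<union> Inr ` topspace Y" for U
    by auto
  show ?thesis
    unfolding continuous_map_def openin_disjoint_sum * using ** by (auto simp: Pi_iff)
qed

lemma continuous_map_sum_topology:
  "continuous_map (sum_topology X I) Z f \<longleftrightarrow> (\<forall>i\<in>I. continuous_map (X i) Z (\<lambda>x. f (i, x)))"
proof -
  have *: "{x. (i, x) \<in> {z \<in> topspace (sum_topology X I). f z \<in> U}} = {x \<in> topspace (X i). f (i, x) \<in> U}"
    if "i \<in> I" for i U
    using that by auto
  have **: "{z \<in> topspace (sum_topology X I). f z \<in> U} \<subseteq> Sigma I (topspace \<circ> X)" for U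
    by auto
  show ?thesis
    unfolding continuous_map_def openin_sum_topology using ** by (auto simp: * Pi_iff cong: ball_cong)
qed

lemma topspace_gen_space:
  "topspace (gen_space X R n) = Inl ` topspace X \<union> Inr ` (mono_surj n 1 \<times> topspace R)"
  by (auto simp: gen_space_def)

lemma continuous_map_gen_space:
  "continuous_map (gen_space X R n) Z f \<longleftrightarrow> continuous_map X Z (\<lambda>x. f (Inl x)) \<and>
     (\<forall>t\<in>mono_surj n 1. continuous_map R Z (\<lambda>\<rho>. f (Inr (t, \<rho>))))"
  by (simp add: gen_space_def continuous_map_disjoint_sum continuous_map_sum_topology)


section \<open>Monotone surjections onto the 1-simplex\<close>

text \<open>Restricted because members of \<open>mono_surj\<close> are extensional
  functions.\<close>

definition surj_id :: "nat \<Rightarrow> nat" where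
  "surj_id = restrict (\<lambda>j. j) {..1}"

text \<open>The surjections with values 0,0,1 and 0,1,1, for \<open>i\<close> equal to 0 and 1. The
  composite form is the index that \<open>degen_gen\<close> produces from
  \<open>surj_id\<close>.\<close>

definition surj_degen :: "nat \<Rightarrow> nat \<Rightarrow> nat" where
  "surj_degen i = compose {..2} surj_id (codegen i)"

lemma atMost_1: "{..Suc 0} = {0, Suc 0}" and atMost_2: "{..2} = {0, Suc 0, 2}"
  by auto

text \<open>Degree 0 thus has no generators from \<open>R\<close>, and a face into degree 0 always
  takes one of the two constant branches of \<open>face_gen\<close>.\<close>

lemma mono_surj_0_1: "mono_surj 0 1 = {}"
proof -
  have False if "t \<in> mono_surj 0 1" for t
  proof -
    have "{t 0} = {0, Suc 0}"
      using that by (simp add: mono_surj_def atMost_1)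
    then show False
      by (simp add: set_eq_iff) (metis n_not_Suc_n)
  qed
  then show ?thesis
    by blast
qed

lemma mono_surj_1_1: "mono_surj 1 1 = {surj_id}"
proof
  show "{surj_id} \<subseteq> mono_surj 1 1"
    by (auto simp: mono_surj_def PiE_def surj_id_def mono_on_def)
  show "mono_surj 1 1 \<subseteq> {surj_id}"
  proof
    fix t assume "t \<in> mono_surj 1 1"
    then have t: "t \<in> extensional {..Suc 0}" "mono_on {..Suc 0} t" "t ` {..Suc 0} = {..Suc 0}"
      by (simp_all add: mono_surj_def PiE_def)
    have "t 0 \<le> t (Suc 0)" "{t 0, t (Suc 0)} = {0, Suc 0}"
      using t(2,3) by (auto simp: mono_on_def atMost_1)
    then have "t 0 = 0" "t (Suc 0) = Suc 0"
      by (auto simp: doubleton_eq_iff)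
    then have "t = surj_id"
      by (intro extensionalityI[OF t(1), of surj_id]) (auto simp: surj_id_def atMost_1)
    then show "t \<in> {surj_id}"
      by simp
  qed
qed

lemma surj_degen_apply:
  "surj_degen 0 0 = 0" "surj_degen 0 (Suc 0) = 0" "surj_degen 0 2 = Suc 0"
  "surj_degen (Suc 0) 0 = 0" "surj_degen (Suc 0) (Suc 0) = Suc 0" "surj_degen (Suc 0) 2 = Suc 0"
  by (auto simp: surj_degen_def compose_def codegen_def surj_id_def)

text \<open>The end values are forced to be 0 and 1; the middle value is free and is itself the
  index of the degeneracy.\<close>

lemma mono_surj_2_1: "mono_surj 2 1 = {surj_degen 0, surj_degen 1}"
proof
  have ext: "surj_degen i \<in> extensional {..2}" for i
    by (simp add: surj_degen_def)
  show "{surj_degen 0, surj_degen 1} \<subseteq> mono_surj 2 1"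
    using ext by (auto simp: mono_surj_def PiE_def atMost_2 atMost_1 mono_on_def surj_degen_apply)
  show "mono_surj 2 1 \<subseteq> {surj_degen 0, surj_degen 1}"
  proof
    fix t assume "t \<in> mono_surj 2 1"
    then have t: "t \<in> extensional {..2}" "mono_on {..2} t" "t ` {..2} = {..Suc 0}"
      by (simp_all add: mono_surj_def PiE_def)
    have le: "t 0 \<le> t (Suc 0)" "t (Suc 0) \<le> t 2"
      using t(2) by (auto simp: mono_on_def)
    have im: "{t 0, t (Suc 0), t 2} = {0, Suc 0}"
      using t(3) by (simp add: atMost_1 atMost_2)
    have *: "x = 0 \<and> z = Suc 0 \<and> (y = 0 \<or> y = Suc 0)"
      if "x \<le> y" "y \<le> z" "{x, y, z} = {0, Suc 0}" for x y z
    proof -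
      have "0 \<in> {x, y, z}" "Suc 0 \<in> {x, y, z}"
        unfolding that(3) by simp_all
      moreover have "x \<in> {0, Suc 0}" "y \<in> {0, Suc 0}" "z \<in> {0, Suc 0}"
        unfolding that(3)[symmetric] by simp_all
      ultimately show ?thesis
        using that(1,2) by auto
    qed
    have "t x = surj_degen (t (Suc 0)) x" if "x \<in> {..2}" for x
      using *[OF le im] that by (auto simp: atMost_2 surj_degen_apply)
    then have "t = surj_degen (t (Suc 0))"
      by (rule extensionalityI[OF t(1) ext])
    then have "t = surj_degen 0 \<or> t = surj_degen (Suc 0)"
      using *[OF le im] by metis
    then show "t \<in> {surj_degen 0, surj_degen 1}"
      by simp
  qed
qed

lemma compose_surj_id_coface:
  "compose {..0} surj_id (coface 0) ` {..0} = {1}" "compose {..0} surj_id (coface 1) ` {..0} = {0}"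
  by (auto simp: compose_def coface_def surj_id_def)

text \<open>Four composites are again \<open>surj_id\<close>. The other two are constant 0 and
  constant 1, where the face becomes \<open>\<omega>\<close> and the identity element; only their
  images are recorded, since \<open>face_gen\<close> tests these.\<close>

lemma compose_surj_degen_coface:
  "compose {..1} (surj_degen 0) (coface 0) = surj_id"
  "compose {..1} (surj_degen 0) (coface 1) = surj_id"
  "compose {..1} (surj_degen 0) (coface 2) ` {..1} = {0}"
  "compose {..1} (surj_degen 1) (coface 0) ` {..1} = {1}"
  "compose {..1} (surj_degen 1) (coface 1) = surj_id"
  "compose {..1} (surj_degen 1) (coface 2) = surj_id"
  by (auto simp: compose_def coface_def surj_id_def surj_degen_def codegen_def fun_eq_iff atMost_1)

lemma mono_surj_image: "t \<in> mono_surj n 1 \<Longrightarrow> t ` {..n} = {0, 1}"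
  by (simp add: mono_surj_def atMost_1)

section \<open>The first step of the pas-a-pas construction\<close>

text \<open>\<open>face_gen\<close> reads \<open>\<omega>\<close> through an extension from
  \<open>X\<close> itself, so freeness of \<open>L 0\<close> on \<open>X\<close> is recorded beside
  freeness on the sum \<open>gen_space X R 0\<close>.\<close>

locale pas_a_pas =
  fixes C :: "nat monoid set" and X :: "'x topology" and R :: "'r topology" and \<omega> :: "'r \<Rightarrow> 'f"
    and L :: "nat \<Rightarrow> 'f tgroup" and \<eta> :: "nat \<Rightarrow> 'x + (nat \<Rightarrow> nat) \<times> 'r \<Rightarrow> 'f"
  assumes C: "group_class C"
    and L: "\<And>n. free_proC C (gen_space X R n) (L n) (\<eta> n)"
    and X: "free_proC C X (L 0) (\<lambda>x. \<eta> 0 (Inl x))"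
    and \<omega>: "continuous_map R (gtop (L 0)) \<omega>"
begin

definition face :: "nat \<Rightarrow> nat \<Rightarrow> 'f \<Rightarrow> 'f" where
  "face n i = sface (pas_a_pas1 X R \<omega> L \<eta>) n i"

definition degen :: "nat \<Rightarrow> nat \<Rightarrow> 'f \<Rightarrow> 'f" where
  "degen n i = sdegen (pas_a_pas1 X R \<omega> L \<eta>) n i"

definition incl :: "nat \<Rightarrow> 'f \<Rightarrow> 'f" where
  "incl n = free_ext X (L 0) (\<lambda>x. \<eta> 0 (Inl x)) (L n) (\<lambda>x. \<eta> n (Inl x))"

lemma proC_L: "proC_group C (L n)"
  by (rule free_proCD(1)[OF L])

lemma continuous_map_\<eta>:
  "continuous_map X (gtop (L n)) (\<lambda>x. \<eta> n (Inl x))"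
  "t \<in> mono_surj n 1 \<Longrightarrow> continuous_map R (gtop (L n)) (\<lambda>\<rho>. \<eta> n (Inr (t, \<rho>)))"
  using free_proCD(2)[OF L, of n] by (simp_all add: continuous_map_gen_space)

lemma \<omega>_in: "\<rho> \<in> topspace R \<Longrightarrow> \<omega> \<rho> \<in> carrier (L 0)"
  using continuous_map_image_subset_topspace[OF \<omega>] proC_groupD(5)[OF proC_L] by blast

lemma incl: "incl n \<in> cont_hom (L 0) (L n)" "x \<in> topspace X \<Longrightarrow> incl n (\<eta> 0 (Inl x)) = \<eta> n (Inl x)"
  unfolding incl_def by (rule free_ext[OF C X proC_L continuous_map_\<eta>(1)]; assumption?)+

lemma incl_0:
  assumes "g \<in> carrier (L 0)"
  shows "incl 0 g = g"
  by (rule free_proC_hom_eq[OF C X proC_L incl(1) cont_hom_id incl(2) assms])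

text \<open>The branch in \<open>face_gen\<close> depends on \<open>t\<close> and \<open>i\<close>
  only, so a single formula applies on each copy of \<open>R\<close>.\<close>

lemma continuous_map_face_gen: "continuous_map (gen_space X R n) (gtop (L (n - 1))) (face_gen X \<omega> L \<eta> n i)"
  unfolding continuous_map_gen_space
proof (intro conjI ballI)
  show "continuous_map X (gtop (L (n - 1))) (\<lambda>x. face_gen X \<omega> L \<eta> n i (Inl x))"
    by (simp add: face_gen_def continuous_map_\<eta>)
  fix t :: "nat \<Rightarrow> nat"
  let ?u = "compose {..n - 1} t (coface i)"
  have "continuous_map R (gtop (L (n - 1))) (\<lambda>\<rho>. incl (n - 1) (\<omega> \<rho>))"
    using continuous_map_compose[OF \<omega> cont_homD(2)[OF incl(1)]] by (simp add: o_def)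
  moreover have "continuous_map R (gtop (L (n - 1))) (\<lambda>\<rho>. \<one>\<^bsub>L (n - 1)\<^esub>)"
    using proC_groupD[OF proC_L] by (intro continuous_map_group_const) (auto simp: group.is_monoid)
  ultimately show "continuous_map R (gtop (L (n - 1))) (\<lambda>\<rho>. face_gen X \<omega> L \<eta> n i (Inr (t, \<rho>)))"
    using continuous_map_\<eta>(2)[of ?u "n - 1"]
    by (cases "?u \<in> mono_surj (n - 1) 1"; cases "?u ` {..n - 1} = {0}")
      (simp_all only: face_gen_def sum.case prod.case Let_def incl_def if_True if_False
        simp_thms)
qed

lemma face:
  shows "face n i \<in> cont_hom (L n) (L (n - 1))"
    and "y \<in> topspace (gen_space X R n) \<Longrightarrow> face n i (\<eta> n y) = face_gen X \<omega> L \<eta> n i y"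
  unfolding face_def pas_a_pas1_def simplicial_tgroup.simps
  by (rule free_ext[OF C L proC_L continuous_map_face_gen]; assumption?)+

text \<open>The reindexing condition is discharged only in the two degrees used, in
  \<open>degen_0\<close> and \<open>degen_1\<close>.\<close>

lemma degen:
  assumes "\<forall>t\<in>mono_surj n 1. compose {..Suc n} t (codegen i) \<in> mono_surj (Suc n) 1"
  shows "degen n i \<in> cont_hom (L n) (L (Suc n))"
    and "y \<in> topspace (gen_space X R n) \<Longrightarrow> degen n i (\<eta> n y) = degen_gen \<eta> n i y"
proof -
  have "continuous_map (gen_space X R n) (gtop (L (Suc n))) (degen_gen \<eta> n i)"
    unfolding continuous_map_gen_space using continuous_map_\<eta>(1)[of "Suc n"] continuous_map_\<eta>(2)[of _ "Suc n"] assms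
    by (simp add: degen_gen_def)
  note free_ext[OF C L proC_L this]
  then show "degen n i \<in> cont_hom (L n) (L (Suc n))"
      "y \<in> topspace (gen_space X R n) \<Longrightarrow> degen n i (\<eta> n y) = degen_gen \<eta> n i y"
    by (simp_all add: degen_def pas_a_pas1_def)
qed

lemma face_Inl:
  "x \<in> topspace X \<Longrightarrow> face n i (\<eta> n (Inl x)) = \<eta> (n - 1) (Inl x)"
  by (simp add: face(2) topspace_gen_space face_gen_def)

lemma face_1:
  assumes "\<rho> \<in> topspace R"
  shows "face 1 0 (\<eta> 1 (Inr (surj_id, \<rho>))) = \<one>\<^bsub>L 0\<^esub>" "face 1 1 (\<eta> 1 (Inr (surj_id, \<rho>))) = \<omega> \<rho>"
proof -
  have *: "face 1 i (\<eta> 1 (Inr (surj_id, \<rho>))) = (if compose {..0} surj_id (coface i) ` {..0} = {0}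
      then \<omega> \<rho> else \<one>\<^bsub>L 0\<^esub>)" for i
  proof -
    have "Inr (surj_id, \<rho>) \<in> topspace (gen_space X R 1)"
      unfolding topspace_gen_space mono_surj_1_1 using assms by simp
    from face(2)[OF this] show ?thesis
      unfolding face_gen_def diff_self_eq_0 sum.case prod.case Let_def mono_surj_0_1 empty_iff if_False
        incl_0[OF \<omega>_in[OF assms], unfolded incl_def] .
  qed
  show "face 1 0 (\<eta> 1 (Inr (surj_id, \<rho>))) = \<one>\<^bsub>L 0\<^esub>" "face 1 1 (\<eta> 1 (Inr (surj_id, \<rho>))) = \<omega> \<rho>"
    unfolding * compose_surj_id_coface by simp_all
qed

lemma face_2:
  assumes "\<rho> \<in> topspace R"
  shows "face 2 0 (\<eta> 2 (Inr (surj_degen 0, \<rho>))) = \<eta> 1 (Inr (surj_id, \<rho>))"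
    "face 2 1 (\<eta> 2 (Inr (surj_degen 0, \<rho>))) = \<eta> 1 (Inr (surj_id, \<rho>))"
    "face 2 2 (\<eta> 2 (Inr (surj_degen 0, \<rho>))) = incl 1 (\<omega> \<rho>)"
    "face 2 0 (\<eta> 2 (Inr (surj_degen 1, \<rho>))) = \<one>\<^bsub>L 1\<^esub>"
    "face 2 1 (\<eta> 2 (Inr (surj_degen 1, \<rho>))) = \<eta> 1 (Inr (surj_id, \<rho>))"
    "face 2 2 (\<eta> 2 (Inr (surj_degen 1, \<rho>))) = \<eta> 1 (Inr (surj_id, \<rho>))"
proof -
  have two: "(2::nat) - 1 = 1"
    by simp
  have *: "face 2 i (\<eta> 2 (Inr (t, \<rho>))) = (let u = compose {..1} t (coface i) in
      if u \<in> mono_surj 1 1 then \<eta> 1 (Inr (u, \<rho>)) else if u ` {..1} = {0} then incl 1 (\<omega> \<rho>)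
      else \<one>\<^bsub>L 1\<^esub>)" if "t \<in> mono_surj 2 1" for t i
  proof -
    have "Inr (t, \<rho>) \<in> topspace (gen_space X R 2)"
      using that assms by (simp add: topspace_gen_space image_iff)
    from face(2)[OF this] show ?thesis
      unfolding face_gen_def two sum.case prod.case incl_def .
  qed
  \<comment> \<open>A constant map is not onto the 1-simplex, which excludes the first branch of
    \<open>face_gen\<close>.\<close>
  have n: "u \<notin> mono_surj 1 1" if "u ` {..1} = {0} \<or> u ` {..1} = {1}" for u :: "nat \<Rightarrow> nat"
  proof
    assume "u \<in> mono_surj 1 1"
    then have "{0, 1} = {0::nat} \<or> {0, 1} = {1::nat}"
      using that mono_surj_image[of u 1] by simp
    then show False
      by (simp add: doubleton_eq_iff)
  qed
  have t: "surj_degen 0 \<in> mono_surj 2 1" "surj_degen 1 \<in> mono_surj 2 1" "surj_id \<in> mono_surj 1 1"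
    by (simp_all only: mono_surj_2_1 mono_surj_1_1 insert_iff simp_thms)
  note n0 = n[OF disjI1[OF compose_surj_degen_coface(3)]] n[OF disjI2[OF compose_surj_degen_coface(4)]]
  show "face 2 0 (\<eta> 2 (Inr (surj_degen 0, \<rho>))) = \<eta> 1 (Inr (surj_id, \<rho>))"
    "face 2 1 (\<eta> 2 (Inr (surj_degen 0, \<rho>))) = \<eta> 1 (Inr (surj_id, \<rho>))"
    "face 2 2 (\<eta> 2 (Inr (surj_degen 0, \<rho>))) = incl 1 (\<omega> \<rho>)"
    "face 2 0 (\<eta> 2 (Inr (surj_degen 1, \<rho>))) = \<one>\<^bsub>L 1\<^esub>"
    "face 2 1 (\<eta> 2 (Inr (surj_degen 1, \<rho>))) = \<eta> 1 (Inr (surj_id, \<rho>))"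
    "face 2 2 (\<eta> 2 (Inr (surj_degen 1, \<rho>))) = \<eta> 1 (Inr (surj_id, \<rho>))"
    unfolding *[OF t(1)] *[OF t(2)] compose_surj_degen_coface(1,2,5,6) Let_def
    using t(3) n0 by (simp_all only: if_True if_False compose_surj_degen_coface(3,4)) simp_all
qed

text \<open>Both homomorphisms fix \<open>X\<close>, and \<open>L 0\<close> is free on
  \<open>X\<close>. Hence the values \<open>incl 1 (\<omega> \<rho>)\<close> of faces in degree 2
  are degenerate.\<close>

lemma degen_0: "degen 0 0 \<in> cont_hom (L 0) (L 1)" "g \<in> carrier (L 0) \<Longrightarrow> degen 0 0 g = incl 1 g"
proof -
  have "\<forall>t\<in>mono_surj 0 1. compose {..Suc 0} t (codegen 0) \<in> mono_surj (Suc 0) 1"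
    unfolding mono_surj_0_1 by blast
  note d = degen[of 0 0, OF this]
  show *: "degen 0 0 \<in> cont_hom (L 0) (L 1)"
    using d(1) by simp
  have Inl: "degen 0 0 (\<eta> 0 (Inl x)) = \<eta> 1 (Inl x)" if "x \<in> topspace X" for x
    using d(2)[of "Inl x"] that by (simp add: topspace_gen_space degen_gen_def)
  show "degen 0 0 g = incl 1 g" if "g \<in> carrier (L 0)"
    by (rule free_proC_hom_eq[OF C X proC_L * incl(1) _ that]) (simp only: Inl incl(2))
qed

lemma degen_1:
  assumes "i \<in> {0, 1}"
  shows "degen 1 i \<in> cont_hom (L 1) (L 2)"
    "x \<in> topspace X \<Longrightarrow> degen 1 i (\<eta> 1 (Inl x)) = \<eta> 2 (Inl x)"
    "\<rho> \<in> topspace R \<Longrightarrow> degen 1 i (\<eta> 1 (Inr (surj_id, \<rho>))) = \<eta> 2 (Inr (surj_degen i, \<rho>))"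
proof -
  have two: "Suc 1 = 2"
    by simp
  have "\<forall>t\<in>mono_surj 1 1. compose {..Suc 1} t (codegen i) \<in> mono_surj (Suc 1) 1"
    using assms unfolding mono_surj_1_1 two mono_surj_2_1 by (auto simp: surj_degen_def)
  note d = degen[of 1 i, OF this, unfolded two]
  show "degen 1 i \<in> cont_hom (L 1) (L 2)"
    by (rule d(1))
  show "degen 1 i (\<eta> 1 (Inl x)) = \<eta> 2 (Inl x)" if "x \<in> topspace X"
  proof -
    have "Inl x \<in> topspace (gen_space X R 1)"
      using that by (simp add: topspace_gen_space)
    from d(2)[OF this] show ?thesis
      unfolding degen_gen_def sum.case two .
  qed
  show "degen 1 i (\<eta> 1 (Inr (surj_id, \<rho>))) = \<eta> 2 (Inr (surj_degen i, \<rho>))" if "\<rho> \<in> topspace R"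
  proof -
    have "Inr (surj_id, \<rho>) \<in> topspace (gen_space X R 1)"
      unfolding topspace_gen_space mono_surj_1_1 using that by simp
    from d(2)[OF this] show ?thesis
      unfolding degen_gen_def sum.case prod.case two surj_degen_def .
  qed
qed

lemma L1_hom_eq:
  assumes K: "proC_group C K" and f: "f \<in> cont_hom (L 1) K" and g: "g \<in> cont_hom (L 1) K"
    and "\<And>x. x \<in> topspace X \<Longrightarrow> f (\<eta> 1 (Inl x)) = g (\<eta> 1 (Inl x))"
    and "\<And>\<rho>. \<rho> \<in> topspace R \<Longrightarrow> f (\<eta> 1 (Inr (surj_id, \<rho>))) = g (\<eta> 1 (Inr (surj_id, \<rho>)))"
    and "z \<in> carrier (L 1)"
  shows "f z = g z"
proof (rule free_proC_hom_eq[OF C L K f g _ assms(6)])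
  fix y assume "y \<in> topspace (gen_space X R 1)"
  then show "f (\<eta> 1 y) = g (\<eta> 1 y)"
    unfolding topspace_gen_space mono_surj_1_1 using assms(4,5) by blast
qed

lemma face_1_cont_hom: "face 1 i \<in> cont_hom (L 1) (L 0)"
  using face(1)[of 1 i] by simp

lemma face_2_cont_hom: "face 2 i \<in> cont_hom (L 2) (L 1)"
  using face(1)[of 2 i] by simp

lemma face_degen_0:
  assumes "g \<in> carrier (L 0)"
  shows "face 1 i (degen 0 0 g) = g"
proof (rule free_proC_hom_eq[OF C X proC_L cont_hom_compose[OF degen_0(1) face_1_cont_hom] cont_hom_id _ assms])
  fix x assume "x \<in> topspace X"
  then show "face 1 i (degen 0 0 (\<eta> 0 (Inl x))) = \<eta> 0 (Inl x)"
    using face_Inl[of x 1 i] free_proCD(3)[OF X] by (simp add: degen_0(2) incl(2))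
qed

sublocale reflexive_graph C "L 1" "L 0" "face 1 0" "face 1 1" "degen 0 0"
  by unfold_locales
    (rule C proC_L face_1_cont_hom degen_0(1) face_degen_0; assumption?)+

text \<open>Both sides are homomorphisms on \<open>L 1\<close>, so \<open>X\<close> and
  \<open>R\<close> are tested. On \<open>R\<close>, the third identity comes from the face with
  value \<open>\<omega> \<rho>\<close>, the fourth from the face with value 1.\<close>

lemma face_degen_1:
  assumes z: "z \<in> carrier (L 1)"
  shows "face 2 0 (degen 1 0 z) = z" "face 2 1 (degen 1 0 z) = z"
    "face 2 2 (degen 1 0 z) = degen 0 0 (face 1 1 z)" "face 2 0 (degen 1 1 z) = degen 0 0 (face 1 0 z)"
    "face 2 1 (degen 1 1 z) = z" "face 2 2 (degen 1 1 z) = z"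
proof -
  have two: "(2::nat) - 1 = 1"
    by simp
  have Inl: "face 2 j (degen 1 i (\<eta> 1 (Inl x))) = \<eta> 1 (Inl x)"
    if "i \<in> {0, 1}" "x \<in> topspace X" for i j x
    using that face_Inl[of x 2 j] degen_1(2) by (simp only: two)
  have Inl': "degen 0 0 (face 1 j (\<eta> 1 (Inl x))) = \<eta> 1 (Inl x)" if "x \<in> topspace X" for j x
    using that face_Inl[of x 1 j] free_proCD(3)[OF X] by (simp only: degen_0(2) incl(2) diff_self_eq_0)
  note ch = cont_hom_compose[OF degen_1(1) face_2_cont_hom] cont_hom_compose[OF face_1_cont_hom degen_0(1)]
  note ev = degen_1(3) face_2 face_1 degen_0(2) \<omega>_in s.hom_one
  show "face 2 0 (degen 1 0 z) = z" "face 2 1 (degen 1 0 z) = z"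
      "face 2 1 (degen 1 1 z) = z" "face 2 2 (degen 1 1 z) = z"
    by (rule L1_hom_eq[OF proC_L ch(1) cont_hom_id _ _ z]; simp only: Inl ev insert_iff simp_thms)+
  show "face 2 2 (degen 1 0 z) = degen 0 0 (face 1 1 z)" "face 2 0 (degen 1 1 z) = degen 0 0 (face 1 0 z)"
    by (rule L1_hom_eq[OF proC_L ch(1) ch(2) _ _ z]; simp only: Inl Inl' ev insert_iff simp_thms)+
qed

text \<open>Each surjection from the 2-simplex to the 1-simplex is a codegeneracy followed by
  \<open>surj_id\<close>, so every generator in degree 2 is degenerate.\<close>

lemma L2_generated:
  assumes S: "subgroup S (L 2)" "closedin (gtop (L 2)) S"
    and sub: "degen 1 0 ` carrier (L 1) \<subseteq> S" "degen 1 1 ` carrier (L 1) \<subseteq> S"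
  shows "carrier (L 2) \<subseteq> S"
proof (rule free_proC_generators[OF C L S])
  have 1: "\<eta> 1 (Inl x) \<in> carrier (L 1)" if "x \<in> topspace X" for x
    by (rule free_proCD(3)[OF L]) (use that in \<open>simp add: topspace_gen_space\<close>)
  have 2: "\<eta> 1 (Inr (surj_id, \<rho>)) \<in> carrier (L 1)" if "\<rho> \<in> topspace R" for \<rho>
    by (rule free_proCD(3)[OF L]) (use that in \<open>simp only: topspace_gen_space mono_surj_1_1; simp\<close>)
  have "\<eta> 2 (Inl x) \<in> S" if "x \<in> topspace X" for x
    using sub(1) 1[OF that] degen_1(2)[of 0 x] that by force
  moreover have "\<eta> 2 (Inr (surj_degen i, \<rho>)) \<in> S" if "i \<in> {0, 1}" "\<rho> \<in> topspace R" for i \<rho>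
    using sub 2[OF that(2)] degen_1(3)[OF that] that(1) by force
  ultimately show "\<eta> 2 ` topspace (gen_space X R 2) \<subseteq> S"
    unfolding topspace_gen_space mono_surj_2_1 by auto
qed

text \<open>The bound \<open>i < n\<close> in \<open>moore\<close> leaves \<open>d_0\<close> in
  degree 1, hence \<open>H\<close>, and \<open>d_0\<close>, \<open>d_1\<close> in degree 2, hence
  the set treated in \<open>peiffer_eq_image_moore\<close>.\<close>

theorem moore_crossed_eq: "moore_crossed (pas_a_pas1 X R \<omega> L \<eta>) = crossed"
proof -
  let ?S = "pas_a_pas1 X R \<omega> L \<eta>"
  have two: "(2::nat) - 1 = 1"
    by simp
  have sobj: "sobj ?S = L"
    by (simp add: pas_a_pas1_def)
  have m1: "moore ?S 1 = H"
    unfolding moore_def H_def kernel_def sobj face_def[symmetric] diff_self_eq_0 less_one by simp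
  have "moore ?S 2 = {w \<in> carrier (L 2). face 2 0 w = \<one>\<^bsub>L 1\<^esub> \<and> face 2 1 w = \<one>\<^bsub>L 1\<^esub>}"
    unfolding moore_def sobj face_def[symmetric] two by (auto simp: less_2_cases_iff)
  then have m2: "sface ?S 2 2 ` moore ?S 2 = P"
    unfolding face_def[symmetric]
    using peiffer_eq_image_moore[OF proC_L face_2_cont_hom face_2_cont_hom face_2_cont_hom
        cont_homD(1)[OF degen_1(1)] cont_homD(1)[OF degen_1(1)], of 0 1]
      face_degen_1 L2_generated by (simp only: insert_iff simp_thms)
  show ?thesis
    unfolding moore_crossed_def crossed_def m1 m2 sobj
    by (simp add: face_def[abs_def] degen_def[abs_def])
qed

end

section \<open>The crossed module of a presentation\<close>

locale crossed_presentation =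
  fixes C :: "nat monoid set" and X :: "'x topology" and R :: "'r topology" and \<omega> :: "'r \<Rightarrow> 'f"
    and F :: "'f tgroup" and \<iota> :: "'x \<Rightarrow> 'f" and E :: "'e tgroup" and \<epsilon> :: "'x + 'r \<Rightarrow> 'e"
  assumes C: "group_class C"
    and F_free: "free_proC C X F \<iota>"
    and E_free: "free_proC C (disjoint_sum X R) E \<epsilon>"
    and \<omega>: "continuous_map R (gtop F) \<omega>"
begin

abbreviation incl :: "'f \<Rightarrow> 'e" where
  "incl \<equiv> pres_incl X F \<iota> E \<epsilon>"

abbreviation \<Theta> :: "'e \<Rightarrow> 'f" where
  "\<Theta> \<equiv> pres_\<Theta> X R \<omega> F \<iota> E \<epsilon>"

text \<open>Plays the part of \<open>d0\<close>, with \<open>\<Theta>\<close> as \<open>d1\<close>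
  and \<open>incl\<close> as the section; it is the counterpart of \<open>face 1 0\<close>.\<close>

definition retr :: "'e \<Rightarrow> 'f" where
  "retr = free_ext (disjoint_sum X R) E \<epsilon> F (case_sum \<iota> (\<lambda>\<rho>. \<one>\<^bsub>F\<^esub>))"

lemma proC: "proC_group C F" "proC_group C E"
  by (rule free_proCD(1)[OF F_free] free_proCD(1)[OF E_free])+

lemma \<epsilon>_in:
  "x \<in> topspace X \<Longrightarrow> \<epsilon> (Inl x) \<in> carrier E" "\<rho> \<in> topspace R \<Longrightarrow> \<epsilon> (Inr \<rho>) \<in> carrier E"
  by (rule free_proCD(3)[OF E_free]; simp)+

lemma continuous_map_\<epsilon>:
  "continuous_map X (gtop E) (\<lambda>x. \<epsilon> (Inl x))" "continuous_map R (gtop E) (\<lambda>\<rho>. \<epsilon> (Inr \<rho>))"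
  using free_proCD(2)[OF E_free] by (simp_all add: continuous_map_disjoint_sum)

lemma incl: "incl \<in> cont_hom F E" "x \<in> topspace X \<Longrightarrow> incl (\<iota> x) = \<epsilon> (Inl x)"
  unfolding pres_incl_def by (rule free_ext[OF C F_free proC(2) continuous_map_\<epsilon>(1)]; assumption?)+

lemma \<Theta>:
  shows "\<Theta> \<in> cont_hom E F" and "x \<in> topspace X \<Longrightarrow> \<Theta> (\<epsilon> (Inl x)) = \<iota> x"
    and "\<rho> \<in> topspace R \<Longrightarrow> \<Theta> (\<epsilon> (Inr \<rho>)) = \<omega> \<rho>"
proof -
  have "continuous_map (disjoint_sum X R) (gtop F) (case_sum \<iota> \<omega>)"
    using free_proCD(2)[OF F_free] \<omega> by (simp add: continuous_map_disjoint_sum)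
  note e = free_ext[OF C E_free proC(1) this, folded pres_\<Theta>_def]
  show "\<Theta> \<in> cont_hom E F"
    by (rule e(1))
  show "x \<in> topspace X \<Longrightarrow> \<Theta> (\<epsilon> (Inl x)) = \<iota> x" "\<rho> \<in> topspace R \<Longrightarrow> \<Theta> (\<epsilon> (Inr \<rho>)) = \<omega> \<rho>"
    using e(2)[of "Inl x"] e(2)[of "Inr \<rho>"] by simp_all
qed

lemma retr:
  shows "retr \<in> cont_hom E F" and "x \<in> topspace X \<Longrightarrow> retr (\<epsilon> (Inl x)) = \<iota> x"
    and "\<rho> \<in> topspace R \<Longrightarrow> retr (\<epsilon> (Inr \<rho>)) = \<one>\<^bsub>F\<^esub>"
proof -
  have "continuous_map R (gtop F) (\<lambda>\<rho>. \<one>\<^bsub>F\<^esub>)"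
    using proC_groupD(1,2)[OF proC(1)] by (intro continuous_map_group_const) (simp_all add: group.is_monoid)
  then have "continuous_map (disjoint_sum X R) (gtop F) (case_sum \<iota> (\<lambda>\<rho>. \<one>\<^bsub>F\<^esub>))"
    using free_proCD(2)[OF F_free] by (simp add: continuous_map_disjoint_sum)
  note e = free_ext[OF C E_free proC(1) this, folded retr_def]
  show "retr \<in> cont_hom E F"
    by (rule e(1))
  show "x \<in> topspace X \<Longrightarrow> retr (\<epsilon> (Inl x)) = \<iota> x" "\<rho> \<in> topspace R \<Longrightarrow> retr (\<epsilon> (Inr \<rho>)) = \<one>\<^bsub>F\<^esub>"
    using e(2)[of "Inl x"] e(2)[of "Inr \<rho>"] by simp_all
qed

lemma E_hom_eq:
  assumes K: "proC_group C K" and f: "f \<in> cont_hom E K" and g: "g \<in> cont_hom E K"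
    and "\<And>x. x \<in> topspace X \<Longrightarrow> f (\<epsilon> (Inl x)) = g (\<epsilon> (Inl x))"
    and "\<And>\<rho>. \<rho> \<in> topspace R \<Longrightarrow> f (\<epsilon> (Inr \<rho>)) = g (\<epsilon> (Inr \<rho>))"
    and "z \<in> carrier E"
  shows "f z = g z"
proof (rule free_proC_hom_eq[OF C E_free K f g _ assms(6)])
  fix y assume "y \<in> topspace (disjoint_sum X R)"
  then show "f (\<epsilon> y) = g (\<epsilon> y)"
    unfolding topspace_disjoint_sum using assms(4,5) by blast
qed

lemma retr_incl: "g \<in> carrier F \<Longrightarrow> retr (incl g) = g"
  by (rule free_proC_hom_eq[OF C F_free proC(1) cont_hom_compose[OF incl(1) retr(1)] cont_hom_id])
    (simp_all add: incl retr)

lemma \<Theta>_incl: "g \<in> carrier F \<Longrightarrow> \<Theta> (incl g) = g"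
  by (rule free_proC_hom_eq[OF C F_free proC(1) cont_hom_compose[OF incl(1) \<Theta>(1)] cont_hom_id])
    (simp_all add: incl \<Theta>)

sublocale reflexive_graph C E F retr \<Theta> incl
  by unfold_locales (rule C proC retr(1) \<Theta>(1) incl(1) retr_incl \<Theta>_incl; assumption?)+

text \<open>Modulo a closed normal subgroup containing \<open>R\<close>, the retraction onto \<open>F\<close> is the identity.\<close>

lemma pres_H_eq: "pres_H R E \<epsilon> = H"
proof
  show "pres_H R E \<epsilon> \<subseteq> H"
    unfolding pres_H_def closed_normal_gen_def
    using H_normal H_closed retr(3) \<epsilon>_in(2) by (intro Inter_lower) (auto simp: H_iff)
  show "H \<subseteq> pres_H R E \<epsilon>"
  proof
    fix z assume z: "z \<in> H"
    let ?K = "pres_H R E \<epsilon>"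
    have R: "(\<lambda>\<rho>. \<epsilon> (Inr \<rho>)) ` topspace R \<subseteq> carrier E"
      using \<epsilon>_in by auto
    have K: "?K \<lhd> E" "closedin (gtop E) ?K"
      unfolding pres_H_def by (rule closed_normal_gen_closed_normal[OF tE R])+
    have RK: "\<epsilon> (Inr \<rho>) \<in> ?K" if "\<rho> \<in> topspace R" for \<rho>
      using that by (auto simp: pres_H_def closed_normal_gen_def)
    interpret K: normal ?K E by (rule K(1))
    let ?\<pi> = "\<lambda>x. ?K #>\<^bsub>E\<^esub> x"
    have \<pi>: "?\<pi> \<in> cont_hom E (quot_tgroup E ?K)"
      using group_hom.homh[OF quot_tgroup_hom[OF K(1)]] continuous_map_coset[OF tE, of ?K]
      by (simp add: cont_hom_def)
    have "?\<pi> z = ?\<pi> (incl (retr z))"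
    proof (rule E_hom_eq[OF proC_group_quot_tgroup[OF C proC(2) K] \<pi>
          cont_hom_compose[OF cont_hom_compose[OF retr(1) incl(1)] \<pi>] _ _ H_carrier[OF z]])
      show "?\<pi> (\<epsilon> (Inr \<rho>)) = ?\<pi> (incl (retr (\<epsilon> (Inr \<rho>))))" if "\<rho> \<in> topspace R" for \<rho>
        using that RK \<epsilon>_in(2) by (simp add: retr K.r_coset_eq_iff)
    qed (simp add: retr incl)
    then show "z \<in> ?K"
      using z by (simp add: H_iff K.r_coset_eq_iff)
  qed
qed

theorem pres_crossed_eq: "pres_crossed X R \<omega> F \<iota> E \<epsilon> = crossed"
proof -
  have "pres_P X R \<omega> F \<iota> E \<epsilon> = P"
    unfolding pres_P_def P_def peiffer_def pres_H_eq ..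
  then show ?thesis
    by (simp add: pres_crossed_def crossed_def pres_H_eq)
qed

end

section \<open>Comparison of the two reflexive graphs\<close>

theorem mainTheorem6:
  fixes C :: "nat monoid set"
    and X :: "'x topology" and R :: "'r topology" and \<omega> :: "'r \<Rightarrow> 'f"
    and F :: "'f tgroup" and \<iota> :: "'x \<Rightarrow> 'f"
    and G :: "'g tgroup" and p :: "'f \<Rightarrow> 'g"
    and E :: "'e tgroup" and \<epsilon> :: "'x + 'r \<Rightarrow> 'e"
    and L :: "nat \<Rightarrow> 'f tgroup" and \<eta> :: "nat \<Rightarrow> 'x + (nat \<Rightarrow> nat) \<times> 'r \<Rightarrow> 'f"
  assumes "group_class C"
    and "proC_presentation C X R \<omega> F \<iota> G p"
    and "free_proC C (disjoint_sum X R) E \<epsilon>"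
    and "\<And>n. free_proC C (gen_space X R n) (L n) (\<eta> n)"
    and "L 0 = F"
    and "\<And>x. x \<in> topspace X \<Longrightarrow> \<eta> 0 (Inl x) = \<iota> x"
  shows "proC_crossed_module C (moore_crossed (pas_a_pas1 X R \<omega> L \<eta>)) \<and>
    proC_crossed_module C (pres_crossed X R \<omega> F \<iota> E \<epsilon>) \<and>
    crossed_iso_over_base (moore_crossed (pas_a_pas1 X R \<omega> L \<eta>))
      (pres_crossed X R \<omega> F \<iota> E \<epsilon>)"
proof -
  have free: "free_proC C X F \<iota>" and \<omega>: "continuous_map R (gtop F) \<omega>"
    using assms(2) by (auto simp: proC_presentation_def)
  interpret L: pas_a_pas C X R \<omega> L \<eta>
    using assms(1,4,5) \<omega> free_proC_cong[OF free, of "\<lambda>x. \<eta> 0 (Inl x)"] assms(6)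
    by unfold_locales auto
  \<comment> \<open>The base is \<open>L 0\<close>, equal to \<open>F\<close> by assumption, since
    both graphs must share literally the same base.\<close>
  interpret E: crossed_presentation C X R \<omega> "L 0" \<iota> E \<epsilon>
    using assms(1,3,5) \<omega> free by unfold_locales auto
  \<comment> \<open>In degree 1 the index \<open>t\<close> can only be \<open>surj_id\<close>:
    \<open>?g\<close> forgets it and \<open>?h\<close> inserts it.\<close>
  let ?g = "case_sum (\<lambda>x. \<epsilon> (Inl x)) (\<lambda>(t, \<rho>). \<epsilon> (Inr \<rho>))"
    and ?h = "case_sum (\<lambda>x. \<eta> 1 (Inl x)) (\<lambda>\<rho>. \<eta> 1 (Inr (surj_id, \<rho>)))"
  define \<psi> where "\<psi> = free_ext (gen_space X R 1) (L 1) (\<eta> 1) E ?g"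
  define \<phi> where "\<phi> = free_ext (disjoint_sum X R) E \<epsilon> (L 1) ?h"
  have "continuous_map (gen_space X R 1) (gtop E) ?g"
    by (simp add: continuous_map_gen_space E.continuous_map_\<epsilon>)
  note \<psi> = free_ext[OF assms(1) L.L E.proC(2) this, folded \<psi>_def]
  have \<psi>_Inl: "\<psi> (\<eta> 1 (Inl x)) = \<epsilon> (Inl x)" if "x \<in> topspace X" for x
    using that by (subst \<psi>(2)) (auto simp: topspace_gen_space)
  have \<psi>_Inr: "\<psi> (\<eta> 1 (Inr (surj_id, \<rho>))) = \<epsilon> (Inr \<rho>)" if "\<rho> \<in> topspace R" for \<rho>
  proof -
    have "Inr (surj_id, \<rho>) \<in> topspace (gen_space X R 1)"
      unfolding topspace_gen_space mono_surj_1_1 using that by simp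
    then show ?thesis
      by (subst \<psi>(2)) auto
  qed
  have "surj_id \<in> mono_surj 1 1"
    unfolding mono_surj_1_1 by simp
  then have "continuous_map (disjoint_sum X R) (gtop (L 1)) ?h"
    using L.continuous_map_\<eta>(1)[of 1] L.continuous_map_\<eta>(2)[of surj_id 1]
    by (simp add: continuous_map_disjoint_sum)
  note \<phi> = free_ext[OF assms(1) assms(3) L.proC_L this, folded \<phi>_def]
  have \<phi>_Inl: "\<phi> (\<epsilon> (Inl x)) = \<eta> 1 (Inl x)" if "x \<in> topspace X" for x
    using that by (subst \<phi>(2)) auto
  have \<phi>_Inr: "\<phi> (\<epsilon> (Inr \<rho>)) = \<eta> 1 (Inr (surj_id, \<rho>))" if "\<rho> \<in> topspace R" for \<rho>
    using that by (subst \<phi>(2)) auto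
  have face_Inl: "L.face 1 i (\<eta> 1 (Inl x)) = \<iota> x" if "x \<in> topspace X" for x i
    using L.face_Inl[OF that, of 1 i] assms(6)[OF that] by (simp only: diff_self_eq_0)
  have degen_\<iota>: "L.degen 0 0 (\<iota> x) = \<eta> 1 (Inl x)" if "x \<in> topspace X" for x
    using that L.degen_0(2)[of "\<iota> x"] L.incl(2)[of x 1] assms(6) free_proCD(3)[OF E.F_free] by simp
  have \<phi>\<psi>: "\<phi> (\<psi> z) = z" if "z \<in> carrier (L 1)" for z
    by (rule L.L1_hom_eq[OF L.proC_L cont_hom_compose[OF \<psi>(1) \<phi>(1)] cont_hom_id _ _ that])
      (simp_all only: \<psi>_Inl \<psi>_Inr \<phi>_Inl \<phi>_Inr)
  have \<psi>\<phi>: "\<psi> (\<phi> z) = z" if "z \<in> carrier E" for z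
    by (rule E.E_hom_eq[OF E.proC(2) cont_hom_compose[OF \<phi>(1) \<psi>(1)] cont_hom_id _ _ that])
      (simp_all only: \<psi>_Inl \<psi>_Inr \<phi>_Inl \<phi>_Inr)
  note ev = \<psi>_Inl \<psi>_Inr \<phi>_Inl \<phi>_Inr face_Inl L.face_1 E.retr(2,3) E.\<Theta>(2,3) degen_\<iota> E.incl(2)
  have 1: "reflexive_graph_hom C (L 1) (L 0) (L.face 1 0) (L.face 1 1) (L.degen 0 0) E E.retr E.\<Theta> E.incl \<psi>"
  proof (rule reflexive_graph_hom.intro[OF L.reflexive_graph_axioms E.reflexive_graph_axioms],
      rule reflexive_graph_hom_axioms.intro[OF \<psi>(1)])
    show "E.retr (\<psi> z) = L.face 1 0 z" "E.\<Theta> (\<psi> z) = L.face 1 1 z" if "z \<in> carrier (L 1)" for z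
      by (rule L.L1_hom_eq[OF L.proC_L cont_hom_compose[OF \<psi>(1) E.retr(1)] L.face_1_cont_hom _ _ that],
          simp_all only: ev)
        (rule L.L1_hom_eq[OF L.proC_L cont_hom_compose[OF \<psi>(1) E.\<Theta>(1)] L.face_1_cont_hom _ _ that],
          simp_all only: ev)
    show "\<psi> (L.degen 0 0 g) = E.incl g" if "g \<in> carrier (L 0)" for g
      by (rule free_proC_hom_eq[OF assms(1) E.F_free E.proC(2)
            cont_hom_compose[OF L.degen_0(1) \<psi>(1)] E.incl(1) _ that])
        (simp only: ev)
  qed
  have 2: "reflexive_graph_hom C E (L 0) E.retr E.\<Theta> E.incl (L 1) (L.face 1 0) (L.face 1 1) (L.degen 0 0) \<phi>"
  proof (rule reflexive_graph_hom.intro[OF E.reflexive_graph_axioms L.reflexive_graph_axioms],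
      rule reflexive_graph_hom_axioms.intro[OF \<phi>(1)])
    interpret \<psi>: reflexive_graph_hom C "L 1" "L 0" "L.face 1 0" "L.face 1 1" "L.degen 0 0" E E.retr E.\<Theta> E.incl \<psi>
      by (rule 1)
    have \<phi>_in: "\<phi> z \<in> carrier (L 1)" if "z \<in> carrier E" for z
      using that cont_homD(1)[OF \<phi>(1)] by (auto simp: hom_def)
    \<comment> \<open>Transported from the properties of \<open>\<psi>\<close> through
      \<open>\<psi> (\<phi> z) = z\<close>, without returning to generators.\<close>
    show "L.face 1 0 (\<phi> z) = E.retr z" "L.face 1 1 (\<phi> z) = E.\<Theta> z" if "z \<in> carrier E" for z
      using \<psi>.f_d0[OF \<phi>_in[OF that]] \<psi>.f_d1[OF \<phi>_in[OF that]] \<psi>\<phi>[OF that] by (simp_all only:)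
    show "\<phi> (E.incl g) = L.degen 0 0 g" if "g \<in> carrier (L 0)" for g
      using \<psi>.f_s[OF that] \<phi>\<psi>[OF L.s.hom_closed[OF that]] by (simp only:)
  qed
  have "crossed_iso_over_base L.crossed E.crossed"
    by (rule crossed_iso_over_base_reflexive_graph[OF 1 2 \<phi>\<psi> \<psi>\<phi>])
  then show ?thesis
    using L.proC_crossed_module_crossed E.proC_crossed_module_crossed assms(5)
    by (simp add: L.moore_crossed_eq E.pres_crossed_eq[unfolded assms(5)])
qed

end
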